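(* Let $b:\mathbb{R}^d\to\mathbb{R}^d$, $Z:\mathscr{C}\to\mathbb{R}^d$, $\sigma$ a non-singular real $d\times d$ matrix and $\xi\in\mathscr{C}$ be given, and assume the following. (i) There is $L_1$ with $|b(x)-b(y)|\le L_1|x-y|$ for all $x,y\in\mathbb{R}^d$, and there are constants $C>0$, $\beta\in\mathbb{R}$ with $2\langle x,b(x)\rangle\le C+\beta|x|^2$ for all $x\in\mathbb{R}^d$. (ii) There are $\alpha\in(0,1]$ and $L_2$ with $|Z(\zeta)-Z(\eta)|\le L_2\|\zeta-\eta\|_\infty^\alpha$ for all $\zeta,\eta\in\mathscr{C}$. Let $X$ be the (unique in law) weak solution of $$\mathrm{d}X(t)=\{b(X(t))+Z(X_t)\}\,\mathrm{d}t+\sigma\,\mathrm{d}W(t),\quad t>0,\qquad X_0=\xi,$$ and let $X^{(\delta)}$ be its truncated Euler–Maruyama scheme with stepsize $\delta$ (defined in the context). Then for any $T>0$ such that $$2\,\|\sigma\|_{\rm HS}^2\,\|\sigma^{-1}\|_{\rm HS}^2\,\{(4L_1^2+L_2^2)\mathbf{1}_{\{\alpha=1\}}+L_1^2\mathbf{1}_{\{\alpha\in(0,1)\}}\}<\mathrm{e}^{-(1+\beta T)}/T^2,$$ there exists a constant $C_{2,T}>0$ (independent of $\delta$, $t$, $f$) such that $$|\mathbb{E}f(X(t))-\mathbb{E}f(X^{(\delta)}(t))|\le C_{2,T}\,\sup_{x\in\mathbb{R}^d}|f(x)|\;\delta^{\alpha/2}$$ for all bounded measurable $f:\mathbb{R}^d\to\mathbb{R}$,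 all $t\in[0,T]$ and all admissible stepsizes $\delta$.
   Context: $\tau>0$ is fixed and $\mathscr{C}=C([-\tau,0];\mathbb{R}^d)$ with the uniform norm $\|\cdot\|_\infty$. For $f\in C([-\tau,\infty);\mathbb{R}^d)$ and $t\ge0$, the segment $f_t\in\mathscr{C}$ is $f_t(\theta)=f(t+\theta)$, $\theta\in[-\tau,0]$. $W$ is a $d$-dimensional Brownian motion on a filtered probability space; $\|\cdot\|_{\rm HS}$ is the Hilbert–Schmidt norm of a matrix. Under (i) and (ii) the path-dependent SDE has a unique weak solution. Admissible stepsizes: $\delta\in(0,1)$ of the form $\delta=\tau/M$, $M\in\mathbb{N}$. Put $t_\delta:=\lfloor t/\delta\rfloor\delta$. The truncated Euler–Maruyama scheme is $$\mathrm{d}X^{(\delta)}(t)=\{b(X^{(\delta)}(t_\delta))+Z(\hat X^{(\delta)}_{t})\}\,\mathrm{d}t+\sigma\,\mathrm{d}W(t),\ t>0,\qquad X^{(\delta)}(\theta)=\xi(\theta),\ \theta\in[-\tau,0],$$ where $\hat X^{(\delta)}_t\in\mathscr{C}$ is $\hat X^{(\delta)}_t(\theta):=X^{(\delta)}((t+\theta)\wedge t_\delta)$, $\theta\in[-\tau,0]$. *)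

theory Defs
  imports "HOL-Probability.Probability"
begin

text \<open>
  The space \<open>C([-\<tau>,0]; R^d)\<close> is represented by the functions \<open>real \<Rightarrow> real ^ 'd\<close> that are
  continuous on \<open>{-\<tau>..0}\<close>; their values outside \<open>{-\<tau>..0}\<close> are arbitrary. A functional \<open>Z\<close>
  satisfying the Hoelder condition below takes equal values on functions that agree
  on \<open>{-\<tau>..0}\<close>, so it is the same thing as a functional on \<open>C([-\<tau>,0]; R^d)\<close>.
\<close>

definition seg_space :: "real \<Rightarrow> (real \<Rightarrow> real ^ 'd) set" where
  "seg_space \<tau> = {\<zeta>. continuous_on {-\<tau>..0} \<zeta>}"

definition seg_norm :: "real \<Rightarrow> (real \<Rightarrow> real ^ 'd) \<Rightarrow> real" where
  "seg_norm \<tau> \<zeta> = (SUP \<theta>\<in>{-\<tau>..0}. norm (\<zeta> \<theta>))"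

definition hs_norm :: "real ^ 'n ^ 'm \<Rightarrow> real" where
  "hs_norm A = sqrt (\<Sum>i\<in>UNIV. \<Sum>j\<in>UNIV. (A $ i $ j)\<^sup>2)"

definition segment :: "(real \<Rightarrow> real ^ 'd) \<Rightarrow> real \<Rightarrow> real \<Rightarrow> real ^ 'd" where
  "segment f t = (\<lambda>\<theta>. f (t + \<theta>))"

definition grid_floor :: "real \<Rightarrow> real \<Rightarrow> real" where
  "grid_floor \<delta> t = of_int \<lfloor>t / \<delta>\<rfloor> * \<delta>"

definition truncated_segment :: "real \<Rightarrow> (real \<Rightarrow> real ^ 'd) \<Rightarrow> real \<Rightarrow> real \<Rightarrow> real ^ 'd" where
  "truncated_segment \<delta> f t = (\<lambda>\<theta>. f (min (t + \<theta>) (grid_floor \<delta> t)))"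

definition admissible_stepsize :: "real \<Rightarrow> real \<Rightarrow> bool" where
  "admissible_stepsize \<tau> \<delta> \<longleftrightarrow> 0 < \<delta> \<and> \<delta> < 1 \<and> (\<exists>M::nat. 0 < M \<and> \<delta> = \<tau> / real M)"

text \<open>
  Filtrations are indexed by \<open>real\<close>, as the library's time index is a type; only the times \<open>t \<ge> 0\<close>
  are used, and a filtration on \<open>[0,\<infinity>)\<close> extends to \<open>real\<close> by \<open>F t = F 0\<close> for \<open>t < 0\<close>.
\<close>

definition filtered_prob_space :: "'w measure \<Rightarrow> (real \<Rightarrow> 'w measure) \<Rightarrow> bool" where
  "filtered_prob_space M F \<longleftrightarrow>
     prob_space M \<and> filtration (space M) F \<and> (\<forall>t. subalgebra M (F t))"

text \<open>
  The product density below says that \<open>W t - W s\<close> has the centred Gaussian law on \<open>R^d\<close> with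
  covariance matrix \<open>(t - s) I\<close>; the second parameter of \<open>normal_density\<close> is the standard deviation.
\<close>

definition brownian_motion ::
  "'w measure \<Rightarrow> (real \<Rightarrow> 'w measure) \<Rightarrow> (real \<Rightarrow> 'w \<Rightarrow> real ^ 'd) \<Rightarrow> bool" where
  "brownian_motion M F W \<longleftrightarrow>
     (\<forall>t\<ge>0. W t \<in> borel_measurable (F t)) \<and>
     (AE \<omega> in M. W 0 \<omega> = 0) \<and>
     (AE \<omega> in M. continuous_on {0..} (\<lambda>t. W t \<omega>)) \<and>
     (\<forall>s t. 0 \<le> s \<and> s < t \<longrightarrow>
        prob_space.indep_set M (sets (F s))
          (sets (vimage_algebra (space M) (\<lambda>\<omega>. W t \<omega> - W s \<omega>) borel)) \<and>
        distributed M lborel (\<lambda>\<omega>. W t \<omega> - W s \<omega>)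
          (\<lambda>x. ennreal (\<Prod>i\<in>UNIV. normal_density 0 (sqrt (t - s)) (x $ i))))"

text \<open>
  \<open>additive_sde M \<tau> \<xi> \<sigma> W G X\<close>: the process \<open>X\<close>, indexed by \<open>[-\<tau>,\<infinity>)\<close>, solves
  \<open>dX(t) = G(X,t) dt + \<sigma> dW(t)\<close>, \<open>t > 0\<close>, with \<open>X = \<xi>\<close> on \<open>[-\<tau>,0]\<close>. As \<open>\<sigma>\<close> is constant, the
  stochastic integral over \<open>[0,t]\<close> is \<open>\<sigma> (W t - W 0)\<close>. The drift \<open>G\<close> receives the whole path of \<open>X\<close>
  and the time.
\<close>

definition additive_sde ::
  "'w measure \<Rightarrow> real \<Rightarrow> (real \<Rightarrow> real ^ 'd) \<Rightarrow> real ^ 'd ^ 'd \<Rightarrow> (real \<Rightarrow> 'w \<Rightarrow> real ^ 'd) \<Rightarrow>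
   ((real \<Rightarrow> real ^ 'd) \<Rightarrow> real \<Rightarrow> real ^ 'd) \<Rightarrow> (real \<Rightarrow> 'w \<Rightarrow> real ^ 'd) \<Rightarrow> bool" where
  "additive_sde M \<tau> \<xi> \<sigma> W G X \<longleftrightarrow>
     (\<forall>t\<ge>-\<tau>. X t \<in> borel_measurable M) \<and>
     (AE \<omega> in M.
        continuous_on {-\<tau>..} (\<lambda>t. X t \<omega>) \<and>
        (\<forall>\<theta>\<in>{-\<tau>..0}. X \<theta> \<omega> = \<xi> \<theta>) \<and>
        (\<forall>t\<ge>0. set_integrable lborel {0..t} (\<lambda>s. G (\<lambda>r. X r \<omega>) s) \<and>
           X t \<omega> = \<xi> 0 + (LINT s:{0..t}|lborel. G (\<lambda>r. X r \<omega>) s)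
                    + \<sigma> *v (W t \<omega> - W 0 \<omega>)))"

definition weak_solution ::
  "real \<Rightarrow> (real ^ 'd \<Rightarrow> real ^ 'd) \<Rightarrow> ((real \<Rightarrow> real ^ 'd) \<Rightarrow> real ^ 'd) \<Rightarrow> real ^ 'd ^ 'd \<Rightarrow>
   (real \<Rightarrow> real ^ 'd) \<Rightarrow> 'w measure \<Rightarrow> (real \<Rightarrow> 'w measure) \<Rightarrow>
   (real \<Rightarrow> 'w \<Rightarrow> real ^ 'd) \<Rightarrow> (real \<Rightarrow> 'w \<Rightarrow> real ^ 'd) \<Rightarrow> bool" where
  "weak_solution \<tau> b Z \<sigma> \<xi> M F W X \<longleftrightarrow>
     filtered_prob_space M F \<and> brownian_motion M F W \<and>
     (\<forall>t\<ge>0. X t \<in> borel_measurable (F t)) \<and>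
     additive_sde M \<tau> \<xi> \<sigma> W (\<lambda>f t. b (f t) + Z (segment f t)) X"

text \<open>
  Adaptedness is not required here: the recursion determines the scheme almost surely from the
  driving Brownian motion.
\<close>

definition truncated_EM_scheme ::
  "real \<Rightarrow> (real ^ 'd \<Rightarrow> real ^ 'd) \<Rightarrow> ((real \<Rightarrow> real ^ 'd) \<Rightarrow> real ^ 'd) \<Rightarrow> real ^ 'd ^ 'd \<Rightarrow>
   (real \<Rightarrow> real ^ 'd) \<Rightarrow> real \<Rightarrow> 'w measure \<Rightarrow> (real \<Rightarrow> 'w measure) \<Rightarrow>
   (real \<Rightarrow> 'w \<Rightarrow> real ^ 'd) \<Rightarrow> (real \<Rightarrow> 'w \<Rightarrow> real ^ 'd) \<Rightarrow> bool" where
  "truncated_EM_scheme \<tau> b Z \<sigma> \<xi> \<delta> M F W X \<longleftrightarrow>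
     filtered_prob_space M F \<and> brownian_motion M F W \<and>
     additive_sde M \<tau> \<xi> \<sigma> W (\<lambda>f t. b (f (grid_floor \<delta> t)) + Z (truncated_segment \<delta> f t)) X"

end

theory Submission
  imports Defs
begin

text \<open>
  On a grid of mesh \<open>\<eta> = \<delta> / n\<close>, the solution \<open>X\<close> is, up to an error that vanishes as \<open>n \<longlongrightarrow> \<infinity>\<close>,
  the Euler--Maruyama recursion driven by the noise increments \<open>\<Delta>W + \<eta> \<sigma>\<^sup>-\<^sup>1 g\<close>, where the adapted gap \<open>g\<close> is
  the difference of the true and the truncated drift along \<open>X\<close>, whereas the scheme is the same recursion
  driven by \<open>\<Delta>V\<close>. An elementary change of measure on the grid bounds the total variation distance
  between the two driving noises by the square root of their relative entropy, which is at most a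
  constant times \<open>\<integral> E |g|\<^sup>2 ds\<close>. The gap only involves the increments of \<open>X\<close> over a time
  \<open>\<delta>\<close>, so \<open>E |g|\<^sup>2\<close> is of order \<open>\<delta>\<^sup>\<alpha>\<close>, which gives the rate \<open>\<delta>\<^sup>\<alpha>\<^sup>/\<^sup>2\<close> for continuous \<open>f\<close>, and then for
  bounded measurable \<open>f\<close>. As the density on the grid is an exponential of a finite sum, no exponential
  moment is needed.
\<close>

section \<open>Interpolated paths and discretized drifts\<close>

text \<open>The solution and the scheme live on unrelated probability spaces, so only laws can be
  compared. Hence both processes are produced by one deterministic map \<open>em_path\<close> from
  increment sequences, and the comparison takes place between two laws of such sequences. The
  entropy is E(-ln D) under the original measure, D being the density of the tilted one. The terms
  linear in the increments have mean zero there, and a second moment of g along X remains. It is a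
  sum of terms of order \<eta> E|g|^2, hence bounded uniformly in n, which lets n tend to infinity
  with \<delta> fixed. The obstacle to that limit is that Z is only Hoelder, so a Gronwall argument
  cannot control small errors in the recursion. The truncation helps: within a block of length
  \<delta> the drift reads nothing later than the start of the block. An error thus passes through a
  fixed number of blocks, each by a map that is continuous at 0. Convergence of the recursion is
  almost sure, which is why continuous f come first; other f are approximated in L1 of the average
  of the two laws.\<close>

definition clamp01 :: "real \<Rightarrow> real" where
  "clamp01 u = max 0 (min 1 u)"

text \<open>Linear interpolation of the grid values \<open>S\<close> after \<open>\<xi>\<close>, frozen from time \<open>m * \<eta>\<close> on. The clamped
  form makes it continuous for every \<open>S\<close>, even if \<open>S 0 \<noteq> \<xi> 0\<close>.\<close>

definition interp :: "(real \<Rightarrow> 'a::real_normed_vector) \<Rightarrow> real \<Rightarrow> nat \<Rightarrow> (nat \<Rightarrow> 'a) \<Rightarrow> real \<Rightarrow> 'a" where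
  "interp \<xi> \<eta> m S r = \<xi> (min r 0) + (\<Sum>l<m. clamp01 (r / \<eta> - real l) *\<^sub>R (S (Suc l) - S l))"

lemma clamp01_bounds: "0 \<le> clamp01 u" "clamp01 u \<le> 1"
  by (auto simp: clamp01_def)

lemma clamp01_simps: "u \<le> 0 \<Longrightarrow> clamp01 u = 0" "1 \<le> u \<Longrightarrow> clamp01 u = 1"
  by (auto simp: clamp01_def)

lemma continuous_on_clamp01 [continuous_intros]:
  "continuous_on A f \<Longrightarrow> continuous_on A (\<lambda>x. clamp01 (f x))"
  unfolding clamp01_def by (intro continuous_intros)

lemma clamp_sum_saturated:
  assumes "a \<le> m" "real m \<le> u"
  shows "E a + (\<Sum>l=a..<m. clamp01 (u - real l) *\<^sub>R (E (Suc l) - E l)) = (E m :: 'a::real_normed_vector)"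
proof -
  have "(\<Sum>l=a..<m. clamp01 (u - real l) *\<^sub>R (E (Suc l) - E l)) = (\<Sum>l=a..<m. E (Suc l) - E l)"
    using assms by (intro sum.cong refl) (auto simp: clamp01_simps)
  also have "\<dots> = E m - E a" using assms(1) by (rule sum_Suc_diff')
  finally show ?thesis by simp
qed

text \<open>At most one weight lies strictly between 0 and 1: the earlier ones are 1 and telescope,
  the later ones are 0. The value is thus a point on a segment between consecutive
  \<open>E k\<close> and \<open>E (Suc k)\<close>. Applied to balls, this turns bounds at grid
  points into bounds at all times.\<close>

lemma clamp_sum_in_convex:
  fixes E :: "nat \<Rightarrow> 'a::real_normed_vector"
  assumes "convex C" "\<And>l. a \<le> l \<Longrightarrow> l \<le> m \<Longrightarrow> E l \<in> C" "a \<le> m"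
  shows "E a + (\<Sum>l=a..<m. clamp01 (u - real l) *\<^sub>R (E (Suc l) - E l)) \<in> C"
  using \<open>a \<le> m\<close> assms(2)
proof (induction m rule: dec_induct)
  case base
  then show ?case by simp
next
  case (step k)
  show ?case
  proof (cases "u \<le> real k")
    case True
    then have "clamp01 (u - real k) = 0" by (simp add: clamp01_simps)
    then show ?thesis using step by (simp add: sum.atLeastLessThan_Suc)
  next
    case False
    define c where "c = clamp01 (u - real k)"
    have "E a + (\<Sum>l=a..<Suc k. clamp01 (u - real l) *\<^sub>R (E (Suc l) - E l)) = E k + c *\<^sub>R (E (Suc k) - E k)"
      using clamp_sum_saturated[of a k u E] step False
      by (simp add: sum.atLeastLessThan_Suc c_def flip: add.assoc)
    also have "\<dots> = (1 - c) *\<^sub>R E k + c *\<^sub>R E (Suc k)" by (simp add: algebra_simps)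
    also have "\<dots> \<in> C"
      using assms(1) step clamp01_bounds[of "u - real k"]
      by (intro convexD_alt) (auto simp: c_def)
    finally show ?thesis .
  qed
qed

lemma interp_nonpos: "r \<le> 0 \<Longrightarrow> \<eta> > 0 \<Longrightarrow> interp \<xi> \<eta> m S r = \<xi> r"
proof -
  assume r: "r \<le> 0" "\<eta> > 0"
  then have "r / \<eta> \<le> 0" by (simp add: divide_nonpos_pos)
  then have "clamp01 (r / \<eta> - real l) = 0" for l by (intro clamp01_simps) linarith
  with r show ?thesis by (simp add: interp_def)
qed

lemma continuous_on_interp:
  assumes "continuous_on {-\<tau>..0} \<xi>" "\<eta> > 0" "\<tau> > 0"
  shows "continuous_on {-\<tau>..} (interp \<xi> \<eta> m S)"
proof -
  have "continuous_on {-\<tau>..} (\<lambda>r. \<xi> (min r 0))"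
    using assms(3)
    by (intro continuous_on_compose2[OF assms(1)] continuous_intros) auto
  then show ?thesis
    unfolding interp_def[abs_def] using assms(2)
    by (intro continuous_intros) auto
qed

text \<open>The terms with \<open>\<xi>\<close> cancel, and the difference interpolates
  \<open>E l = S l - S' l\<close>, which starts at 0 and has all its nodes in the ball.\<close>

lemma interp_diff_bound:
  assumes "S 0 = S' 0" "\<And>l. l \<le> m \<Longrightarrow> norm (S l - S' l) \<le> \<epsilon>"
  shows "norm (interp \<xi> \<eta> m S r - interp \<xi> \<eta> m S' r) \<le> \<epsilon>"
proof -
  define E where "E l = S l - S' l" for l
  have "E 0 + (\<Sum>l=0..<m. clamp01 (r/\<eta> - real l) *\<^sub>R (E (Suc l) - E l)) \<in> cball 0 \<epsilon>"
    using assms by (intro clamp_sum_in_convex) (auto simp: E_def)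
  moreover have "(\<Sum>l=0..<m. clamp01 (r/\<eta> - real l) *\<^sub>R (E (Suc l) - E l)) =
      interp \<xi> \<eta> m S r - interp \<xi> \<eta> m S' r"
    unfolding interp_def E_def atLeast0LessThan
    by (simp add: sum_subtractf[symmetric] scaleR_diff_right[symmetric] algebra_simps del: scaleR_diff_right)
  ultimately show ?thesis using assms(1) by (simp add: E_def)
qed

text \<open>The two interpolations share the terms below \<open>a\<close>. The remaining terms,
  started at \<open>S a\<close>, stay in a ball around \<open>S a\<close>.\<close>

lemma interp_stop_diff_bound:
  assumes "a \<le> m" "\<And>l. a \<le> l \<Longrightarrow> l \<le> m \<Longrightarrow> norm (S l - S a) \<le> \<epsilon>"
  shows "norm (interp \<xi> \<eta> m S r - interp \<xi> \<eta> a S r) \<le> \<epsilon>"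
proof -
  have "S a + (\<Sum>l=a..<m. clamp01 (r/\<eta> - real l) *\<^sub>R (S (Suc l) - S l)) \<in> cball (S a) \<epsilon>"
    using assms by (intro clamp_sum_in_convex) (auto simp: dist_norm norm_minus_commute)
  moreover have "(\<Sum>l=a..<m. clamp01 (r/\<eta> - real l) *\<^sub>R (S (Suc l) - S l)) =
      interp \<xi> \<eta> m S r - interp \<xi> \<eta> a S r"
  proof -
    have "{..<m} = {..<a} \<union> {a..<m}" using assms(1) by auto
    then show ?thesis unfolding interp_def by (simp add: sum.union_disjoint ivl_disj_int)
  qed
  ultimately show ?thesis by (simp add: dist_norm norm_minus_commute)
qed

text \<open>Between two nodes the interpolation is a convex combination of two values of
  \<open>y\<close> at times within \<eta> of the current one; from \<open>real m * \<eta>\<close> on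
  both paths are frozen. The condition \<open>y 0 = \<xi> 0\<close> makes the telescoped sum start
  correctly.\<close>

lemma interp_approx:
  fixes y :: "real \<Rightarrow> 'a::real_normed_vector"
  assumes "\<eta> > 0" "y 0 = \<xi> 0" "0 \<le> r"
    and "\<And>u v. 0 \<le> u \<Longrightarrow> u \<le> real m * \<eta> \<Longrightarrow> 0 \<le> v \<Longrightarrow> v \<le> real m * \<eta> \<Longrightarrow> \<bar>u - v\<bar> \<le> \<eta> \<Longrightarrow> norm (y u - y v) \<le> \<omega>"
  shows "norm (interp \<xi> \<eta> m (\<lambda>l. y (real l * \<eta>)) r - y (min r (real m * \<eta>))) \<le> \<omega>"
  using assms(4)
proof (induction m)
  case 0
  show ?case using assms 0[of 0 0] by (simp add: interp_def min_def)
next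
  case (Suc m)
  define S where "S = (\<lambda>l. y (real l * \<eta>))"
  have le: "real m * \<eta> \<le> real (Suc m) * \<eta>" using assms(1) by (simp add: mult_right_mono)
  show ?case
  proof (cases "r \<le> real m * \<eta>")
    case True
    then have "clamp01 (r / \<eta> - real m) = 0" using assms(1) by (simp add: clamp01_simps field_simps)
    then have "interp \<xi> \<eta> (Suc m) S r = interp \<xi> \<eta> m S r" by (simp add: interp_def)
    moreover have "min r (real (Suc m) * \<eta>) = min r (real m * \<eta>)" using True le by simp
    moreover have "norm (interp \<xi> \<eta> m S r - y (min r (real m * \<eta>))) \<le> \<omega>"
      unfolding S_def using le by (intro Suc.IH Suc.prems) auto
    ultimately show ?thesis by (simp add: S_def)
  next
    case False
    define c where "c = clamp01 (r / \<eta> - real m)"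
    define r' where "r' = min r (real (Suc m) * \<eta>)"
    have m_le: "real m \<le> r / \<eta>" using False assms(1) by (simp add: field_simps)
    have "S 0 + (\<Sum>l=0..<m. clamp01 (r/\<eta> - real l) *\<^sub>R (S (Suc l) - S l)) = S m"
      using m_le by (intro clamp_sum_saturated) auto
    then have "interp \<xi> \<eta> (Suc m) S r = S m + c *\<^sub>R (S (Suc m) - S m)"
      using assms(2,3) by (simp add: interp_def S_def c_def atLeast0LessThan min_absorb2 flip: add.assoc)
    also have "\<dots> = (1 - c) *\<^sub>R S m + c *\<^sub>R S (Suc m)" by (simp add: algebra_simps)
    also have "\<dots> \<in> cball (y r') \<omega>"
    proof (rule convexD_alt)
      have r': "real m * \<eta> \<le> r'" "r' \<le> real (Suc m) * \<eta>" using False le by (auto simp: r'_def)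
      have "0 \<le> real m * \<eta>" using assms(1) by simp
      with r' have r0: "0 \<le> r'" by simp
      show "S m \<in> cball (y r') \<omega>" "S (Suc m) \<in> cball (y r') \<omega>"
        using r' r0 le assms(1) unfolding S_def mem_cball dist_norm
        by (auto intro!: Suc.prems simp: algebra_simps)
    qed (auto simp: c_def clamp01_bounds)
    finally show ?thesis by (simp add: r'_def S_def dist_norm norm_minus_commute)
  qed
qed

text \<open>The constants are nonnegative so that the bounds can be used monotonically; any
  Lipschitz and Hoelder constants fit after passing to absolute values.\<close>

locale delay_drift =
  fixes b :: "real ^ 'd \<Rightarrow> real ^ 'd"
    and Z :: "(real \<Rightarrow> real ^ 'd) \<Rightarrow> real ^ 'd"
    and \<xi> :: "real \<Rightarrow> real ^ 'd"
    and \<tau> L1 L2 \<alpha> :: real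
  assumes \<tau>_pos: "\<tau> > 0"
    and \<xi>_cont: "continuous_on {-\<tau>..0} \<xi>"
    and b_lipschitz: "\<And>x y. norm (b x - b y) \<le> L1 * norm (x - y)"
    and L1_nonneg: "0 \<le> L1"
    and Z_hoelder: "\<And>\<zeta> \<eta>. \<zeta> \<in> seg_space \<tau> \<Longrightarrow> \<eta> \<in> seg_space \<tau> \<Longrightarrow>
           norm (Z \<zeta> - Z \<eta>) \<le> L2 * seg_norm \<tau> (\<lambda>\<theta>. \<zeta> \<theta> - \<eta> \<theta>) powr \<alpha>"
    and L2_nonneg: "0 \<le> L2"
    and \<alpha>_pos: "0 < \<alpha>" and \<alpha>_le_1: "\<alpha> \<le> 1"
begin

text \<open>Lets later estimates of \<open>Z\<close> work with pointwise bounds. Monotonicity of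
  \<open>powr\<close> needs the supremum to be nonnegative, hence the second step.\<close>

lemma Z_diff_le:
  assumes "\<zeta> \<in> seg_space \<tau>" "\<zeta>' \<in> seg_space \<tau>" "\<And>\<theta>. -\<tau> \<le> \<theta> \<Longrightarrow> \<theta> \<le> 0 \<Longrightarrow> norm (\<zeta> \<theta> - \<zeta>' \<theta>) \<le> \<epsilon>"
  shows "norm (Z \<zeta> - Z \<zeta>') \<le> L2 * \<epsilon> powr \<alpha>"
proof -
  have "seg_norm \<tau> (\<lambda>\<theta>. \<zeta> \<theta> - \<zeta>' \<theta>) \<le> \<epsilon>"
    unfolding seg_norm_def using \<tau>_pos assms(3) by (intro cSUP_least) auto
  moreover have "0 \<le> seg_norm \<tau> (\<lambda>\<theta>. \<zeta> \<theta> - \<zeta>' \<theta>)"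
    unfolding seg_norm_def using \<tau>_pos assms(3)
    by (intro cSUP_upper2[of _ _ 0] bdd_aboveI2[of _ _ \<epsilon>]) auto
  ultimately have "L2 * seg_norm \<tau> (\<lambda>\<theta>. \<zeta> \<theta> - \<zeta>' \<theta>) powr \<alpha> \<le> L2 * \<epsilon> powr \<alpha>"
    using \<alpha>_pos L2_nonneg by (intro mult_left_mono powr_mono2) auto
  with Z_hoelder[OF assms(1,2)] show ?thesis by linarith
qed

text \<open>Distance 0 on \<open>{-\<tau>..0}\<close> gives the Hoelder bound
  \<open>0 powr \<alpha> = 0\<close>, so values outside the interval do not influence
  \<open>Z\<close>.\<close>

lemma Z_cong:
  assumes "\<zeta> \<in> seg_space \<tau>" "\<And>\<theta>. -\<tau> \<le> \<theta> \<Longrightarrow> \<theta> \<le> 0 \<Longrightarrow> \<zeta> \<theta> = \<zeta>' \<theta>"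
  shows "Z \<zeta> = Z \<zeta>'"
proof -
  have "\<zeta>' \<in> seg_space \<tau>" using assms unfolding seg_space_def
    by (auto intro: continuous_on_eq)
  from Z_diff_le[OF assms(1) this, of 0] assms(2) show ?thesis by simp
qed

text \<open>Drift at the grid time \<open>j * \<eta>\<close> with the path frozen at \<open>c * \<eta>\<close>: the SDE has \<open>c = j\<close>, the truncated
  scheme has \<open>c = n * (j div n)\<close> when \<open>\<delta> = n * \<eta>\<close>.\<close>

definition disc_drift :: "real \<Rightarrow> nat \<Rightarrow> nat \<Rightarrow> (nat \<Rightarrow> real ^ 'd) \<Rightarrow> real ^ 'd" where
  "disc_drift \<eta> c j S = b (S c) + Z (\<lambda>\<theta>. interp \<xi> \<eta> c S (real j * \<eta> + \<theta>))"

lemma interp_seg: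
  assumes "\<eta> > 0"
  shows "(\<lambda>\<theta>. interp \<xi> \<eta> c S (real j * \<eta> + \<theta>)) \<in> seg_space \<tau>"
proof -
  have "continuous_on {-\<tau>..0} (\<lambda>\<theta>. real j * \<eta> + \<theta>)" by (intro continuous_intros)
  moreover have "(\<lambda>\<theta>. real j * \<eta> + \<theta>) ` {-\<tau>..0} \<subseteq> {-\<tau>..}"
  proof (rule image_subsetI)
    fix \<theta> assume "\<theta> \<in> {-\<tau>..0}"
    moreover have "0 \<le> real j * \<eta>" using \<open>\<eta> > 0\<close> by simp
    ultimately show "real j * \<eta> + \<theta> \<in> {-\<tau>..}" unfolding atLeast_iff atLeastAtMost_iff by linarith
  qed
  ultimately show ?thesis
    unfolding seg_space_def mem_Collect_eq
    by (rule continuous_on_compose2[OF continuous_on_interp[OF \<xi>_cont \<open>\<eta> > 0\<close> \<tau>_pos]])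
qed

text \<open>Closeness is asked only for \<open>l \<le> c\<close>, since the drift reads no grid
  value after the freezing index. With \<open>\<epsilon> = 0\<close> this says that those values
  determine the drift.\<close>

lemma disc_drift_diff:
  assumes "\<eta> > 0" "S 0 = S' 0" "\<And>l. l \<le> c \<Longrightarrow> norm (S l - S' l) \<le> \<epsilon>"
  shows "norm (disc_drift \<eta> c j S - disc_drift \<eta> c j S') \<le> L1 * \<epsilon> + L2 * \<epsilon> powr \<alpha>"
proof -
  have "norm (b (S c) - b (S' c)) \<le> L1 * norm (S c - S' c)" by (rule b_lipschitz)
  also have "\<dots> \<le> L1 * \<epsilon>" using assms L1_nonneg by (intro mult_left_mono) auto
  finally have 1: "norm (b (S c) - b (S' c)) \<le> L1 * \<epsilon>" .
  have 2: "norm (Z (\<lambda>\<theta>. interp \<xi> \<eta> c S (real j * \<eta> + \<theta>)) - Z (\<lambda>\<theta>. interp \<xi> \<eta> c S' (real j * \<eta> + \<theta>))) \<le> L2 * \<epsilon> powr \<alpha>"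
    using assms by (intro Z_diff_le interp_seg interp_diff_bound) auto
  show ?thesis unfolding disc_drift_def add_diff_add
    by (rule order_trans[OF norm_triangle_ineq add_mono[OF 1 2]])
qed

text \<open>With \<open>m = j\<close> and \<open>a\<close> the start of the block of
  \<open>j\<close>, this bounds the gap between the true and the truncated drift by the increments
  within the block.\<close>

lemma disc_drift_stop_diff:
  assumes "\<eta> > 0" "a \<le> m" "\<And>l. a \<le> l \<Longrightarrow> l \<le> m \<Longrightarrow> norm (S l - S a) \<le> \<epsilon>"
  shows "norm (disc_drift \<eta> m j S - disc_drift \<eta> a j S) \<le> L1 * \<epsilon> + L2 * \<epsilon> powr \<alpha>"
proof -
  have "norm (b (S m) - b (S a)) \<le> L1 * norm (S m - S a)" by (rule b_lipschitz)
  also have "\<dots> \<le> L1 * \<epsilon>" using assms L1_nonneg by (intro mult_left_mono) auto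
  finally have 1: "norm (b (S m) - b (S a)) \<le> L1 * \<epsilon>" .
  have 2: "norm (Z (\<lambda>\<theta>. interp \<xi> \<eta> m S (real j * \<eta> + \<theta>)) - Z (\<lambda>\<theta>. interp \<xi> \<eta> a S (real j * \<eta> + \<theta>))) \<le> L2 * \<epsilon> powr \<alpha>"
    using assms by (intro Z_diff_le interp_seg interp_stop_diff_bound) auto
  show ?thesis unfolding disc_drift_def add_diff_add
    by (rule order_trans[OF norm_triangle_ineq add_mono[OF 1 2]])
qed

text \<open>The Borel sets on sequences come from the product topology. \<open>Z\<close> is
  continuous for the uniform distance, and that distance between two interpolations is at most the
  finite sum \<open>d k\<close> of increment differences, because every weight is at most 1. So
  coordinatewise convergence suffices.\<close>

lemma disc_drift_measurable:
  assumes "\<eta> > 0"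
  shows "disc_drift \<eta> c j \<in> borel_measurable borel"
proof (rule borel_measurable_continuous_onI)
  show "continuous_on UNIV (disc_drift \<eta> c j)"
    unfolding continuous_on_sequentially
  proof (intro allI ballI impI, elim conjE)
    fix f :: "nat \<Rightarrow> nat \<Rightarrow> real ^ 'd" and S
    assume lim: "f \<longlonglongrightarrow> S"
    have cont: "isCont (\<lambda>S :: nat \<Rightarrow> real ^ 'd. S l) S" for l
      using continuous_on_product_coordinates[of l] continuous_on_eq_continuous_at[OF open_UNIV] by blast
    have l: "(\<lambda>k. f k l) \<longlonglongrightarrow> S l" for l
      using isCont_tendsto_compose[OF cont lim] .
    define d where "d k = (\<Sum>l<c. norm ((f k (Suc l) - f k l) - (S (Suc l) - S l)))" for k
    have d0: "d \<longlonglongrightarrow> 0"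
      unfolding d_def by (intro tendsto_null_sum tendsto_norm_zero LIM_zero tendsto_diff l)
    have "norm (Z (\<lambda>\<theta>. interp \<xi> \<eta> c (f k) (real j * \<eta> + \<theta>)) - Z (\<lambda>\<theta>. interp \<xi> \<eta> c S (real j * \<eta> + \<theta>)))
        \<le> L2 * d k powr \<alpha>" for k
    proof (intro Z_diff_le interp_seg assms)
      fix \<theta>
      let ?r = "(real j * \<eta> + \<theta>) / \<eta>"
      have "interp \<xi> \<eta> c (f k) (real j * \<eta> + \<theta>) - interp \<xi> \<eta> c S (real j * \<eta> + \<theta>)
        = (\<Sum>l<c. clamp01 (?r - real l) *\<^sub>R ((f k (Suc l) - f k l) - (S (Suc l) - S l)))"
        unfolding interp_def by (simp add: sum_subtractf scaleR_diff_right)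
      also have "norm \<dots> \<le> d k" unfolding d_def
        by (rule sum_norm_le) (auto simp: clamp01_bounds intro!: mult_left_le_one_le)
      finally show "norm (interp \<xi> \<eta> c (f k) (real j * \<eta> + \<theta>) - interp \<xi> \<eta> c S (real j * \<eta> + \<theta>)) \<le> d k" .
    qed
    moreover have "(\<lambda>k. L2 * d k powr \<alpha>) \<longlonglongrightarrow> L2 * 0"
    proof (rule tendsto_mult_left)
      show "(\<lambda>k. d k powr \<alpha>) \<longlonglongrightarrow> 0"
        using tendsto_powr'[OF d0 tendsto_const, of \<alpha>] \<alpha>_pos
        by (auto simp: d_def sum_nonneg)
    qed
    ultimately have "(\<lambda>k. Z (\<lambda>\<theta>. interp \<xi> \<eta> c (f k) (real j * \<eta> + \<theta>)) - Z (\<lambda>\<theta>. interp \<xi> \<eta> c S (real j * \<eta> + \<theta>))) \<longlonglongrightarrow> 0"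
      by - (rule Lim_null_comparison[where g="\<lambda>k. L2 * d k powr \<alpha>"], auto)
    then have "(\<lambda>k. Z (\<lambda>\<theta>. interp \<xi> \<eta> c (f k) (real j * \<eta> + \<theta>))) \<longlonglongrightarrow> Z (\<lambda>\<theta>. interp \<xi> \<eta> c S (real j * \<eta> + \<theta>))"
      by (rule LIM_zero_cancel)
    moreover have "(\<lambda>k. b (f k c)) \<longlonglongrightarrow> b (S c)"
    proof -
      have "(\<lambda>k. b (f k c) - b (S c)) \<longlonglongrightarrow> 0"
        by (rule Lim_null_comparison[OF always_eventually[OF allI[OF b_lipschitz]]])
           (rule tendsto_mult_right_zero[OF tendsto_norm_zero[OF LIM_zero[OF l]]])
      then show ?thesis by (rule LIM_zero_cancel)
    qed
    ultimately show "(disc_drift \<eta> c j \<circ> f) \<longlonglongrightarrow> disc_drift \<eta> c j S"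
      unfolding disc_drift_def comp_def by (intro tendsto_add)
  qed
qed

end

section \<open>Convergence of the Euler recursion on finer grids\<close>

lemma powr_le_1_plus:
  assumes "0 \<le> m" "0 \<le> \<alpha>" "\<alpha> \<le> (1::real)"
  shows "m powr \<alpha> \<le> 1 + m"
proof (cases "m \<le> 1")
  case True
  then have "m powr \<alpha> \<le> 1" using assms by (intro powr_le1) auto
  then show ?thesis using assms by linarith
next
  case False
  then have "m powr \<alpha> \<le> m powr 1" using assms by (intro powr_mono) auto
  then show ?thesis using False by simp
qed

lemma ex_modulus_of_continuity:
  fixes y :: "real \<Rightarrow> 'a::real_normed_vector"
  assumes "continuous_on {a..b} y" "\<eta> \<longlonglongrightarrow> 0"
  obtains \<omega> :: "nat \<Rightarrow> real" where "\<omega> \<longlonglongrightarrow> 0" "\<And>k. 0 \<le> \<omega> k"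
    "\<And>k u v. a \<le> u \<Longrightarrow> u \<le> b \<Longrightarrow> a \<le> v \<Longrightarrow> v \<le> b \<Longrightarrow> \<bar>u - v\<bar> \<le> \<eta> k \<Longrightarrow> norm (y u - y v) \<le> \<omega> k"
proof -
  \<comment> \<open>Inserting 0 keeps the set nonempty and its supremum nonnegative even if no pair
    \<open>u\<close>, \<open>v\<close> qualifies.\<close>
  define V where "V k = insert 0 {norm (y u - y v) | u v. u \<in> {a..b} \<and> v \<in> {a..b} \<and> \<bar>u - v\<bar> \<le> \<eta> k}" for k
  have "bounded (y ` {a..b})"
    using assms(1) compact_continuous_image compact_imp_bounded by blast
  then obtain B where B: "\<And>u. u \<in> {a..b} \<Longrightarrow> norm (y u) \<le> B"
    unfolding bounded_iff by blast
  have bdd: "bdd_above (V k)" for k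
  proof (rule bdd_aboveI[of _ "\<bar>2 * B\<bar>"])
    fix z assume "z \<in> V k"
    then consider "z = 0" | u v where "z = norm (y u - y v)" "u \<in> {a..b}" "v \<in> {a..b}" by (auto simp: V_def)
    then show "z \<le> \<bar>2 * B\<bar>"
    proof cases
      case 2
      then show ?thesis using B[of u] B[of v] norm_triangle_ineq4[of "y u" "y v"] by linarith
    qed auto
  qed
  have nn: "0 \<le> Sup (V k)" for k by (rule cSup_upper[OF _ bdd]) (auto simp: V_def)
  show ?thesis
  proof (rule that[of "\<lambda>k. Sup (V k)"])
    show "(\<lambda>k. Sup (V k)) \<longlonglongrightarrow> 0"
    proof (rule LIMSEQ_I)
      fix r :: real assume "0 < r"
      have "uniformly_continuous_on {a..b} y" using assms(1) compact_uniformly_continuous by blast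
      then obtain d where "d > 0"
        and d: "\<And>u v. u \<in> {a..b} \<Longrightarrow> v \<in> {a..b} \<Longrightarrow> dist v u < d \<Longrightarrow> dist (y v) (y u) < r / 2"
        unfolding uniformly_continuous_on_def using \<open>0 < r\<close> by (metis half_gt_zero)
      obtain N where N: "\<And>k. k \<ge> N \<Longrightarrow> norm (\<eta> k - 0) < d"
        using LIMSEQ_D[OF assms(2) \<open>d > 0\<close>] by blast
      have "Sup (V k) \<le> r / 2" if "k \<ge> N" for k
      proof (rule cSup_least)
        fix z assume "z \<in> V k"
        then consider "z = 0" | u v where "z = norm (y u - y v)" "u \<in> {a..b}" "v \<in> {a..b}" "\<bar>u - v\<bar> \<le> \<eta> k"
          by (auto simp: V_def)
        then show "z \<le> r / 2"
        proof cases
          case 2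
          then show ?thesis using d[of v u] N[OF that] by (auto simp: dist_norm)
        qed (use \<open>0 < r\<close> in auto)
      qed (auto simp: V_def)
      then show "\<exists>no. \<forall>k\<ge>no. norm (Sup (V k) - 0) < r"
        using nn \<open>0 < r\<close> by (intro exI[of _ N]) (fastforce simp: abs_of_nonneg)
    qed
    show "norm (y u - y v) \<le> Sup (V k)"
      if "a \<le> u" "u \<le> b" "a \<le> v" "v \<le> b" "\<bar>u - v\<bar> \<le> \<eta> k" for k u v
      using that by (intro cSup_upper[OF _ bdd]) (auto simp: V_def)
  qed (rule nn)
qed

text \<open>A weighted supremum norm replaces Gronwall's inequality.\<close>

lemma apriori_bound:
  fixes y :: "real \<Rightarrow> 'a::euclidean_space"
  assumes "0 < T" "0 \<le> \<tau>" and cont: "continuous_on {-\<tau>..T} y"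
    and init: "\<And>r. -\<tau> \<le> r \<Longrightarrow> r \<le> 0 \<Longrightarrow> norm (y r) \<le> \<Xi>"
    and int: "G integrable_on {0..T}"
    and eq: "\<And>t. 0 \<le> t \<Longrightarrow> t \<le> T \<Longrightarrow> y t = y 0 + integral {0..t} G + N t"
    and N: "\<And>t. 0 \<le> t \<Longrightarrow> t \<le> T \<Longrightarrow> norm (N t) \<le> R"
    and G: "\<And>s m. 0 \<le> s \<Longrightarrow> s \<le> T \<Longrightarrow> (\<And>r. -\<tau> \<le> r \<Longrightarrow> r \<le> s \<Longrightarrow> norm (y r) \<le> m) \<Longrightarrow> norm (G s) \<le> A + B * m"
    and "0 \<le> A" "0 \<le> B" and t: "-\<tau> \<le> t" "t \<le> T"
  shows "norm (y t) \<le> 2 * exp ((2 * B + 1) * T) * (\<Xi> + A * T + R)"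
proof -
  \<comment> \<open>With this weight the drift integral contributes at most half of the weighted
    supremum, because \<open>B / lam \<le> 1 / 2\<close>; that half is absorbed on the left.\<close>
  define lam where "lam = 2 * B + 1"
  have lam: "lam > 0" "B / lam \<le> 1 / 2" using \<open>0 \<le> B\<close> by (auto simp: lam_def field_simps)
  \<comment> \<open>The weight is 1 on the initial segment, where the path is bounded by
    \<open>\<Xi>\<close> directly.\<close>
  define \<phi> where "\<phi> s = exp (- lam * max s 0) * norm (y s)" for s
  have "continuous_on {-\<tau>..T} \<phi>" unfolding \<phi>_def by (intro continuous_intros cont)
  moreover have "{-\<tau>..T} \<noteq> {}" using assms by auto
  ultimately obtain u where u: "-\<tau> \<le> u" "u \<le> T" and sup: "\<And>s. -\<tau> \<le> s \<Longrightarrow> s \<le> T \<Longrightarrow> \<phi> s \<le> \<phi> u"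
    using continuous_attains_sup[of "{-\<tau>..T}" \<phi>] by force
  define c where "c = \<phi> u"
  have c0: "0 \<le> c" by (simp add: c_def \<phi>_def)
  have bnd: "norm (y r) \<le> c * exp (lam * max r 0)" if "-\<tau> \<le> r" "r \<le> T" for r
    using sup[OF that] unfolding c_def[symmetric] by (simp add: \<phi>_def exp_minus field_simps)
  have bnd': "norm (y r) \<le> c * exp (lam * s)" if "-\<tau> \<le> r" "r \<le> s" "0 \<le> s" "s \<le> T" for r s
  proof -
    have "c * exp (lam * max r 0) \<le> c * exp (lam * s)" using that lam c0 by (intro mult_left_mono) auto
    then show ?thesis using bnd[of r] that by linarith
  qed
  have \<Xi>0: "0 \<le> \<Xi>" using order_trans[OF norm_ge_zero init[of 0]] \<open>0 \<le> \<tau>\<close> by simp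
  have R0: "0 \<le> R" using order_trans[OF norm_ge_zero N[of 0]] \<open>0 < T\<close> by simp
  define K where "K = \<Xi> + A * T + R"
  have AT0: "0 \<le> A * T" using assms by simp
  have K0: "0 \<le> K" using \<Xi>0 R0 AT0 by (simp add: K_def)
  have c_le: "c \<le> 2 * K"
  proof (cases "u \<le> 0")
    case True
    then have "c = norm (y u)" by (simp add: c_def \<phi>_def)
    then show ?thesis using init[OF u(1) True] K0 R0 AT0 by (simp add: K_def)
  next
    case False
    \<comment> \<open>An antiderivative of \<open>A + B * (c * exp (lam * s))\<close>, the bound on
      \<open>G s\<close> that results from the maximality of \<open>c\<close>.\<close>
    define H where "H s = A * s + B * c / lam * exp (lam * s)" for s
    have "((\<lambda>s. A + B * (c * exp (lam * s))) has_integral (H u - H 0)) {0..u}"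
    proof (rule fundamental_theorem_of_calculus)
      fix x
      have "(H has_real_derivative (A + B * (c * exp (lam * x)))) (at x within {0..u})"
        unfolding H_def using lam by (auto intro!: derivative_eq_intros)
      then show "(H has_vector_derivative (A + B * (c * exp (lam * x)))) (at x within {0..u})"
        by (simp add: has_real_derivative_iff_has_vector_derivative)
    qed (use False in auto)
    moreover have "G integrable_on {0..u}" using u by (intro integrable_on_subinterval[OF int]) auto
    ultimately have "norm (integral {0..u} G) \<le> integral {0..u} (\<lambda>s. A + B * (c * exp (lam * s)))"
      using u bnd' by (intro integral_norm_bound_integral G) (auto simp: integrable_on_def)
    also have "\<dots> = H u - H 0" using \<open>(_ has_integral _) _\<close> by (rule integral_unique)
    also have "\<dots> \<le> A * u + B / lam * c * exp (lam * u)" using lam c0 \<open>0 \<le> B\<close> by (simp add: H_def)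
    also have "\<dots> \<le> A * T + 1 / 2 * (c * exp (lam * u))"
      using lam c0 u \<open>0 \<le> A\<close> unfolding mult.assoc by (intro add_mono mult_left_mono mult_right_mono) auto
    finally have I: "norm (integral {0..u} G) \<le> A * T + 1 / 2 * (c * exp (lam * u))" .
    have "c * exp (lam * u) = norm (y u)" using False by (simp add: c_def \<phi>_def exp_minus field_simps)
    also have "\<dots> \<le> norm (y 0) + norm (integral {0..u} G) + norm (N u)"
      using eq[of u] False u norm_triangle_ineq[of "y 0 + integral {0..u} G" "N u"] norm_triangle_ineq[of "y 0" "integral {0..u} G"]
      by auto
    also have "\<dots> \<le> K + 1 / 2 * (c * exp (lam * u))"
      using I init[of 0] N[of u] False u \<open>0 \<le> \<tau>\<close> by (simp add: K_def)
    finally have "c * exp (lam * u) \<le> 2 * K" by simp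
    moreover have "c * 1 \<le> c * exp (lam * u)" using False lam c0 by (intro mult_left_mono) auto
    ultimately show ?thesis by simp
  qed
  have "norm (y t) \<le> c * exp (lam * T)" using t \<open>0 < T\<close> by (intro bnd') auto
  also have "\<dots> \<le> 2 * K * exp (lam * T)" using c_le by (intro mult_right_mono) auto
  finally show ?thesis unfolding K_def lam_def by (simp add: algebra_simps)
qed

context delay_drift
begin

section \<open>Riemann sums of the drift and stability of the explicit recursion\<close>

lemma path_seg:
  assumes "continuous_on {-\<tau>..T} y" "0 \<le> s" "s \<le> T" "0 \<le> g" "g \<le> s"
  shows "(\<lambda>\<theta>. y (min (s + \<theta>) g)) \<in> seg_space \<tau>"
  unfolding seg_space_def mem_Collect_eq using assms
  by (intro continuous_on_compose2[OF assms(1)] continuous_intros) auto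

lemma Z_growth:
  assumes "\<zeta> \<in> seg_space \<tau>" "\<And>\<theta>. -\<tau> \<le> \<theta> \<Longrightarrow> \<theta> \<le> 0 \<Longrightarrow> norm (\<zeta> \<theta>) \<le> m"
  shows "norm (Z \<zeta>) \<le> norm (Z (\<lambda>_. 0)) + L2 * (1 + m)"
proof -
  have "0 \<le> m" using order_trans[OF norm_ge_zero assms(2)[of 0]] \<tau>_pos by simp
  have "norm (Z \<zeta> - Z (\<lambda>_. 0)) \<le> L2 * m powr \<alpha>"
    using assms by (intro Z_diff_le) (auto simp: seg_space_def)
  also have "\<dots> \<le> L2 * (1 + m)"
    using L2_nonneg \<open>0 \<le> m\<close> \<alpha>_pos \<alpha>_le_1 by (intro mult_left_mono powr_le_1_plus) auto
  finally show ?thesis using norm_triangle_ineq2[of "Z \<zeta>" "Z (\<lambda>_. 0)"] by linarith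
qed

lemma b_growth: "norm (x) \<le> m \<Longrightarrow> norm (b x) \<le> norm (b 0) + L1 * m"
  using b_lipschitz[of x 0] mult_left_mono[OF _ L1_nonneg, of "norm x" m] norm_triangle_ineq2[of "b x" "b 0"] by simp

text \<open>One statement for both processes: \<open>\<gamma> s\<close> is the time at which the
  path is frozen and \<open>c j\<close> the corresponding grid index. The solution has
  \<open>\<gamma> s = s\<close> and \<open>c j = j\<close>, the scheme has \<open>grid_floor\<close>
  and the start of the block. The error in one cell is \<eta> times the oscillation of the drift on
  it, and the induction adds up the cells.\<close>

lemma riemann_sum_drift:
  assumes \<eta>: "\<eta> > 0" and y0: "\<And>r. -\<tau> \<le> r \<Longrightarrow> r \<le> 0 \<Longrightarrow> y r = \<xi> r"
    and cont: "continuous_on {-\<tau>..T} y" and \<omega>: "0 \<le> \<omega>"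
    and modulus: "\<And>u v. -\<tau> \<le> u \<Longrightarrow> u \<le> T \<Longrightarrow> -\<tau> \<le> v \<Longrightarrow> v \<le> T \<Longrightarrow> \<bar>u - v\<bar> \<le> \<eta> \<Longrightarrow> norm (y u - y v) \<le> \<omega>"
    and int: "G integrable_on {0..T}"
    and G: "\<And>s. 0 \<le> s \<Longrightarrow> s \<le> T \<Longrightarrow> G s = b (y (\<gamma> s)) + Z (\<lambda>\<theta>. y (min (s + \<theta>) (\<gamma> s)))"
    and c: "\<And>j. c j \<le> j"
    and \<gamma>: "\<And>j s. real j * \<eta> \<le> s \<Longrightarrow> s < real (Suc j) * \<eta> \<Longrightarrow> \<bar>\<gamma> s - real (c j) * \<eta>\<bar> \<le> \<eta> \<and> 0 \<le> \<gamma> s \<and> \<gamma> s \<le> s"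
    and i: "real i * \<eta> \<le> T"
  shows "norm (integral {0..real i * \<eta>} G - (\<Sum>j<i. \<eta> *\<^sub>R disc_drift \<eta> (c j) j (\<lambda>l. y (real l * \<eta>))))
    \<le> real i * \<eta> * (L1 * \<omega> + L2 * (2 * \<omega>) powr \<alpha>)"
  using i
proof (induction i)
  case 0
  then show ?case by simp
next
  case (Suc i)
  define x where "x l = y (real l * \<eta>)" for l
  define D where "D = disc_drift \<eta> (c i) i x"
  define K where "K = L1 * \<omega> + L2 * (2 * \<omega>) powr \<alpha>"
  define p where "p = real i * \<eta>"
  define q where "q = real (c i) * \<eta>"
  have Suc_p: "real (Suc i) * \<eta> = p + \<eta>" by (simp add: p_def algebra_simps)
  have p0: "0 \<le> p" "p + \<eta> \<le> T" using \<eta> Suc.prems by (auto simp: p_def algebra_simps)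
  have q0: "0 \<le> q" "q \<le> p" using \<eta> c[of i] by (auto simp: q_def p_def)
  have K0: "0 \<le> K" using L1_nonneg L2_nonneg \<omega> by (simp add: K_def)
  have close: "norm (G s - D) \<le> K" if s: "p \<le> s" "s < p + \<eta>" for s
  proof -
    have g: "\<bar>\<gamma> s - q\<bar> \<le> \<eta>" "0 \<le> \<gamma> s" "\<gamma> s \<le> s" using \<gamma>[of i s] s by (auto simp: p_def q_def algebra_simps)
    have "norm (b (y (\<gamma> s)) - b (x (c i))) \<le> L1 * norm (y (\<gamma> s) - y q)" unfolding x_def q_def by (rule b_lipschitz)
    also have "\<dots> \<le> L1 * \<omega>" using g q0 p0 s \<tau>_pos L1_nonneg by (intro mult_left_mono modulus) auto
    finally have 1: "norm (b (y (\<gamma> s)) - b (x (c i))) \<le> L1 * \<omega>" .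
    \<comment> \<open>Twice the modulus: once for moving the evaluation time from
      \<open>min (s + \<theta>) (\<gamma> s)\<close> to \<open>min (p + \<theta>) q\<close>, once
      for replacing the path by its interpolation.\<close>
    have 2: "norm (Z (\<lambda>\<theta>. y (min (s + \<theta>) (\<gamma> s))) - Z (\<lambda>\<theta>. interp \<xi> \<eta> (c i) x (real i * \<eta> + \<theta>))) \<le> L2 * (2 * \<omega>) powr \<alpha>"
    proof (intro Z_diff_le interp_seg path_seg[OF cont])
      fix \<theta> assume \<theta>: "-\<tau> \<le> \<theta>" "\<theta> \<le> 0"
      have "norm (y (min (s + \<theta>) (\<gamma> s)) - y (min (p + \<theta>) q)) \<le> \<omega>"
        using g q0 p0 s \<theta> \<tau>_pos by (intro modulus) auto
      moreover have "norm (interp \<xi> \<eta> (c i) x (p + \<theta>) - y (min (p + \<theta>) q)) \<le> \<omega>"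
      proof (cases "p + \<theta> \<le> 0")
        case True
        then show ?thesis using y0[of "p + \<theta>"] \<theta> p0 q0 \<eta> \<omega> by (simp add: interp_nonpos min_absorb1)
      next
        case False
        then show ?thesis unfolding x_def q_def using p0 q0 \<eta> \<tau>_pos y0[of 0]
          by (intro interp_approx modulus) (auto simp: q_def)
      qed
      ultimately show "norm (y (min (s + \<theta>) (\<gamma> s)) - interp \<xi> \<eta> (c i) x (real i * \<eta> + \<theta>)) \<le> 2 * \<omega>"
        unfolding p_def[symmetric]
        by (smt (verit) norm_triangle_sub norm_minus_commute norm_diff_triangle_le)
    qed (use g s p0 \<eta> in auto)
    have "G s = b (y (\<gamma> s)) + Z (\<lambda>\<theta>. y (min (s + \<theta>) (\<gamma> s)))" using p0 s by (intro G) auto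
    then have "G s - D = (b (y (\<gamma> s)) - b (x (c i))) +
       (Z (\<lambda>\<theta>. y (min (s + \<theta>) (\<gamma> s))) - Z (\<lambda>\<theta>. interp \<xi> \<eta> (c i) x (real i * \<eta> + \<theta>)))"
      by (simp add: D_def disc_drift_def)
    then show ?thesis unfolding K_def using norm_triangle_le[OF add_mono[OF 1 2]] by metis
  qed
  have "((\<lambda>s. G s - D) has_integral (integral {p..p+\<eta>} G - \<eta> *\<^sub>R D)) (cbox p (p + \<eta>))"
  proof -
    have "G integrable_on {p..p+\<eta>}" using int by (rule integrable_on_subinterval) (use p0 in auto)
    then have "(G has_integral integral {p..p+\<eta>} G) {p..p+\<eta>}" by (rule integrable_integral)
    from has_integral_diff[OF this has_integral_const_real[of D p "p + \<eta>"]] show ?thesis using \<eta> by simp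
  qed
  \<comment> \<open>The right endpoint is removed as a null set: \<open>\<gamma>\<close> is
    controlled on half-open cells only and may jump there.\<close>
  then have "norm (integral {p..p+\<eta>} G - \<eta> *\<^sub>R D) \<le> K * measure lborel (cbox p (p + \<eta>))"
    by (rule has_integral_bound_spike_finite[OF K0, of "{p + \<eta>}", rotated]) (auto intro!: close)
  then have step: "norm (integral {p..p+\<eta>} G - \<eta> *\<^sub>R D) \<le> \<eta> * K" using \<eta> by (simp add: mult.commute)
  have split: "integral {0..p+\<eta>} G = integral {0..p} G + integral {p..p+\<eta>} G"
    using p0 \<eta> by (intro Henstock_Kurzweil_Integration.integral_combine[symmetric] integrable_on_subinterval[OF int]) auto
  have IH: "norm (integral {0..p} G - (\<Sum>j<i. \<eta> *\<^sub>R disc_drift \<eta> (c j) j x)) \<le> p * K"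
    using Suc.IH p0 \<eta> unfolding p_def K_def x_def by auto
  have "norm (integral {0..p+\<eta>} G - (\<Sum>j<Suc i. \<eta> *\<^sub>R disc_drift \<eta> (c j) j x)) =
    norm ((integral {0..p} G - (\<Sum>j<i. \<eta> *\<^sub>R disc_drift \<eta> (c j) j x)) + (integral {p..p+\<eta>} G - \<eta> *\<^sub>R D))"
    unfolding split sum.lessThan_Suc D_def[symmetric] by (simp add: algebra_simps)
  also have "\<dots> \<le> p * K + \<eta> * K" by (rule norm_triangle_le[OF add_mono[OF IH step]])
  finally show ?case unfolding Suc_p K_def[symmetric] x_def[symmetric] by (simp add: algebra_simps)
qed

text \<open>The state is the whole history, because the drift reads past values; positions after
  \<open>i\<close> still hold the initial \<open>\<xi> 0\<close>. The freezing index
  \<open>n * (i div n)\<close> is the start of the current block. The recursion is a deterministic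
  function of the noise \<open>w\<close>, so noises from different probability spaces can be fed
  into it.\<close>

primrec em_path :: "real ^ 'd ^ 'd \<Rightarrow> real \<Rightarrow> nat \<Rightarrow> (nat \<Rightarrow> real ^ 'd) \<Rightarrow> nat \<Rightarrow> nat \<Rightarrow> real ^ 'd" where
  "em_path \<sigma> \<eta> n w 0 = (\<lambda>_. \<xi> 0)"
| "em_path \<sigma> \<eta> n w (Suc i) = (em_path \<sigma> \<eta> n w i)(Suc i :=
     em_path \<sigma> \<eta> n w i i + \<eta> *\<^sub>R disc_drift \<eta> (n * (i div n)) i (em_path \<sigma> \<eta> n w i) + \<sigma> *v w i)"

lemma em_path_stable: "l \<le> i \<Longrightarrow> em_path \<sigma> \<eta> n w i l = em_path \<sigma> \<eta> n w l l"
  by (induction i) (auto simp: le_Suc_eq)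

lemma em_path_sum:
  "em_path \<sigma> \<eta> n w i i = \<xi> 0 + (\<Sum>j<i. \<eta> *\<^sub>R disc_drift \<eta> (n * (j div n)) j (em_path \<sigma> \<eta> n w j) + \<sigma> *v w j)"
  by (induction i) (auto simp: algebra_simps)

text \<open>Error after \<open>k\<close> blocks of length \<open>\<delta>\<close> when the grid equation holds up to \<open>\<rho>\<close>.\<close>

primrec block_err :: "real \<Rightarrow> nat \<Rightarrow> real \<Rightarrow> real" where
  "block_err T 0 \<rho> = 0"
| "block_err T (Suc k) \<rho> = block_err T k \<rho> + T * (L1 * block_err T k \<rho> + L2 * block_err T k \<rho> powr \<alpha>) + \<rho>"

lemma block_err_nonneg: "0 \<le> T \<Longrightarrow> 0 \<le> \<rho> \<Longrightarrow> 0 \<le> block_err T k \<rho>"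
  using L1_nonneg L2_nonneg by (induction k) auto

text \<open>For a fixed number of blocks the error is a finite composition of maps that vanish
  continuously at 0; for the power this uses \<alpha> > 0. No rate in \<open>\<rho>\<close> is
  claimed.\<close>

lemma block_err_tendsto:
  assumes "\<rho> \<longlonglongrightarrow> 0" "\<And>k. 0 \<le> \<rho> k" "0 \<le> T"
  shows "(\<lambda>k. block_err T K (\<rho> k)) \<longlonglongrightarrow> 0"
proof (induction K)
  case (Suc K)
  have "(\<lambda>k. block_err T K (\<rho> k) powr \<alpha>) \<longlonglongrightarrow> 0 powr \<alpha>"
    using assms \<alpha>_pos by (intro tendsto_powr' Suc tendsto_const) (auto simp: block_err_nonneg)
  then have "(\<lambda>k. block_err T (Suc K) (\<rho> k)) \<longlonglongrightarrow> 0 + T * (L1 * 0 + L2 * 0 powr \<alpha>) + 0"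
    unfolding block_err.simps by (intro tendsto_add tendsto_mult tendsto_const Suc assms)
  then show ?case by simp
qed simp

text \<open>Within one block of \<open>n\<close> steps the drift only sees the previous blocks, so the error is propagated
  block by block although the drift is not Lipschitz.\<close>

lemma em_path_stability:
  assumes "\<eta> > 0" "n > 0" "0 \<le> \<rho>" "x 0 = \<xi> 0" "real m * \<eta> \<le> T"
    and err: "\<And>i. i \<le> m \<Longrightarrow> norm (x i - (\<xi> 0 + (\<Sum>j<i. \<eta> *\<^sub>R disc_drift \<eta> (n * (j div n)) j x + \<sigma> *v w j))) \<le> \<rho>"
    and "i \<le> m" "i \<le> k * n"
  shows "norm (em_path \<sigma> \<eta> n w i i - x i) \<le> block_err T k \<rho>"
  using \<open>i \<le> m\<close> \<open>i \<le> k * n\<close>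
proof (induction k arbitrary: i)
  case 0
  then show ?case using assms by simp
next
  case (Suc k)
  define e where "e = block_err T k \<rho>"
  have T0: "0 \<le> T" using assms(1,5) by (smt (verit) mult_nonneg_nonneg of_nat_0_le_iff)
  have e0: "0 \<le> e" using T0 assms(3) by (simp add: e_def block_err_nonneg)
  define S where "S = em_path \<sigma> \<eta> n w"
  define K where "K = L1 * e + L2 * e powr \<alpha>"
  have K0: "0 \<le> K" using L1_nonneg L2_nonneg e0 by (simp add: K_def)
  define D where "D j = disc_drift \<eta> (n * (j div n)) j" for j
  \<comment> \<open>For \<open>j < Suc k * n\<close> the freezing index is at most
    \<open>k * n\<close>, so every grid value read by the drift is covered by the induction
    hypothesis.\<close>
  have D: "norm (D j (S j) - D j x) \<le> K" if "j < i" for j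
    unfolding K_def D_def
  proof (rule disc_drift_diff)
    show "S j 0 = x 0" using em_path_stable[of 0 j] assms(4) by (simp add: S_def)
    fix l assume l: "l \<le> n * (j div n)"
    have jn: "n * (j div n) \<le> j" by (simp add: mult.commute)
    have "j < Suc k * n" using that Suc.prems by simp
    then have "j div n < Suc k" using assms(2) by (simp add: div_less_iff_less_mult)
    then have "n * (j div n) \<le> n * k" by (intro mult_le_mono2) simp
    with l have "l \<le> k * n" by (metis le_trans mult.commute)
    moreover have "l \<le> m" using order_trans[OF l jn] that Suc.prems by linarith
    ultimately have "norm (em_path \<sigma> \<eta> n w l l - x l) \<le> e" unfolding e_def by (rule Suc.IH[rotated])
    then show "norm (S j l - x l) \<le> e" using em_path_stable[of l j] l jn by (simp add: S_def)
  qed (use assms in auto)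
  have "S i i - x i = (\<Sum>j<i. \<eta> *\<^sub>R (D j (S j) - D j x)) - (x i - (\<xi> 0 + (\<Sum>j<i. \<eta> *\<^sub>R D j x + \<sigma> *v w j)))"
    using em_path_sum[of \<sigma> \<eta> n w i] by (simp add: S_def D_def sum_subtractf sum.distrib algebra_simps)
  also have "norm \<dots> \<le> norm (\<Sum>j<i. \<eta> *\<^sub>R (D j (S j) - D j x)) + \<rho>"
    unfolding D_def using Suc.prems by (intro order_trans[OF norm_triangle_ineq4 add_left_mono[OF err]])
  also have "norm (\<Sum>j<i. \<eta> *\<^sub>R (D j (S j) - D j x)) \<le> (\<Sum>j<i. \<eta> * K)"
    using assms(1) by (intro sum_norm_le) (auto simp: D)
  also have "\<dots> = (real i * \<eta>) * K" by simp
  also have "\<dots> \<le> T * K"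
  proof (rule mult_right_mono)
    have "real i * \<eta> \<le> real m * \<eta>" using Suc.prems assms(1) by (intro mult_right_mono) auto
    then show "real i * \<eta> \<le> T" using assms(5) by linarith
  qed (rule K0)
  finally show ?case using e0 by (simp add: K_def e_def S_def)
qed

text \<open>Besides the increments of \<open>W\<close>, the noise \<open>w\<close> carries the
  difference between the drift with freezing index \<open>c\<close> and the block-frozen drift. With
  this correction \<open>y\<close> solves the block-frozen recursion up to the Riemann sum error
  \<open>\<rho> k\<close>, which vanishes with the modulus of continuity, and stability carries this
  over to \<open>em_path\<close>.\<close>

lemma em_path_converges:
  fixes y :: "real \<Rightarrow> real ^ 'd" and \<delta> t :: real
  defines "\<eta> \<equiv> \<lambda>k. \<delta> / real (Suc k)"
  defines "m \<equiv> \<lambda>k. nat \<lfloor>t / \<eta> k\<rfloor>"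
  assumes \<delta>: "\<delta> > 0" and t: "0 \<le> t" and y0: "\<And>r. -\<tau> \<le> r \<Longrightarrow> r \<le> 0 \<Longrightarrow> y r = \<xi> r"
    and cont: "continuous_on {-\<tau>..t} y"
    and int: "G integrable_on {0..t}"
    and G: "\<And>s. 0 \<le> s \<Longrightarrow> s \<le> t \<Longrightarrow> G s = b (y (\<gamma> s)) + Z (\<lambda>\<theta>. y (min (s + \<theta>) (\<gamma> s)))"
    and eq: "\<And>s. 0 \<le> s \<Longrightarrow> s \<le> t \<Longrightarrow> y s = \<xi> 0 + integral {0..s} G + \<sigma> *v (W s - W 0)"
    and c: "\<And>k j. c k j \<le> j"
    and \<gamma>: "\<And>k j s. real j * \<eta> k \<le> s \<Longrightarrow> s < real (Suc j) * \<eta> k \<Longrightarrow>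
        \<bar>\<gamma> s - real (c k j) * \<eta> k\<bar> \<le> \<eta> k \<and> 0 \<le> \<gamma> s \<and> \<gamma> s \<le> s"
    and w: "\<And>k j. j < m k \<Longrightarrow> \<sigma> *v w k j =
        \<eta> k *\<^sub>R (disc_drift (\<eta> k) (c k j) j (\<lambda>l. y (real l * \<eta> k))
              - disc_drift (\<eta> k) (Suc k * (j div Suc k)) j (\<lambda>l. y (real l * \<eta> k)))
        + \<sigma> *v (W (real (Suc j) * \<eta> k) - W (real j * \<eta> k))"
  shows "(\<lambda>k. em_path \<sigma> (\<eta> k) (Suc k) (w k) (m k) (m k)) \<longlonglongrightarrow> y t"
proof -
  have \<eta>: "\<eta> k > 0" for k using \<delta> by (simp add: \<eta>_def)
  have \<eta>0: "\<eta> \<longlonglongrightarrow> 0" unfolding \<eta>_def by (rule LIMSEQ_Suc[OF lim_const_over_n])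
  have m: "real (m k) * \<eta> k \<le> t" "t < real (m k) * \<eta> k + \<eta> k" for k
  proof -
    have "0 \<le> t / \<eta> k" using t \<eta>[of k] by simp
    then have "real (m k) \<le> t / \<eta> k" "t / \<eta> k < real (m k) + 1" unfolding m_def by linarith+
    then show "real (m k) * \<eta> k \<le> t" "t < real (m k) * \<eta> k + \<eta> k"
      using \<eta>[of k] by (auto simp: field_simps)
  qed
  obtain \<omega> where \<omega>: "\<omega> \<longlonglongrightarrow> 0" "\<And>k. 0 \<le> \<omega> k"
    "\<And>k u v. -\<tau> \<le> u \<Longrightarrow> u \<le> t \<Longrightarrow> -\<tau> \<le> v \<Longrightarrow> v \<le> t \<Longrightarrow> \<bar>u - v\<bar> \<le> \<eta> k \<Longrightarrow> norm (y u - y v) \<le> \<omega> k"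
    using ex_modulus_of_continuity[OF cont \<eta>0] by metis
  define \<rho> where "\<rho> k = t * (L1 * \<omega> k + L2 * (2 * \<omega> k) powr \<alpha>)" for k
  have \<rho>0: "0 \<le> \<rho> k" for k using t L1_nonneg L2_nonneg \<omega>(2)[of k] by (simp add: \<rho>_def)
  have "(\<lambda>k. (2 * \<omega> k) powr \<alpha>) \<longlonglongrightarrow> (2 * 0) powr \<alpha>"
    using \<omega>(2) \<alpha>_pos by (intro tendsto_powr' tendsto_intros \<omega>(1)) auto
  then have "\<rho> \<longlonglongrightarrow> t * (L1 * 0 + L2 * (2 * 0) powr \<alpha>)"
    unfolding \<rho>_def by (intro tendsto_add tendsto_mult tendsto_const \<omega>(1))
  then have \<rho>: "\<rho> \<longlonglongrightarrow> 0" by simp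
  \<comment> \<open>The number of blocks up to \<open>t\<close> does not depend on \<open>k\<close>;
    only the number of grid points per block grows.\<close>
  define K where "K = nat \<lceil>t / \<delta>\<rceil>"
  have stab: "norm (em_path \<sigma> (\<eta> k) (Suc k) (w k) (m k) (m k) - y (real (m k) * \<eta> k)) \<le> block_err t K (\<rho> k)" for k
  proof (rule em_path_stability[OF \<eta>, where m="m k" and x="\<lambda>l. y (real l * \<eta> k)"])
    let ?x = "\<lambda>l. y (real l * \<eta> k)"
    fix i assume i: "i \<le> m k"
    have it: "real i * \<eta> k \<le> t"
      using i m(1)[of k] \<eta>[of k] by (smt (verit) mult_right_mono of_nat_mono)
    have "(\<Sum>j<i. \<sigma> *v w k j) = (\<Sum>j<i. \<eta> k *\<^sub>R (disc_drift (\<eta> k) (c k j) j ?x - disc_drift (\<eta> k) (Suc k * (j div Suc k)) j ?x))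
        + \<sigma> *v (\<Sum>j<i. W (real (Suc j) * \<eta> k) - W (real j * \<eta> k))"
      using i by (simp add: w sum.distrib linear_sum[OF matrix_vector_mul_linear] del: mult_Suc of_nat_Suc)
    also have "(\<Sum>j<i. W (real (Suc j) * \<eta> k) - W (real j * \<eta> k)) = W (real i * \<eta> k) - W 0"
      using sum_lessThan_telescope[of "\<lambda>j. W (real j * \<eta> k)" i] by simp
    finally have "\<xi> 0 + (\<Sum>j<i. \<eta> k *\<^sub>R disc_drift (\<eta> k) (Suc k * (j div Suc k)) j ?x + \<sigma> *v w k j) =
        \<xi> 0 + (\<Sum>j<i. \<eta> k *\<^sub>R disc_drift (\<eta> k) (c k j) j ?x) + \<sigma> *v (W (real i * \<eta> k) - W 0)"
      by (simp add: sum.distrib sum_subtractf scaleR_diff_right del: mult_Suc)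
    then have "?x i - (\<xi> 0 + (\<Sum>j<i. \<eta> k *\<^sub>R disc_drift (\<eta> k) (Suc k * (j div Suc k)) j ?x + \<sigma> *v w k j)) =
        integral {0..real i * \<eta> k} G - (\<Sum>j<i. \<eta> k *\<^sub>R disc_drift (\<eta> k) (c k j) j ?x)"
      using eq[of "real i * \<eta> k"] it \<eta>[of k] by simp
    also have "norm \<dots> \<le> real i * \<eta> k * (L1 * \<omega> k + L2 * (2 * \<omega> k) powr \<alpha>)"
      by (rule riemann_sum_drift[where T=t and \<gamma>=\<gamma>]) (use \<eta> y0 cont \<omega> int G c \<gamma> it in auto)
    also have "\<dots> \<le> \<rho> k" unfolding \<rho>_def
      using it L1_nonneg L2_nonneg \<omega>(2)[of k] by (intro mult_right_mono) auto
    finally show "norm (?x i - (\<xi> 0 + (\<Sum>j<i. \<eta> k *\<^sub>R disc_drift (\<eta> k) (Suc k * (j div Suc k)) j ?x + \<sigma> *v w k j))) \<le> \<rho> k" .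
  next
    have "real (m k) \<le> real K * real (Suc k)"
    proof -
      have "real (m k) \<le> t / \<eta> k" using m(1)[of k] \<eta>[of k] by (simp add: field_simps)
      also have "\<dots> = t / \<delta> * real (Suc k)" by (simp add: \<eta>_def)
      also have "\<dots> \<le> real K * real (Suc k)"
        unfolding K_def by (intro mult_right_mono real_nat_ceiling_ge) auto
      finally show ?thesis .
    qed
    then show "m k \<le> K * Suc k" by (metis of_nat_le_iff of_nat_mult)
  qed (use \<tau>_pos y0[of 0] \<rho>0 m in auto)
  have "(\<lambda>k. block_err t K (\<rho> k) + \<omega> k) \<longlonglongrightarrow> 0 + 0"
    by (intro tendsto_add block_err_tendsto \<rho> \<rho>0 t \<omega>)
  then have lim: "(\<lambda>k. block_err t K (\<rho> k) + \<omega> k) \<longlonglongrightarrow> 0" by simp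
  have "norm (em_path \<sigma> (\<eta> k) (Suc k) (w k) (m k) (m k) - y t) \<le> block_err t K (\<rho> k) + \<omega> k" for k
  proof -
    \<comment> \<open>The last grid time lies less than one cell before \<open>t\<close>.\<close>
    have "norm (y (real (m k) * \<eta> k) - y t) \<le> \<omega> k"
      using m[of k] \<eta>[of k] t \<tau>_pos by (intro \<omega>(3)) (auto intro: order_trans[of _ 0])
    then show ?thesis using stab[of k] by (smt (verit) norm_diff_triangle_le)
  qed
  then have "(\<lambda>k. em_path \<sigma> (\<eta> k) (Suc k) (w k) (m k) (m k) - y t) \<longlonglongrightarrow> 0"
    by (intro Lim_null_comparison[OF always_eventually lim]) auto
  then show ?thesis by (rule LIM_zero_cancel)
qed

lemma em_path_measurable:
  assumes "\<eta> > 0"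
  shows "(\<lambda>w. em_path \<sigma> \<eta> n w i) \<in> borel_measurable borel"
proof (induction i)
  case (Suc i)
  note [measurable] = Suc disc_drift_measurable[OF assms]
  have [measurable]: "(\<lambda>w :: nat \<Rightarrow> real ^ 'd. w l) \<in> borel_measurable borel" for l
    by (intro borel_measurable_continuous_onI continuous_on_product_coordinates)
  have [measurable]: "(\<lambda>w. em_path \<sigma> \<eta> n w i l) \<in> borel_measurable borel" for l
    using measurable_compose[OF Suc, of "\<lambda>S. S l" borel] by simp
  have [measurable]: "(\<lambda>v. \<sigma> *v v) \<in> borel_measurable borel"
    by (intro borel_measurable_continuous_onI linear_continuous_on matrix_vector_mul_bounded_linear)
  show ?case
    by (rule measurable_coordinatewise_then_product) (simp add: fun_upd_def)
qed simp

end

section \<open>Brownian increments and change of measure on a grid\<close>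

definition gauss_density :: "real \<Rightarrow> real ^ 'd \<Rightarrow> real" where
  "gauss_density v x = (\<Prod>i\<in>UNIV. normal_density 0 (sqrt v) (x $ i))"

section \<open>Gaussian densities and their translates\<close>

lemma coordinate_measurable:
  "(\<lambda>x :: nat \<Rightarrow> 'a::topological_space. x l) \<in> borel_measurable borel"
  by (rule borel_measurable_continuous_onI[OF continuous_on_product_coordinates])

lemma gauss_density_measurable [measurable]: "gauss_density v \<in> borel_measurable borel"
  unfolding gauss_density_def[abs_def]
  by (intro borel_measurable_prod measurable_compose[OF borel_measurable_nth borel_measurable_normal_density])

lemma gauss_density_nonneg: "0 \<le> gauss_density v x"
  unfolding gauss_density_def by (intro prod_nonneg) auto

text \<open>The integrand is a product over coordinates, so Fubini applies: \<open>f\<close> puts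
  \<open>h\<close> into the factor of \<open>axis k 1\<close>, and the other factors integrate to
  1.\<close>

lemma nn_integral_gauss_component:
  fixes k :: "'d::finite"
  assumes "0 < v" and [measurable]: "h \<in> borel_measurable borel" and h: "\<And>z. 0 \<le> h z"
  shows "(\<integral>\<^sup>+x. ennreal (gauss_density v x) * ennreal (h ((x::real^'d) $ k)) \<partial>lborel)
       = (\<integral>\<^sup>+z. ennreal (normal_density 0 (sqrt v) z) * ennreal (h z) \<partial>lborel)"
proof -
  define f where "f b z = ennreal (normal_density 0 (sqrt v) z) * (if b = axis k (1::real) then ennreal (h z) else 1)"
    for b :: "real^'d" and z :: real
  have Basis: "(Basis :: (real^'d) set) = (\<lambda>i. axis i 1) ` UNIV"
    by (auto simp: Basis_vec_def)
  have inj: "inj (\<lambda>i::'d. axis i (1::real))" by (auto simp: inj_on_def axis_eq_axis)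
  have prodB: "(\<Prod>b\<in>Basis. F b) = (\<Prod>i\<in>UNIV. F (axis i 1))" for F :: "real^'d \<Rightarrow> ennreal"
    unfolding Basis using inj by (subst prod.reindex) auto
  have "ennreal (gauss_density v x) * ennreal (h (x $ k)) = (\<Prod>b\<in>Basis. f b (x \<bullet> b))" for x :: "real^'d"
  proof -
    have "(\<Prod>i\<in>UNIV. f (axis i 1) (x $ i)) = (\<Prod>i\<in>UNIV. ennreal (normal_density 0 (sqrt v) (x $ i))) *
        (\<Prod>i\<in>UNIV. if i = k then ennreal (h (x $ i)) else 1)"
      by (simp add: f_def prod.distrib axis_eq_axis)
    also have "(\<Prod>i\<in>UNIV. if i = k then ennreal (h (x $ i)) else 1) = ennreal (h (x $ k))"
      by (simp add: prod.delta)
    finally show ?thesis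
      by (simp add: prodB gauss_density_def prod_ennreal inner_axis)
  qed
  then have "(\<integral>\<^sup>+x. ennreal (gauss_density v x) * ennreal (h ((x::real^'d) $ k)) \<partial>lborel)
    = (\<integral>\<^sup>+x. (\<Prod>b\<in>Basis. f b (x \<bullet> b)) \<partial>lborel)" by simp
  also have "\<dots> = (\<Prod>b\<in>Basis. (\<integral>\<^sup>+z. f b z \<partial>lborel))"
  proof (rule nn_integral_lborel_prod)
    show "f b \<in> borel_measurable borel" for b
    proof (cases "b = axis k 1")
      case True
      then show ?thesis unfolding f_def by simp
    next
      case False
      then show ?thesis unfolding f_def by simp
    qed
  qed simp
  also have "\<dots> = (\<Prod>i\<in>UNIV. (\<integral>\<^sup>+z. f (axis i 1) z \<partial>lborel))"
    by (rule prodB[where F="\<lambda>b. \<integral>\<^sup>+z. f b z \<partial>lborel"])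
  also have "\<dots> = (\<Prod>i\<in>UNIV. if i = k then (\<integral>\<^sup>+z. ennreal (normal_density 0 (sqrt v) z) * ennreal (h z) \<partial>lborel) else 1)"
  proof (rule prod.cong[OF refl])
    fix i :: 'd
    have "(\<integral>\<^sup>+z. ennreal (normal_density 0 (sqrt v) z) \<partial>lborel) = 1"
      using assms(1) by (subst nn_integral_eq_integral) simp_all
    then show "(\<integral>\<^sup>+z. f (axis i 1) z \<partial>lborel) = (if i = k then (\<integral>\<^sup>+z. ennreal (normal_density 0 (sqrt v) z) * ennreal (h z) \<partial>lborel) else 1)"
      by (simp add: f_def axis_eq_axis)
  qed
  also have "\<dots> = (\<integral>\<^sup>+z. ennreal (normal_density 0 (sqrt v) z) * ennreal (h z) \<partial>lborel)" by simp
  finally show ?thesis .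
qed

text \<open>The likelihood ratio of \<open>gauss_density v (x + u)\<close> to
  \<open>gauss_density v x\<close>, that is, one factor of a Girsanov exponential. For v = \<eta>
  and u = \<eta> h it reads exp(-<h, x> - \<eta> |h|^2 / 2).\<close>

definition tilt :: "real \<Rightarrow> 'a::real_inner \<Rightarrow> 'a \<Rightarrow> real" where
  "tilt v x u = exp (- (x \<bullet> u) / v - (u \<bullet> u) / (2 * v))"

lemma gauss_density_shift:
  assumes "v > 0"
  shows "gauss_density v x * tilt v x u = gauss_density v (x + u)"
proof -
  have *: "normal_density 0 (sqrt v) (a + c) = normal_density 0 (sqrt v) a * exp (- (a * c) / v - (c * c) / (2 * v))" for a c
  proof -
    have "- (a + c)\<^sup>2 / (2 * v) = - a\<^sup>2 / (2 * v) + (- (a * c) / v - (c * c) / (2 * v))"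
      using assms by (simp add: field_simps power2_eq_square)
    then show ?thesis using assms by (simp add: normal_density_def flip: exp_add)
  qed
  have "- (x \<bullet> u) / v - (u \<bullet> u) / (2 * v) = (\<Sum>i\<in>UNIV. - (x $ i * u $ i) / v - (u $ i * u $ i) / (2 * v))"
    by (simp add: inner_vec_def sum_subtractf sum_negf sum_divide_distrib)
  then show ?thesis
    by (simp add: gauss_density_def tilt_def exp_sum * prod.distrib)
qed

text \<open>Expectation of \<open>\<phi>\<close> when the first coordinates are independent Gaussian vectors with covariance
  matrix \<open>v I\<close> and the others are \<open>0\<close>.\<close>

primrec gauss_iter :: "real \<Rightarrow> nat \<Rightarrow> ((nat \<Rightarrow> real ^ 'd) \<Rightarrow> ennreal) \<Rightarrow> ennreal" where
  "gauss_iter v 0 \<phi> = \<phi> (\<lambda>_. 0)"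
| "gauss_iter v (Suc i) \<phi> = gauss_iter v i (\<lambda>x. \<integral>\<^sup>+y. ennreal (gauss_density v y) * \<phi> (x(i := y)) \<partial>lborel)"

lemma fun_upd_borel_measurable [measurable (raw)]:
  fixes f :: "'b \<Rightarrow> nat \<Rightarrow> 'a::second_countable_topology"
  assumes [measurable]: "f \<in> borel_measurable M" "g \<in> borel_measurable M"
  shows "(\<lambda>x. (f x)(i := g x)) \<in> borel_measurable M"
proof (rule measurable_coordinatewise_then_product)
  fix l
  have "(\<lambda>x. f x l) \<in> borel_measurable M"
    using measurable_compose[OF assms(1) coordinate_measurable] .
  then show "(\<lambda>x. ((f x)(i := g x)) l) \<in> borel_measurable M"
    by (cases "l = i") simp_all
qed

section \<open>Independence and moments of Brownian increments, and the density on the grid\<close>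

locale brownian =
  fixes M :: "'w measure" and F :: "real \<Rightarrow> 'w measure" and W :: "real \<Rightarrow> 'w \<Rightarrow> real ^ 'd"
  assumes fps: "filtered_prob_space M F" and bm: "brownian_motion M F W"
begin

sublocale prob_space M using fps by (simp add: filtered_prob_space_def)

lemma space_F: "space (F t) = space M"
  using fps by (simp add: filtered_prob_space_def subalgebra_def)

lemma F_measurable_mono: "f \<in> measurable (F s) L \<Longrightarrow> s \<le> t \<Longrightarrow> f \<in> measurable (F t) L"
  using fps filtration.sets_F_mono[of "space M" F s t]
  by (intro measurable_from_subalg[of "F t" "F s"]) (auto simp: subalgebra_def space_F filtered_prob_space_def)

lemma F_measurable: "f \<in> measurable (F s) L \<Longrightarrow> f \<in> measurable M L"
  using fps by (intro measurable_from_subalg[of M "F s"]) (auto simp: filtered_prob_space_def)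

lemma W_adapted: "0 \<le> t \<Longrightarrow> W t \<in> borel_measurable (F t)"
  using bm by (simp add: brownian_motion_def)

lemma W_measurable: "0 \<le> t \<Longrightarrow> W t \<in> borel_measurable M"
  by (rule F_measurable[OF W_adapted])

lemma increment_distributed:
  "0 \<le> s \<Longrightarrow> s < t \<Longrightarrow> distributed M lborel (\<lambda>\<omega>. W t \<omega> - W s \<omega>) (\<lambda>x. ennreal (gauss_density (t - s) x))"
  using bm by (simp add: brownian_motion_def gauss_density_def)

lemma increment_indep_set:
  assumes "0 \<le> s" "s < t" "A \<in> sets (F s)" "B \<in> sets borel"
  shows "prob (A \<inter> ((\<lambda>\<omega>. W t \<omega> - W s \<omega>) -` B \<inter> space M)) = prob A * prob ((\<lambda>\<omega>. W t \<omega> - W s \<omega>) -` B \<inter> space M)"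
proof (rule indep_setD)
  show "indep_set (sets (F s)) (sets (vimage_algebra (space M) (\<lambda>\<omega>. W t \<omega> - W s \<omega>) borel))"
    using bm assms by (simp add: brownian_motion_def)
  show "(\<lambda>\<omega>. W t \<omega> - W s \<omega>) -` B \<inter> space M \<in> sets (vimage_algebra (space M) (\<lambda>\<omega>. W t \<omega> - W s \<omega>) borel)"
    using assms(4) by (rule in_vimage_algebra)
qed fact

lemma increment_measurable: "0 \<le> s \<Longrightarrow> 0 \<le> t \<Longrightarrow> (\<lambda>\<omega>. W t \<omega> - W s \<omega>) \<in> borel_measurable M"
  by (intro borel_measurable_diff W_measurable)

text \<open>Independence of \<open>F s\<close> and the increment gives the product formula on
  rectangles, which determines a product measure. \<open>K\<close> may be any object known at time
  \<open>s\<close>, such as a tuple of past quantities.\<close>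

lemma joint_law:
  assumes "0 \<le> s" "s < t" "K \<in> measurable (F s) L"
  shows "distr M L K \<Otimes>\<^sub>M distr M borel (\<lambda>\<omega>. W t \<omega> - W s \<omega>) =
    distr M (L \<Otimes>\<^sub>M borel) (\<lambda>\<omega>. (K \<omega>, W t \<omega> - W s \<omega>))"
proof -
  let ?D = "\<lambda>\<omega>. W t \<omega> - W s \<omega>"
  have [measurable]: "K \<in> measurable M L" by (rule F_measurable[OF assms(3)])
  have [measurable]: "?D \<in> borel_measurable M" using assms by (intro increment_measurable) auto
  interpret K: prob_space "distr M L K" by (rule prob_space_distr) simp
  interpret D: prob_space "distr M borel ?D" by (rule prob_space_distr) simp
  show ?thesis
  proof (rule pair_measure_eqI)
    fix A B assume A: "A \<in> sets (distr M L K)" and B: "B \<in> sets (distr M borel ?D)"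
    have "(\<lambda>\<omega>. (K \<omega>, ?D \<omega>)) -` (A \<times> B) \<inter> space M = (K -` A \<inter> space M) \<inter> (?D -` B \<inter> space M)" by auto
    moreover have "prob ((K -` A \<inter> space M) \<inter> (?D -` B \<inter> space M)) = prob (K -` A \<inter> space M) * prob (?D -` B \<inter> space M)"
      using assms A B measurable_sets[OF assms(3), of A] by (intro increment_indep_set) (auto simp: space_F)
    ultimately show "emeasure (distr M L K) A * emeasure (distr M borel ?D) B =
        emeasure (distr M (L \<Otimes>\<^sub>M borel) (\<lambda>\<omega>. (K \<omega>, ?D \<omega>))) (A \<times> B)"
      using A B by (simp add: emeasure_distr emeasure_eq_measure ennreal_mult)
  qed (auto simp: K.sigma_finite_measure_axioms D.sigma_finite_measure_axioms)
qed

lemma increment_indep: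
  assumes "0 \<le> s" "s < t" "v \<in> borel_measurable (F s)"
  shows "indep_var borel v borel (\<lambda>\<omega>. (W t \<omega> - W s \<omega>) $ k)"
proof -
  let ?D = "\<lambda>\<omega>. W t \<omega> - W s \<omega>"
  have [measurable]: "v \<in> borel_measurable M" by (rule F_measurable[OF assms(3)])
  have [measurable]: "?D \<in> borel_measurable M" using assms by (intro increment_measurable) auto
  have [measurable]: "(\<lambda>\<omega>. ?D \<omega> $ k) \<in> borel_measurable M"
    using measurable_compose[OF \<open>?D \<in> borel_measurable M\<close> borel_measurable_nth] .
  note [measurable] = this[unfolded vector_minus_component]
  have "distr M borel v \<Otimes>\<^sub>M distr M borel (\<lambda>\<omega>. ?D \<omega> $ k) = distr (distr M borel v \<Otimes>\<^sub>M distr M borel ?D) (borel \<Otimes>\<^sub>M borel) (\<lambda>(a, x). (a, x $ k))"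
  proof -
    interpret D: prob_space "distr M borel (\<lambda>\<omega>. ?D \<omega> $ k)" by (rule prob_space_distr) simp
    interpret D': prob_space "distr (distr M borel ?D) borel (\<lambda>x. x $ k)"
      using D.prob_space_axioms by (simp add: distr_distr comp_def)
    have "distr (distr M borel v) borel (\<lambda>a. a) \<Otimes>\<^sub>M distr (distr M borel ?D) borel (\<lambda>x. x $ k) =
      distr (distr M borel v \<Otimes>\<^sub>M distr M borel ?D) (borel \<Otimes>\<^sub>M borel) (\<lambda>(a, x). (a, x $ k))"
      by (rule pair_measure_distr) (auto simp: D'.sigma_finite_measure_axioms)
    then show ?thesis by (simp add: distr_distr comp_def)
  qed
  also have "\<dots> = distr M (borel \<Otimes>\<^sub>M borel) (\<lambda>\<omega>. (v \<omega>, ?D \<omega> $ k))"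
  proof -
    have "(\<lambda>(a :: real, x :: real ^ 'd). (a, x $ k)) \<in> measurable (borel \<Otimes>\<^sub>M borel) (borel \<Otimes>\<^sub>M borel)"
      unfolding case_prod_beta
      by (rule measurable_Pair[OF measurable_fst measurable_compose[OF measurable_snd borel_measurable_nth]])
    from distr_distr[OF this, of "\<lambda>\<omega>. (v \<omega>, ?D \<omega>)" M] show ?thesis
      unfolding joint_law[OF assms] by (simp add: comp_def)
  qed
  finally show ?thesis unfolding indep_var_distribution_eq by simp
qed

text \<open>Conditioning on \<open>F s\<close> in integrated form: by the product law and Fubini,
  the past \<open>K\<close> is held fixed while the increment is integrated against its Gaussian
  density.\<close>

lemma freeze:
  assumes "0 \<le> s" "s < t" "K \<in> measurable (F s) L" and [measurable]: "\<Psi> \<in> borel_measurable (L \<Otimes>\<^sub>M borel)"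
  shows "(\<integral>\<^sup>+\<omega>. \<Psi> (K \<omega>, W t \<omega> - W s \<omega>) \<partial>M)
    = (\<integral>\<^sup>+\<omega>. (\<integral>\<^sup>+x. ennreal (gauss_density (t - s) x) * \<Psi> (K \<omega>, x) \<partial>lborel) \<partial>M)"
proof -
  let ?D = "\<lambda>\<omega>. W t \<omega> - W s \<omega>"
  have [measurable]: "K \<in> measurable M L" by (rule F_measurable[OF assms(3)])
  have [measurable]: "?D \<in> borel_measurable M" using assms by (intro increment_measurable) auto
  have eq: "distr M L K \<Otimes>\<^sub>M distr M borel ?D = distr M (L \<Otimes>\<^sub>M borel) (\<lambda>\<omega>. (K \<omega>, ?D \<omega>))"
    by (rule joint_law[OF assms(1-3)])
  have dD: "distr M borel ?D = density lborel (\<lambda>x. ennreal (gauss_density (t - s) x))"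
    unfolding distributed_distr_eq_density[OF increment_distributed[OF assms(1,2)], symmetric]
    by (rule distr_cong) simp_all
  interpret D: prob_space "distr M borel ?D" by (rule prob_space_distr) simp
  have [measurable]: "\<Psi> \<in> borel_measurable (distr M L K \<Otimes>\<^sub>M distr M borel ?D)"
    using assms(4) by simp
  have "(\<integral>\<^sup>+\<omega>. \<Psi> (K \<omega>, ?D \<omega>) \<partial>M) = (\<integral>\<^sup>+p. \<Psi> p \<partial>distr M (L \<Otimes>\<^sub>M borel) (\<lambda>\<omega>. (K \<omega>, ?D \<omega>)))"
    by (subst nn_integral_distr) auto
  also have "\<dots> = (\<integral>\<^sup>+a. \<integral>\<^sup>+x. \<Psi> (a, x) \<partial>distr M borel ?D \<partial>distr M L K)"
    unfolding eq[symmetric] by (rule D.nn_integral_fst[symmetric]) simp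
  also have "\<dots> = (\<integral>\<^sup>+\<omega>. \<integral>\<^sup>+x. \<Psi> (K \<omega>, x) \<partial>distr M borel ?D \<partial>M)"
    by (rule nn_integral_distr) (auto intro!: D.borel_measurable_nn_integral_fst)
  also have "\<dots> = (\<integral>\<^sup>+\<omega>. (\<integral>\<^sup>+x. ennreal (gauss_density (t - s) x) * \<Psi> (K \<omega>, x) \<partial>lborel) \<partial>M)"
    unfolding dD
  proof (intro nn_integral_cong nn_integral_density)
    fix \<omega> assume "\<omega> \<in> space M"
    then have "K \<omega> \<in> space L" using measurable_space[OF \<open>K \<in> measurable M L\<close>] by blast
    then show "(\<lambda>x. \<Psi> (K \<omega>, x)) \<in> borel_measurable lborel" by simp
  qed simp
  finally show ?thesis .
qed

lemma increment_component_distributed: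
  assumes "0 \<le> s" "s < t"
  shows "distributed M lborel (\<lambda>\<omega>. (W t \<omega> - W s \<omega>) $ k) (normal_density 0 (sqrt (t - s)))"
proof -
  let ?D = "\<lambda>\<omega>. W t \<omega> - W s \<omega>"
  have [measurable]: "?D \<in> borel_measurable M" using assms by (intro increment_measurable) auto
  have [measurable]: "(\<lambda>\<omega>. ?D \<omega> $ k) \<in> borel_measurable M"
    using measurable_compose[OF \<open>?D \<in> borel_measurable M\<close> borel_measurable_nth] .
  note [measurable] = this[unfolded vector_minus_component]
  show ?thesis unfolding distributed_def
  proof (intro conjI measure_eqI)
    fix A assume "A \<in> sets (distr M lborel (\<lambda>\<omega>. ?D \<omega> $ k))"
    then have [measurable]: "A \<in> sets borel" by simp
    have "emeasure (distr M lborel (\<lambda>\<omega>. ?D \<omega> $ k)) A = (\<integral>\<^sup>+z. indicator A z \<partial>distr M lborel (\<lambda>\<omega>. ?D \<omega> $ k))"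
      by simp
    also have "\<dots> = (\<integral>\<^sup>+\<omega>. indicator A (?D \<omega> $ k) \<partial>M)"
      by (rule nn_integral_distr) auto
    also have "\<dots> = (\<integral>\<^sup>+\<omega>. ennreal (indicator A (?D \<omega> $ k)) \<partial>M)"
      by (simp add: ennreal_indicator)
    also have "\<dots> = (\<integral>\<^sup>+x. ennreal (gauss_density (t - s) x) * ennreal (indicator A (x $ k)) \<partial>lborel)"
      by (rule distributed_nn_integral[OF increment_distributed[OF assms], symmetric]) auto
    also have "\<dots> = (\<integral>\<^sup>+z. ennreal (normal_density 0 (sqrt (t - s)) z) * ennreal (indicator A z) \<partial>lborel)"
      using assms by (intro nn_integral_gauss_component) auto
    also have "\<dots> = emeasure (density lborel (\<lambda>x. ennreal (normal_density 0 (sqrt (t - s)) x))) A"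
      by (subst emeasure_density) (auto simp: ennreal_indicator)
    finally show "emeasure (distr M lborel (\<lambda>\<omega>. ?D \<omega> $ k)) A = emeasure (density lborel (\<lambda>x. ennreal (normal_density 0 (sqrt (t - s)) x))) A" .
  qed auto
qed

lemma increment_component_moments:
  assumes "0 \<le> s" "s < t"
  shows "integrable M (\<lambda>\<omega>. (W t \<omega> - W s \<omega>) $ k)" "expectation (\<lambda>\<omega>. (W t \<omega> - W s \<omega>) $ k) = 0"
    "integrable M (\<lambda>\<omega>. ((W t \<omega> - W s \<omega>) $ k)\<^sup>2)" "expectation (\<lambda>\<omega>. ((W t \<omega> - W s \<omega>) $ k)\<^sup>2) = t - s"
proof -
  note D = increment_component_distributed[OF assms, of k]
  have pos: "0 < sqrt (t - s)" using assms by simp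
  show 1: "integrable M (\<lambda>\<omega>. (W t \<omega> - W s \<omega>) $ k)"
    using integrable_normal_moment_nz_1[OF pos] D by (intro distributed_integrable_var[OF D]) auto
  show 2: "expectation (\<lambda>\<omega>. (W t \<omega> - W s \<omega>) $ k) = 0"
    using normal_distributed_expectation[OF pos D] .
  have "integrable lborel (\<lambda>x. normal_density 0 (sqrt (t - s)) x * x\<^sup>2)"
    using integrable_normal_moment[OF pos, of 0 2] by simp
  then show "integrable M (\<lambda>\<omega>. ((W t \<omega> - W s \<omega>) $ k)\<^sup>2)"
    by (subst distributed_integrable[OF D, symmetric]) auto
  show "expectation (\<lambda>\<omega>. ((W t \<omega> - W s \<omega>) $ k)\<^sup>2) = t - s"
    using normal_distributed_variance[OF pos D] 2 assms by simp
qed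

text \<open>By independence the expectation factorizes, and the increment has mean zero. This
  removes the martingale terms both from the entropy and from the maximal inequality.\<close>

lemma increment_orthogonal:
  assumes "0 \<le> s" "s < t" "v \<in> borel_measurable (F s)" "integrable M v"
  shows "integrable M (\<lambda>\<omega>. v \<omega> * (W t \<omega> - W s \<omega>) $ k)" "expectation (\<lambda>\<omega>. v \<omega> * (W t \<omega> - W s \<omega>) $ k) = 0"
proof -
  note ind = increment_indep[OF assms(1-3)]
  note m = increment_component_moments[OF assms(1,2), of k]
  show "integrable M (\<lambda>\<omega>. v \<omega> * (W t \<omega> - W s \<omega>) $ k)"
    by (rule indep_var_integrable[OF ind assms(4) m(1)])
  show "expectation (\<lambda>\<omega>. v \<omega> * (W t \<omega> - W s \<omega>) $ k) = 0"
    using indep_var_lebesgue_integral[OF ind assms(4) m(1)] m(2) by simp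
qed

text \<open>Entries from \<open>j\<close> on are 0, matching the starting sequence of
  \<open>gauss_iter\<close>. The shift 0 gives the plain Brownian increments.\<close>

definition shifted_noise :: "real \<Rightarrow> (nat \<Rightarrow> 'w \<Rightarrow> real ^ 'd) \<Rightarrow> nat \<Rightarrow> 'w \<Rightarrow> nat \<Rightarrow> real ^ 'd" where
  "shifted_noise \<eta> u j \<omega> = (\<lambda>i. if i < j then W (real (Suc i) * \<eta>) \<omega> - W (real i * \<eta>) \<omega> + u i \<omega> else 0)"

text \<open>A discrete stochastic exponential. It is positive everywhere, so its logarithm, a finite
  sum, makes sense pointwise.\<close>

definition girsanov_density :: "real \<Rightarrow> (nat \<Rightarrow> 'w \<Rightarrow> real ^ 'd) \<Rightarrow> nat \<Rightarrow> 'w \<Rightarrow> real" where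
  "girsanov_density \<eta> u j \<omega> = (\<Prod>i<j. tilt \<eta> (W (real (Suc i) * \<eta>) \<omega> - W (real i * \<eta>) \<omega>) (u i \<omega>))"

lemma tilt_measurable [measurable]:
  "f \<in> borel_measurable L \<Longrightarrow> g \<in> borel_measurable L \<Longrightarrow> (\<lambda>x. tilt v (f x) (g x :: real ^ 'd)) \<in> borel_measurable L"
  unfolding tilt_def
  by (intro measurable_compose[OF _ borel_measurable_exp] borel_measurable_diff borel_measurable_divide
      borel_measurable_uminus borel_measurable_inner borel_measurable_const)

lemma girsanov_density_pos: "0 < girsanov_density \<eta> u j \<omega>"
  unfolding girsanov_density_def tilt_def by (intro prod_pos) auto

lemma noise_adapted:
  assumes "\<eta> > 0" "\<And>i. i < j \<Longrightarrow> u i \<in> borel_measurable (F (real i * \<eta>))"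
  shows "shifted_noise \<eta> u j \<in> borel_measurable (F (real j * \<eta>))"
    "girsanov_density \<eta> u j \<in> borel_measurable (F (real j * \<eta>))"
proof -
  have W: "W (real i * \<eta>) \<in> borel_measurable (F (real j * \<eta>))" if "i \<le> j" for i
    using W_adapted[of "real i * \<eta>"] assms(1) that
    by (auto intro: F_measurable_mono[where s="real i * \<eta>"] mult_right_mono)
  have u: "u i \<in> borel_measurable (F (real j * \<eta>))" if "i < j" for i
    using assms(2)[OF that] assms(1) that by (auto intro: F_measurable_mono[where s="real i * \<eta>"] mult_right_mono)
  have D: "(\<lambda>\<omega>. W (real (Suc i) * \<eta>) \<omega> - W (real i * \<eta>) \<omega>) \<in> borel_measurable (F (real j * \<eta>))" if "i < j" for i
    using that W[of i] W[of "Suc i"] by (intro borel_measurable_diff) auto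
  show "shifted_noise \<eta> u j \<in> borel_measurable (F (real j * \<eta>))"
    unfolding shifted_noise_def
  proof (rule measurable_coordinatewise_then_product)
    show "(\<lambda>x. if i < j then W (real (Suc i) * \<eta>) x - W (real i * \<eta>) x + u i x else 0) \<in> borel_measurable (F (real j * \<eta>))" for i
      using D[of i] u[of i] by (cases "i < j") (auto intro: borel_measurable_add)
  qed
  show "girsanov_density \<eta> u j \<in> borel_measurable (F (real j * \<eta>))"
    unfolding girsanov_density_def by (intro borel_measurable_prod tilt_measurable D u) auto
qed

text \<open>Adaptedness of the shifts allows the last increment to be integrated out with the past
  frozen, and a translation of Lebesgue measure then removes its shift. The right-hand side involves
  neither \<open>M\<close> nor \<open>W\<close>, so it can be matched with the value obtained from
  another Brownian motion on another space.\<close>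

lemma girsanov_grid:
  assumes "\<eta> > 0" "\<And>i. i < j \<Longrightarrow> u i \<in> borel_measurable (F (real i * \<eta>))"
    and "\<phi> \<in> borel_measurable borel"
  shows "(\<integral>\<^sup>+\<omega>. ennreal (girsanov_density \<eta> u j \<omega>) * \<phi> (shifted_noise \<eta> u j \<omega>) \<partial>M) = gauss_iter \<eta> j \<phi>"
  using assms(2,3)
proof (induction j arbitrary: \<phi>)
  case 0
  then show ?case by (simp add: girsanov_density_def shifted_noise_def emeasure_space_1)
next
  case (Suc j)
  note [measurable] = Suc.prems(2)
  let ?s = "real j * \<eta>" and ?t = "real (Suc j) * \<eta>"
  have st: "0 \<le> ?s" "?s < ?t" "?t - ?s = \<eta>" using assms(1) by (auto simp: algebra_simps)
  let ?L = "borel \<Otimes>\<^sub>M (borel \<Otimes>\<^sub>M borel) :: (real \<times> (nat \<Rightarrow> real ^ 'd) \<times> (real ^ 'd)) measure"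
  \<comment> \<open>All the data known at time \<open>real j * \<eta>\<close> that enter the last
    step: density, noise and the next shift.\<close>
  define K where "K \<omega> = (girsanov_density \<eta> u j \<omega>, shifted_noise \<eta> u j \<omega>, u j \<omega>)" for \<omega>
  define \<Psi> where "\<Psi> = (\<lambda>((d, x, v), z). ennreal d * (ennreal (tilt \<eta> z v) * \<phi> (x(j := z + v))))"
  define \<phi>' where "\<phi>' x = (\<integral>\<^sup>+y. ennreal (gauss_density \<eta> y) * \<phi> (x(j := y)) \<partial>lborel)" for x
  have [measurable]: "K \<in> measurable (F ?s) ?L"
    unfolding K_def using noise_adapted[OF assms(1), of j u] Suc.prems by (intro measurable_Pair) auto
  have [measurable]: "\<Psi> \<in> borel_measurable (?L \<Otimes>\<^sub>M borel)"
    unfolding \<Psi>_def case_prod_beta by measurable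
  \<comment> \<open>The tilt turns the Gaussian density at \<open>y\<close> into the one at
    \<open>y + u j \<omega>\<close>; then \<open>y + u j \<omega>\<close> becomes the new
    integration variable.\<close>
  have shift: "(\<integral>\<^sup>+y. ennreal (gauss_density \<eta> y) * \<Psi> (K \<omega>, y) \<partial>lborel) =
      ennreal (girsanov_density \<eta> u j \<omega>) * \<phi>' (shifted_noise \<eta> u j \<omega>)" for \<omega>
  proof -
    let ?x = "shifted_noise \<eta> u j \<omega>"
    have e: "ennreal (gauss_density \<eta> (y + u j \<omega>)) = ennreal (gauss_density \<eta> y) * ennreal (tilt \<eta> y (u j \<omega>))" for y
      using gauss_density_shift[OF assms(1), of y "u j \<omega>"]
      by (simp add: gauss_density_nonneg flip: ennreal_mult')
    have "(\<integral>\<^sup>+y. ennreal (gauss_density \<eta> y) * \<Psi> (K \<omega>, y) \<partial>lborel) =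
        (\<integral>\<^sup>+y. ennreal (girsanov_density \<eta> u j \<omega>) * (ennreal (gauss_density \<eta> (u j \<omega> + y)) * \<phi> (?x(j := u j \<omega> + y))) \<partial>lborel)"
      by (intro nn_integral_cong) (simp add: e \<Psi>_def K_def mult_ac add.commute)
    also have "\<dots> = ennreal (girsanov_density \<eta> u j \<omega>) *
        (\<integral>\<^sup>+y. ennreal (gauss_density \<eta> (u j \<omega> + y)) * \<phi> (?x(j := u j \<omega> + y)) \<partial>lborel)"
      by (rule nn_integral_cmult) simp
    also have "(\<integral>\<^sup>+y. ennreal (gauss_density \<eta> (u j \<omega> + y)) * \<phi> (?x(j := u j \<omega> + y)) \<partial>lborel) =
        (\<integral>\<^sup>+y. ennreal (gauss_density \<eta> y) * \<phi> (?x(j := y)) \<partial>distr lborel borel ((+) (u j \<omega>)))"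
      by (rule nn_integral_distr[symmetric]) simp_all
    finally show ?thesis by (simp add: lborel_distr_plus \<phi>'_def)
  qed
  have noise_Suc: "shifted_noise \<eta> u (Suc j) \<omega> = (shifted_noise \<eta> u j \<omega>)(j := W ?t \<omega> - W ?s \<omega> + u j \<omega>)" for \<omega>
    by (auto simp: shifted_noise_def fun_eq_iff less_Suc_eq)
  have "(\<integral>\<^sup>+\<omega>. ennreal (girsanov_density \<eta> u (Suc j) \<omega>) * \<phi> (shifted_noise \<eta> u (Suc j) \<omega>) \<partial>M) =
     (\<integral>\<^sup>+\<omega>. \<Psi> (K \<omega>, W ?t \<omega> - W ?s \<omega>) \<partial>M)"
    unfolding noise_Suc
    by (intro nn_integral_cong)
       (simp add: \<Psi>_def K_def girsanov_density_def ennreal_mult tilt_def prod_nonneg mult.assoc del: of_nat_Suc)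
  also have "\<dots> = (\<integral>\<^sup>+\<omega>. (\<integral>\<^sup>+y. ennreal (gauss_density \<eta> y) * \<Psi> (K \<omega>, y) \<partial>lborel) \<partial>M)"
    using freeze[of ?s ?t K ?L \<Psi>] st by simp
  also have "\<dots> = (\<integral>\<^sup>+\<omega>. ennreal (girsanov_density \<eta> u j \<omega>) * \<phi>' (shifted_noise \<eta> u j \<omega>) \<partial>M)"
    unfolding shift ..
  also have "\<dots> = gauss_iter \<eta> j \<phi>'"
  proof (rule Suc.IH)
    show "\<phi>' \<in> borel_measurable borel" unfolding \<phi>'_def by measurable
  qed (use Suc.prems in auto)
  finally show ?case by (simp add: \<phi>'_def[abs_def])
qed

text \<open>The products of \<open>u i\<close> with the following increment have mean zero, so only
  the quadratic terms survive. Minus this expectation is the entropy of \<open>M\<close> relative to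
  the tilted measure; being taken under \<open>M\<close>, it asks only for second moments of the
  shifts.\<close>

lemma girsanov_log:
  assumes \<eta>: "\<eta> > 0" and u: "\<And>i. i < j \<Longrightarrow> u i \<in> borel_measurable (F (real i * \<eta>))"
    and L2: "\<And>i. i < j \<Longrightarrow> integrable M (\<lambda>\<omega>. (norm (u i \<omega>))\<^sup>2)"
  shows "integrable M (\<lambda>\<omega>. ln (girsanov_density \<eta> u j \<omega>))"
    "expectation (\<lambda>\<omega>. ln (girsanov_density \<eta> u j \<omega>)) = - (\<Sum>i<j. expectation (\<lambda>\<omega>. (norm (u i \<omega>))\<^sup>2) / (2 * \<eta>))"
proof -
  define D where "D i \<omega> = W (real (Suc i) * \<eta>) \<omega> - W (real i * \<eta>) \<omega>" for i \<omega>
  have ln_eq: "ln (girsanov_density \<eta> u j \<omega>) = (\<Sum>i<j. - ((\<Sum>k\<in>UNIV. u i \<omega> $ k * D i \<omega> $ k) / \<eta> + (norm (u i \<omega>))\<^sup>2 / (2 * \<eta>)))" for \<omega>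
    unfolding girsanov_density_def
    by (subst ln_prod) (auto simp: tilt_def D_def inner_vec_def mult.commute power2_norm_eq_inner intro!: sum.cong)
  have orth: "integrable M (\<lambda>\<omega>. u i \<omega> $ k * D i \<omega> $ k)" "expectation (\<lambda>\<omega>. u i \<omega> $ k * D i \<omega> $ k) = 0" if i: "i < j" for i k
  proof -
    have [measurable]: "u i \<in> borel_measurable M" by (rule F_measurable[OF u[OF i]])
    have m: "(\<lambda>\<omega>. u i \<omega> $ k) \<in> borel_measurable (F (real i * \<eta>))" 
      by (rule measurable_compose[OF u[OF i] borel_measurable_nth])
    have "integrable M (\<lambda>\<omega>. (u i \<omega> $ k)\<^sup>2)"
    proof (rule Bochner_Integration.integrable_bound[OF L2[OF i]])
      show "AE \<omega> in M. norm ((u i \<omega> $ k)\<^sup>2) \<le> norm ((norm (u i \<omega>))\<^sup>2)"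
        by (simp add: component_le_norm_cart flip: abs_le_square_iff)
    qed (use F_measurable[OF m] in measurable)
    then have "integrable M (\<lambda>\<omega>. u i \<omega> $ k)"
      by (rule square_integrable_imp_integrable[OF F_measurable[OF m]])
    from increment_orthogonal[OF _ _ m this, of "real (Suc i) * \<eta>" k] \<eta>
    show "integrable M (\<lambda>\<omega>. u i \<omega> $ k * D i \<omega> $ k)" "expectation (\<lambda>\<omega>. u i \<omega> $ k * D i \<omega> $ k) = 0"
      by (simp_all add: D_def algebra_simps)
  qed
  show "integrable M (\<lambda>\<omega>. ln (girsanov_density \<eta> u j \<omega>))"
    unfolding ln_eq
    by (intro Bochner_Integration.integrable_sum integrable_minus Bochner_Integration.integrable_add integrable_divide orth L2) auto
  have "expectation (\<lambda>\<omega>. ln (girsanov_density \<eta> u j \<omega>)) =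
    (\<Sum>i<j. - ((\<Sum>k\<in>UNIV. expectation (\<lambda>\<omega>. u i \<omega> $ k * D i \<omega> $ k)) / \<eta> + expectation (\<lambda>\<omega>. (norm (u i \<omega>))\<^sup>2) / (2 * \<eta>)))"
    unfolding ln_eq using orth L2 by (simp add: Bochner_Integration.integral_sum Bochner_Integration.integral_add)
  then show "expectation (\<lambda>\<omega>. ln (girsanov_density \<eta> u j \<omega>)) = - (\<Sum>i<j. expectation (\<lambda>\<omega>. (norm (u i \<omega>))\<^sup>2) / (2 * \<eta>))"
    by (simp add: orth sum_negf)
qed

end

text \<open>Total variation is bounded by relative entropy through the Hellinger distance: \<open>1 + ln D / 2 \<le> sqrt D\<close>.\<close>

lemma (in prob_space) total_variation_le_relative_entropy:
  fixes D :: "'a \<Rightarrow> real"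
  assumes [measurable]: "D \<in> borel_measurable M" and pos: "\<And>\<omega>. 0 < D \<omega>"
    and int: "integrable M D" "expectation D = 1" "integrable M (\<lambda>\<omega>. ln (D \<omega>))"
    and ent: "- expectation (\<lambda>\<omega>. ln (D \<omega>)) \<le> s\<^sup>2" "0 < s"
  shows "expectation (\<lambda>\<omega>. \<bar>1 - D \<omega>\<bar>) \<le> 2 * s"
proof -
  have sq_le: "sqrt (D \<omega>) \<le> 1 + D \<omega>" for \<omega>
    by (rule real_le_lsqrt) (use pos[of \<omega>] in \<open>auto simp: power2_eq_square algebra_simps\<close>)
  have int_sqrt: "integrable M (\<lambda>\<omega>. sqrt (D \<omega>))"
  proof (rule Bochner_Integration.integrable_bound)
    show "integrable M (\<lambda>\<omega>. 1 + D \<omega>)" using int by simp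
    have "norm (sqrt (D \<omega>)) \<le> norm (1 + D \<omega>)" for \<omega> using sq_le[of \<omega>] pos[of \<omega>] by simp
    then show "AE \<omega> in M. norm (sqrt (D \<omega>)) \<le> norm (1 + D \<omega>)" by simp
  qed simp
  \<comment> \<open>With r = sqrt D, the left side is |1 - r| (1 + r), split by Young's inequality
    with weight \<open>s\<close>. The first quotient is (1 - r)^2 / s written so that its
    expectation involves only the mean of r.\<close>
  have "\<bar>1 - D \<omega>\<bar> \<le> (2 + 2 * D \<omega> - 4 * sqrt (D \<omega>)) / 2 / s + s / 4 * (2 + 2 * D \<omega>)" for \<omega>
  proof -
    define r where "r = sqrt (D \<omega>)"
    have r: "0 \<le> r" "D \<omega> = r\<^sup>2" using pos[of \<omega>] by (auto simp: r_def less_imp_le)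
    have "\<bar>1 - r\<^sup>2\<bar> = \<bar>1 - r\<bar> * (1 + r)"
    proof -
      have "1 - r\<^sup>2 = (1 - r) * (1 + r)" by (simp add: power2_eq_square algebra_simps)
      then show ?thesis using r by (simp add: abs_mult)
    qed
    also have "\<dots> \<le> (1 - r)\<^sup>2 / s + s / 4 * (1 + r)\<^sup>2"
    proof -
      have "0 \<le> (\<bar>1 - r\<bar> - s / 2 * (1 + r))\<^sup>2 / s" using ent(2) by simp
      also have "\<dots> = (1 - r)\<^sup>2 / s + s / 4 * (1 + r)\<^sup>2 - \<bar>1 - r\<bar> * (1 + r)"
        using ent(2) by (simp add: field_simps power2_eq_square)
      finally show ?thesis by simp
    qed
    also have "\<dots> \<le> (2 + 2 * r\<^sup>2 - 4 * r) / 2 / s + s / 4 * (2 + 2 * r\<^sup>2)"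
    proof (rule add_mono)
      have "(1 - r)\<^sup>2 = (2 + 2 * r\<^sup>2 - 4 * r) / 2" by (simp add: power2_eq_square algebra_simps)
      then show "(1 - r)\<^sup>2 / s \<le> (2 + 2 * r\<^sup>2 - 4 * r) / 2 / s" by (simp only: order_refl)
      have "(1 + r)\<^sup>2 \<le> 2 + 2 * r\<^sup>2" using sum_squares_bound[of 1 r] by (simp add: power2_eq_square algebra_simps)
      then show "s / 4 * (1 + r)\<^sup>2 \<le> s / 4 * (2 + 2 * r\<^sup>2)" using ent(2) by simp
    qed
    finally show ?thesis using r(1) unfolding r(2) by (simp only: real_sqrt_abs abs_of_nonneg)
  qed
  then have "expectation (\<lambda>\<omega>. \<bar>1 - D \<omega>\<bar>) \<le>
      expectation (\<lambda>\<omega>. (2 + 2 * D \<omega> - 4 * sqrt (D \<omega>)) / 2 / s + s / 4 * (2 + 2 * D \<omega>))"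
    using int int_sqrt by (intro integral_mono) auto
  also have "\<dots> = (4 - 4 * expectation (\<lambda>\<omega>. sqrt (D \<omega>))) / 2 / s + s"
    using int int_sqrt by (simp add: prob_space)
  also have "\<dots> \<le> s\<^sup>2 / s + s"
  proof -
    \<comment> \<open>The logarithmic inequality bounds the squared Hellinger term 2 - 2 E sqrt D by
      -E ln D, hence by s^2.\<close>
    have "expectation (\<lambda>\<omega>. 1 + ln (D \<omega>) / 2) \<le> expectation (\<lambda>\<omega>. sqrt (D \<omega>))"
    proof (rule integral_mono)
      fix \<omega>
      have "ln (D \<omega>) / 2 = ln (sqrt (D \<omega>))" using pos[of \<omega>] by (simp add: ln_sqrt)
      also have "\<dots> \<le> sqrt (D \<omega>) - 1" using pos[of \<omega>] by (intro ln_le_minus_one) simp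
      finally show "1 + ln (D \<omega>) / 2 \<le> sqrt (D \<omega>)" by simp
    qed (use int int_sqrt in auto)
    then have "1 + expectation (\<lambda>\<omega>. ln (D \<omega>)) / 2 \<le> expectation (\<lambda>\<omega>. sqrt (D \<omega>))"
      using int by (simp add: prob_space)
    then have "(4 - 4 * expectation (\<lambda>\<omega>. sqrt (D \<omega>))) / 2 \<le> s\<^sup>2" using ent(1) by simp
    then show ?thesis using ent(2) by (intro add_mono divide_right_mono) auto
  qed
  also have "\<dots> = 2 * s" using ent(2) by (simp add: power2_eq_square)
  finally show ?thesis .
qed

text \<open>The expectation of \<phi> under the plain noise of \<open>V\<close> equals the one under
  the shifted noise of \<open>W\<close> weighted by \<open>D\<close>. The difference is thus the
  integral of \<open>(1 - D) * \<phi>\<close> on the first space, bounded by \<open>B\<close> times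
  the L1 norm of \<open>1 - D\<close>.\<close>

lemma shifted_noise_compare:
  fixes W :: "real \<Rightarrow> 'v \<Rightarrow> real ^ 'd" and V :: "real \<Rightarrow> 'w \<Rightarrow> real ^ 'd"
  assumes "brownian M F W" "brownian N G V" and \<eta>: "\<eta> > 0"
    and u: "\<And>i. i < j \<Longrightarrow> u i \<in> borel_measurable (F (real i * \<eta>))"
    and L2: "\<And>i. i < j \<Longrightarrow> integrable M (\<lambda>\<omega>. (norm (u i \<omega>))\<^sup>2)"
    and ent: "(\<Sum>i<j. (\<integral>\<omega>. (norm (u i \<omega>))\<^sup>2 \<partial>M) / (2 * \<eta>)) \<le> s\<^sup>2" "0 < s"
    and \<phi>[measurable]: "\<phi> \<in> borel_measurable borel" and B: "\<And>x. \<bar>\<phi> x\<bar> \<le> B"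
  shows "\<bar>(\<integral>\<omega>. \<phi> (brownian.shifted_noise W \<eta> u j \<omega>) \<partial>M) -
          (\<integral>\<omega>. \<phi> (brownian.shifted_noise V \<eta> (\<lambda>_ _. 0) j \<omega>) \<partial>N)\<bar> \<le> 2 * B * s"
proof -
  interpret P: brownian M F W by fact
  interpret Q: brownian N G V by fact
  define w where "w = P.shifted_noise \<eta> u j"
  define v where "v = Q.shifted_noise \<eta> (\<lambda>_ _. 0) j"
  define D where "D = P.girsanov_density \<eta> u j"
  have [measurable]: "w \<in> borel_measurable M" "D \<in> borel_measurable M"
    using P.noise_adapted[OF \<eta>, of j u] u unfolding w_def D_def by (auto intro: P.F_measurable)
  have [measurable]: "v \<in> borel_measurable N"
    unfolding v_def using Q.noise_adapted(1)[OF \<eta>, of j "\<lambda>_ _. 0"] by (auto intro: Q.F_measurable)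
  have Dpos: "0 < D \<omega>" for \<omega> unfolding D_def by (rule P.girsanov_density_pos)
  have tilt0: "tilt \<eta> x (0 :: real ^ 'd) = 1" for x by (simp add: tilt_def)
  \<comment> \<open>Both sides equal the same \<open>gauss_iter\<close>, the density for the zero
    shift being 1. The test function 1 then shows that \<open>D\<close> has expectation 1.\<close>
  have main: "(\<integral>\<^sup>+\<omega>. ennreal (D \<omega>) * \<psi> (w \<omega>) \<partial>M) = (\<integral>\<^sup>+\<omega>. \<psi> (v \<omega>) \<partial>N)"
    if "\<psi> \<in> borel_measurable borel" for \<psi>
    using P.girsanov_grid[OF \<eta> u that] Q.girsanov_grid[OF \<eta> _ that, of j "\<lambda>_ _. 0"]
    by (simp add: w_def v_def D_def Q.girsanov_density_def tilt0)
  have "(\<integral>\<^sup>+\<omega>. ennreal (D \<omega>) \<partial>M) = 1" using main[of "\<lambda>_. 1"] by (simp add: Q.emeasure_space_1)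
  then have intD: "integrable M D" "(\<integral>\<omega>. D \<omega> \<partial>M) = 1"
    using Dpos by (auto simp: integrable_iff_bounded integral_eq_nn_integral less_imp_le intro: AE_I2)
  have B0: "0 \<le> B" using B[of undefined] by simp
  have int_phi: "integrable M (\<lambda>\<omega>. \<phi> (w \<omega>))" "integrable N (\<lambda>\<omega>. \<phi> (v \<omega>))"
    using B by (auto intro!: P.integrable_const_bound[of _ B] Q.integrable_const_bound[of _ B])
  have int_D_phi: "integrable M (\<lambda>\<omega>. D \<omega> * \<phi> (w \<omega>))"
    using B B0 by (intro Bochner_Integration.integrable_bound[OF integrable_mult_right[OF intD(1), of B]] AE_I2)
       (auto simp: abs_mult mult.commute[of B] intro!: mult_left_mono)
  \<comment> \<open>Adding \<open>B\<close> makes the test function nonnegative, as the change of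
    measure is stated for nonnegative integrals.\<close>
  have "(\<integral>\<omega>. D \<omega> * (\<phi> (w \<omega>) + B) \<partial>M) = (\<integral>\<omega>. \<phi> (v \<omega>) + B \<partial>N)"
  proof -
    have nn: "0 \<le> \<phi> x + B" for x using B[of x] by linarith
    have "(\<integral>\<omega>. D \<omega> * (\<phi> (w \<omega>) + B) \<partial>M) = enn2real (\<integral>\<^sup>+\<omega>. ennreal (D \<omega>) * ennreal (\<phi> (w \<omega>) + B) \<partial>M)"
      using Dpos nn by (subst integral_eq_nn_integral) (auto simp: ennreal_mult less_imp_le)
    also have "\<dots> = enn2real (\<integral>\<^sup>+\<omega>. ennreal (\<phi> (v \<omega>) + B) \<partial>N)"
      by (subst main) auto
    also have "\<dots> = (\<integral>\<omega>. \<phi> (v \<omega>) + B \<partial>N)" using nn by (subst integral_eq_nn_integral) auto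
    finally show ?thesis .
  qed
  then have "(\<integral>\<omega>. \<phi> (v \<omega>) \<partial>N) = (\<integral>\<omega>. D \<omega> * \<phi> (w \<omega>) \<partial>M)"
    using int_phi int_D_phi intD by (simp add: distrib_left Q.prob_space)
  then have "(\<integral>\<omega>. \<phi> (w \<omega>) \<partial>M) - (\<integral>\<omega>. \<phi> (v \<omega>) \<partial>N) = (\<integral>\<omega>. (1 - D \<omega>) * \<phi> (w \<omega>) \<partial>M)"
    using int_phi int_D_phi by (simp add: left_diff_distrib)
  also have "\<bar>\<dots>\<bar> \<le> (\<integral>\<omega>. \<bar>(1 - D \<omega>) * \<phi> (w \<omega>)\<bar> \<partial>M)" by (rule integral_abs_bound)
  also have "\<dots> \<le> (\<integral>\<omega>. \<bar>1 - D \<omega>\<bar> * B \<partial>M)"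
  proof (rule integral_mono)
    show "integrable M (\<lambda>\<omega>. \<bar>(1 - D \<omega>) * \<phi> (w \<omega>)\<bar>)" using int_phi int_D_phi by (simp add: left_diff_distrib)
    show "integrable M (\<lambda>\<omega>. \<bar>1 - D \<omega>\<bar> * B)" using intD by simp
    show "\<bar>(1 - D \<omega>) * \<phi> (w \<omega>)\<bar> \<le> \<bar>1 - D \<omega>\<bar> * B" for \<omega>
      using B by (simp add: abs_mult mult_left_mono)
  qed
  also have "\<dots> \<le> 2 * s * B"
  proof -
    have "(\<integral>\<omega>. \<bar>1 - D \<omega>\<bar> \<partial>M) \<le> 2 * s"
    proof (rule P.total_variation_le_relative_entropy)
      show "integrable M (\<lambda>\<omega>. ln (D \<omega>))" "- (\<integral>\<omega>. ln (D \<omega>) \<partial>M) \<le> s\<^sup>2"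
        using P.girsanov_log[OF \<eta> u L2] ent(1) by (simp_all add: D_def)
    qed (use Dpos intD ent in auto)
    then show ?thesis using B0 by (simp add: mult_right_mono)
  qed
  finally show ?thesis unfolding w_def v_def by (simp add: mult_ac)
qed

section \<open>Maximal inequalities\<close>

text \<open>The maximum of 0 and \<open>S 1\<close>, ..., \<open>S i\<close>, hence nonnegative; it
  is the usual running maximum when \<open>S 0 = 0\<close>.\<close>

primrec running_max :: "(nat \<Rightarrow> real) \<Rightarrow> nat \<Rightarrow> real" where
  "running_max S 0 = 0"
| "running_max S (Suc i) = max (running_max S i) (S (Suc i))"

lemma running_max_ge: "S 0 = 0 \<Longrightarrow> l \<le> i \<Longrightarrow> S l \<le> running_max S i"
  by (induction i) (auto simp: le_Suc_eq le_max_iff_disj)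

text \<open>A crude bound that serves to make the running maximum square integrable, before the
  sharp estimate is available.\<close>

lemma running_max_square: "(running_max S i)\<^sup>2 \<le> (\<Sum>l\<le>i. (S l)\<^sup>2)"
proof (induction i)
  case (Suc i)
  then show ?case by (auto simp: max_def sum_nonneg intro: add_increasing add_increasing2)
qed simp

text \<open>A pathwise form of Doob's \<open>L\<^sup>2\<close> inequality: the sum is a martingale transform and has mean zero.\<close>

lemma doob_pathwise:
  assumes "S 0 = 0"
  shows "(running_max S n)\<^sup>2 \<le> 4 * (S n)\<^sup>2 - 4 * (\<Sum>j<n. running_max S j * (S (Suc j) - S j))"
proof -
  \<comment> \<open>A discrete integration by parts. The maximum m moves only when a new value s
    exceeds it, and the inequality then loses (s - m)^2 / 2. Splitting the product
    \<open>running_max S n * S n\<close> afterwards produces the factor 4.\<close>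
  have "(\<Sum>j<n. running_max S j * (S (Suc j) - S j)) \<le> running_max S n * S n - (running_max S n)\<^sup>2 / 2"
  proof (induction n)
    case (Suc n)
    let ?m = "running_max S n" and ?s = "S (Suc n)"
    have "?m * ?s - ?m\<^sup>2 / 2 \<le> max ?m ?s * ?s - (max ?m ?s)\<^sup>2 / 2"
    proof (cases "?s \<le> ?m")
      case False
      have "0 \<le> (?s - ?m)\<^sup>2 / 2" by simp
      then show ?thesis using False by (simp add: max_def power2_eq_square field_simps)
    qed (simp add: max_def)
    then show ?case using Suc by (simp add: algebra_simps)
  qed (simp add: assms)
  moreover have "running_max S n * S n \<le> (running_max S n)\<^sup>2 / 4 + (S n)\<^sup>2"
    using zero_le_power2[of "running_max S n / 2 - S n"] by (simp add: power2_eq_square field_simps)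
  ultimately show ?thesis by linarith
qed

context brownian
begin

text \<open>The running maximum controls a path from above only; the two signs \<open>c = 1\<close>
  and \<open>c = -1\<close> together control the absolute value.\<close>

lemma doob_component:
  fixes s :: "nat \<Rightarrow> real" and c :: real and k :: 'd
  assumes s: "0 \<le> s 0" "strict_mono s" and c: "\<bar>c\<bar> = 1"
  defines "S \<equiv> \<lambda>\<omega> l. c * (W (s l) \<omega> - W (s 0) \<omega>) $ k"
  shows "integrable M (\<lambda>\<omega>. (running_max (S \<omega>) n)\<^sup>2)"
    "expectation (\<lambda>\<omega>. (running_max (S \<omega>) n)\<^sup>2) \<le> 4 * (s n - s 0)"
proof -
  have s_less: "s i < s j" if "i < j" for i j using s(2) that by (simp add: strict_mono_def)
  have s_le: "s i \<le> s j" if "i \<le> j" for i j using s_less[of i j] that by (cases "i = j") auto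
  have s_nn: "0 \<le> s i" for i using s_le[of 0 i] s(1) by simp
  have W: "W (s l) \<in> borel_measurable (F (s n))" if "l \<le> n" for l n
    by (rule F_measurable_mono[OF W_adapted[OF s_nn] s_le[OF that]])
  have S_ad: "(\<lambda>\<omega>. S \<omega> l) \<in> borel_measurable (F (s n))" if "l \<le> n" for l n
    unfolding S_def using W[OF that] W[of 0 n]
    by (intro borel_measurable_times borel_measurable_const measurable_compose[OF _ borel_measurable_nth] borel_measurable_diff) auto
  have M_ad: "(\<lambda>\<omega>. running_max (S \<omega>) l) \<in> borel_measurable (F (s n))" if "l \<le> n" for l n
    using that by (induction l) (auto intro!: borel_measurable_max S_ad)
  have c2: "c\<^sup>2 = 1" using c by (metis power2_abs one_power2)
  have S_sq: "(S \<omega> l)\<^sup>2 = ((W (s l) \<omega> - W (s 0) \<omega>) $ k)\<^sup>2" for \<omega> l by (simp add: S_def power_mult_distrib c2 del: vector_minus_component)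
  have "integrable M (\<lambda>\<omega>. (S \<omega> l)\<^sup>2) \<and> expectation (\<lambda>\<omega>. (S \<omega> l)\<^sup>2) = s l - s 0" for l
  proof (cases "l = 0")
    case False
    then show ?thesis
      unfolding S_sq using increment_component_moments(3,4)[of "s 0" "s l" k] s(1) s_less[of 0 l] by auto
  qed (simp add: S_sq)
  then have S2: "integrable M (\<lambda>\<omega>. (S \<omega> l)\<^sup>2)" "expectation (\<lambda>\<omega>. (S \<omega> l)\<^sup>2) = s l - s 0" for l
    by blast+
  have Mm: "(\<lambda>\<omega>. running_max (S \<omega>) l) \<in> borel_measurable M" for l
    by (rule F_measurable[OF M_ad[OF order_refl]])
  have M2: "integrable M (\<lambda>\<omega>. (running_max (S \<omega>) n)\<^sup>2)" for n
  proof (rule Bochner_Integration.integrable_bound)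
    show "integrable M (\<lambda>\<omega>. \<Sum>l\<le>n. (S \<omega> l)\<^sup>2)" using S2 by (intro Bochner_Integration.integrable_sum)
    show "AE \<omega> in M. norm ((running_max (S \<omega>) n)\<^sup>2) \<le> norm (\<Sum>l\<le>n. (S \<omega> l)\<^sup>2)"
      using running_max_square by (intro AE_I2) (simp add: sum_nonneg)
  qed (use Mm in measurable)
  show "integrable M (\<lambda>\<omega>. (running_max (S \<omega>) n)\<^sup>2)" by (rule M2)
  have M1: "integrable M (\<lambda>\<omega>. running_max (S \<omega>) j)" for j
    by (rule square_integrable_imp_integrable[OF Mm M2])
  have orth: "integrable M (\<lambda>\<omega>. running_max (S \<omega>) j * (S \<omega> (Suc j) - S \<omega> j))"
    "expectation (\<lambda>\<omega>. running_max (S \<omega>) j * (S \<omega> (Suc j) - S \<omega> j)) = 0" for j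
  proof -
    have eq: "running_max (S \<omega>) j * (S \<omega> (Suc j) - S \<omega> j) = c * (running_max (S \<omega>) j * (W (s (Suc j)) \<omega> - W (s j) \<omega>) $ k)" for \<omega>
      by (simp add: S_def algebra_simps)
    note o = increment_orthogonal[OF s_nn s_less[OF lessI] M_ad[OF order_refl] M1, of j k]
    show "integrable M (\<lambda>\<omega>. running_max (S \<omega>) j * (S \<omega> (Suc j) - S \<omega> j))"
      unfolding eq by (intro integrable_mult_right o)
    show "expectation (\<lambda>\<omega>. running_max (S \<omega>) j * (S \<omega> (Suc j) - S \<omega> j)) = 0"
      unfolding eq by (subst integral_mult_right_zero) (simp only: o mult_zero_right)
  qed
  have "expectation (\<lambda>\<omega>. (running_max (S \<omega>) n)\<^sup>2) \<le>
      expectation (\<lambda>\<omega>. 4 * (S \<omega> n)\<^sup>2 - 4 * (\<Sum>j<n. running_max (S \<omega>) j * (S \<omega> (Suc j) - S \<omega> j)))"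
    using S2 orth M2
    by (intro integral_mono doob_pathwise Bochner_Integration.integrable_diff integrable_mult_right Bochner_Integration.integrable_sum)
       (auto simp: S_def)
  also have "\<dots> = 4 * (s n - s 0)"
    using S2 orth by (simp add: Bochner_Integration.integral_diff Bochner_Integration.integral_sum)
  finally show "expectation (\<lambda>\<omega>. (running_max (S \<omega>) n)\<^sup>2) \<le> 4 * (s n - s 0)" .
qed

text \<open>The constant is Doob's factor 4, times two signs, times the number of
  coordinates.\<close>

lemma doob:
  fixes s :: "nat \<Rightarrow> real"
  assumes s: "0 \<le> s 0" "strict_mono s"
  shows "(\<integral>\<^sup>+\<omega>. (SUP l\<in>{..n}. ennreal ((norm (W (s l) \<omega> - W (s 0) \<omega>))\<^sup>2)) \<partial>M) \<le> ennreal (8 * real CARD('d) * (s n - s 0))"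
proof -
  define R where "R c k \<omega> = (running_max (\<lambda>l. c * (W (s l) \<omega> - W (s 0) \<omega>) $ k) n)\<^sup>2" for c k \<omega>
  have R: "integrable M (R c k)" "expectation (R c k) \<le> 4 * (s n - s 0)" if "\<bar>c\<bar> = 1" for c k
    using doob_component[OF s that, where n=n and k=k] by (simp_all add: R_def[abs_def])
  have R_nn: "0 \<le> R c k \<omega>" for c k \<omega> by (simp add: R_def)
  have "(SUP l\<in>{..n}. ennreal ((norm (W (s l) \<omega> - W (s 0) \<omega>))\<^sup>2)) \<le> ennreal (\<Sum>k\<in>UNIV. R 1 k \<omega> + R (-1) k \<omega>)" for \<omega>
  proof (intro SUP_least ennreal_leI)
    fix l assume l: "l \<in> {..n}"
    have "(norm (W (s l) \<omega> - W (s 0) \<omega>))\<^sup>2 = (\<Sum>k\<in>UNIV. ((W (s l) \<omega> - W (s 0) \<omega>) $ k)\<^sup>2)"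
      unfolding power2_norm_eq_inner inner_vec_def by (simp add: power2_eq_square)
    also have "\<dots> \<le> (\<Sum>k\<in>UNIV. R 1 k \<omega> + R (-1) k \<omega>)"
    proof (rule sum_mono)
      fix k
      define z where "z = (W (s l) \<omega> - W (s 0) \<omega>) $ k"
      have ge: "c * z \<le> running_max (\<lambda>l. c * (W (s l) \<omega> - W (s 0) \<omega>) $ k) n" for c
        unfolding z_def by (rule running_max_ge) (use l in auto)
      show "((W (s l) \<omega> - W (s 0) \<omega>) $ k)\<^sup>2 \<le> R 1 k \<omega> + R (-1) k \<omega>"
      proof (cases "0 \<le> z")
        case True
        then have "z\<^sup>2 \<le> R 1 k \<omega>" unfolding R_def using ge[of 1] by (intro power_mono) auto
        then show ?thesis using R_nn[of "-1" k \<omega>] unfolding z_def[symmetric] by linarith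
      next
        case False
        then have "(- z)\<^sup>2 \<le> R (-1) k \<omega>" unfolding R_def using ge[of "-1"] by (intro power_mono) auto
        then have "z\<^sup>2 \<le> R (-1) k \<omega>" by simp
        then show ?thesis using R_nn[of 1 k \<omega>] unfolding z_def[symmetric] by linarith
      qed
    qed
    finally show "(norm (W (s l) \<omega> - W (s 0) \<omega>))\<^sup>2 \<le> (\<Sum>k\<in>UNIV. R 1 k \<omega> + R (-1) k \<omega>)" .
  qed
  then have "(\<integral>\<^sup>+\<omega>. (SUP l\<in>{..n}. ennreal ((norm (W (s l) \<omega> - W (s 0) \<omega>))\<^sup>2)) \<partial>M) \<le>
      (\<integral>\<^sup>+\<omega>. ennreal (\<Sum>k\<in>UNIV. R 1 k \<omega> + R (-1) k \<omega>) \<partial>M)"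
    by (intro nn_integral_mono)
  also have "\<dots> = ennreal (\<Sum>k\<in>UNIV. expectation (R 1 k) + expectation (R (-1) k))"
    using R R_nn by (subst nn_integral_eq_integral) (auto simp: sum_nonneg)
  also have "\<dots> \<le> ennreal (\<Sum>k\<in>(UNIV::'d set). 4 * (s n - s 0) + 4 * (s n - s 0))"
    using R by (intro ennreal_leI sum_mono add_mono) auto
  also have "\<dots> = ennreal (8 * real CARD('d) * (s n - s 0))" by (simp add: algebra_simps)
  finally show ?thesis .
qed

text \<open>A measurable majorant of the squared supremum of the noise over \<open>{0..T}\<close>
  along continuous paths. Only countably many times enter, and the lower limit is ready for Fatou's
  lemma.\<close>

definition sup_square :: "real \<Rightarrow> 'w \<Rightarrow> ennreal" where
  "sup_square T \<omega> = liminf (\<lambda>n. SUP l\<in>{..Suc n}. ennreal ((norm (W (real l * (T / real (Suc n))) \<omega> - W 0 \<omega>))\<^sup>2))"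

lemma sup_square_measurable:
  assumes "0 < T" shows "sup_square T \<in> borel_measurable M"
proof -
  have "(\<lambda>\<omega>. W (real l * (T / real (Suc n))) \<omega> - W 0 \<omega>) \<in> borel_measurable M" for l n
    using assms by (intro increment_measurable) auto
  then show ?thesis unfolding sup_square_def[abs_def]
    by (intro borel_measurable_liminf borel_measurable_SUP measurable_compose[OF _ measurable_ennreal] borel_measurable_power borel_measurable_norm) auto
qed

text \<open>Fatou's lemma with the maximal inequality on each grid, whose bound is the same for all
  grids because each one ends at \<open>T\<close>.\<close>

lemma nn_integral_sup_square:
  assumes "0 < T"
  shows "(\<integral>\<^sup>+\<omega>. sup_square T \<omega> \<partial>M) \<le> ennreal (8 * real CARD('d) * T)"
proof -
  have D: "(\<lambda>\<omega>. W (real l * (T / real (Suc n))) \<omega> - W 0 \<omega>) \<in> borel_measurable M" for l n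
    using assms by (intro increment_measurable) auto
  have "(\<integral>\<^sup>+\<omega>. sup_square T \<omega> \<partial>M) \<le> liminf (\<lambda>n. \<integral>\<^sup>+\<omega>. (SUP l\<in>{..Suc n}. ennreal ((norm (W (real l * (T / real (Suc n))) \<omega> - W 0 \<omega>))\<^sup>2)) \<partial>M)"
    unfolding sup_square_def using D
    by (intro nn_integral_liminf borel_measurable_SUP measurable_compose[OF _ measurable_ennreal] borel_measurable_power borel_measurable_norm) auto
  also have "\<dots> \<le> liminf (\<lambda>n :: nat. ennreal (8 * real CARD('d) * T))"
  proof (intro Liminf_mono always_eventually allI)
    fix n :: nat
    have "strict_mono (\<lambda>l. real l * (T / real (Suc n)))"
      using assms by (auto simp: strict_mono_def intro!: mult_strict_right_mono divide_strict_right_mono)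
    from doob[OF _ this, of "Suc n"]
    show "(\<integral>\<^sup>+\<omega>. (SUP l\<in>{..Suc n}. ennreal ((norm (W (real l * (T / real (Suc n))) \<omega> - W 0 \<omega>))\<^sup>2)) \<partial>M) \<le> ennreal (8 * real CARD('d) * T)"
      by (simp del: of_nat_Suc)
  qed
  also have "\<dots> = ennreal (8 * real CARD('d) * T)" by (simp add: Liminf_const)
  finally show ?thesis .
qed

text \<open>On each grid the supremum dominates the value at the last grid point before
  \<open>t\<close>, and by continuity these values converge to the one at \<open>t\<close>.\<close>

lemma sup_square_ge:
  assumes "0 < T" "0 \<le> t" "t \<le> T" and cont: "continuous_on {0..} (\<lambda>t. W t \<omega>)"
  shows "ennreal ((norm (W t \<omega> - W 0 \<omega>))\<^sup>2) \<le> sup_square T \<omega>"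
proof -
  define h where "h n = T / real (Suc n)" for n
  define l where "l n = nat \<lfloor>t / h n\<rfloor>" for n
  have h: "h n > 0" for n using assms by (simp add: h_def)
  have h0: "h \<longlonglongrightarrow> 0" unfolding h_def by (rule LIMSEQ_Suc[OF lim_const_over_n])
  have l: "real (l n) * h n \<le> t" "t < real (l n) * h n + h n" for n
  proof -
    have "0 \<le> t / h n" using assms h[of n] by simp
    then have "real (l n) \<le> t / h n" "t / h n < real (l n) + 1" unfolding l_def by linarith+
    then show "real (l n) * h n \<le> t" "t < real (l n) * h n + h n"
      using h[of n] by (auto simp: field_simps)
  qed
  have l_le: "l n \<le> Suc n" for n
  proof -
    have "real (l n) * h n \<le> real (Suc n) * h n" using l(1)[of n] assms by (simp add: h_def)
    then show ?thesis using h[of n] by (simp del: of_nat_Suc)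
  qed
  have lim_t: "(\<lambda>n. real (l n) * h n) \<longlonglongrightarrow> t"
  proof (rule tendsto_sandwich[OF _ _ _ tendsto_const])
    show "(\<lambda>n. t - h n) \<longlonglongrightarrow> t" using tendsto_diff[OF tendsto_const h0, of t] by simp
    show "\<forall>\<^sub>F n in sequentially. t - h n \<le> real (l n) * h n"
      using l(2) by (intro always_eventually allI) (smt (verit))
    show "\<forall>\<^sub>F n in sequentially. real (l n) * h n \<le> t" using l(1) by simp
  qed
  have "(\<lambda>n. W (real (l n) * h n) \<omega>) \<longlonglongrightarrow> W t \<omega>"
    by (rule continuous_on_tendsto_compose[OF cont lim_t]) (use assms h in \<open>auto simp: less_imp_le\<close>)
  then have "(\<lambda>n. ennreal ((norm (W (real (l n) * h n) \<omega> - W 0 \<omega>))\<^sup>2)) \<longlonglongrightarrow> ennreal ((norm (W t \<omega> - W 0 \<omega>))\<^sup>2)"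
    by (intro tendsto_ennrealI tendsto_intros)
  then have "ennreal ((norm (W t \<omega> - W 0 \<omega>))\<^sup>2) = liminf (\<lambda>n. ennreal ((norm (W (real (l n) * h n) \<omega> - W 0 \<omega>))\<^sup>2))"
    by (intro lim_imp_Liminf[symmetric]) auto
  also have "\<dots> \<le> sup_square T \<omega>" unfolding sup_square_def h_def[symmetric]
    using l_le by (intro Liminf_mono always_eventually allI SUP_upper) auto
  finally show ?thesis .
qed

end

text \<open>Regularity encloses a Borel set between a compact and an open set of almost the same
  measure, and Urysohn's lemma supplies a continuous function between their indicators. Sums and
  dominated limits extend this to integrable functions.\<close>

lemma integrable_approx_continuous:
  fixes \<rho> :: "('a::euclidean_space) measure" and f :: "'a \<Rightarrow> real"
  assumes "finite_measure \<rho>" and sets: "sets \<rho> = sets borel" and "integrable \<rho> f" and "e > 0"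
  shows "\<exists>g. continuous_on UNIV g \<and> integrable \<rho> g \<and> (\<integral>x. \<bar>f x - g x\<bar> \<partial>\<rho>) < e"
proof -
  interpret finite_measure \<rho> by fact
  have space: "space \<rho> = UNIV" using sets_eq_imp_space_eq[OF sets] by simp
  have cm: "g \<in> borel_measurable \<rho>" if "continuous_on UNIV g" for g :: "'a \<Rightarrow> real"
    using borel_measurable_continuous_onI[OF that] sets by (simp add: measurable_cong_sets[OF sets refl])
  show ?thesis using assms(3,4)
  proof (induction f arbitrary: e rule: integrable_induct)
    case (base A c)
    then have A: "A \<in> sets borel" using sets by simp
    \<comment> \<open>The open and the compact set will differ by less than \<open>2 * e'\<close> in
      measure, which costs \<open>2 * e' * \<bar>c\<bar> < e\<close>; the added 1 covers
      \<open>c = 0\<close>.\<close>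
    define e' where "e' = e / (2 * (\<bar>c\<bar> + 1))"
    have e': "e' > 0" using base(3) by (simp add: e'_def)
    have fin: "emeasure \<rho> (space \<rho>) \<noteq> \<infinity>" by simp
    define m where "m = measure \<rho> A"
    have m: "emeasure \<rho> A = ennreal m" "0 \<le> m" by (simp_all add: m_def emeasure_eq_measure)
    obtain K where K: "compact K" "K \<subseteq> A" "m - e' < measure \<rho> K"
    proof (cases "m = 0")
      case True
      then show ?thesis using that[of "{}"] e' by simp
    next
      case False
      then have "ennreal (m - e') < (SUP K\<in>{K. K \<subseteq> A \<and> compact K}. emeasure \<rho> K)"
        unfolding inner_regular[OF sets fin A, symmetric] m(1) using False m(2) e' by (intro ennreal_lessI) auto
      then obtain K where K: "K \<subseteq> A" "compact K" "ennreal (m - e') < ennreal (measure \<rho> K)"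
        by (auto simp: less_SUP_iff emeasure_eq_measure)
      then have "m - e' < measure \<rho> K" by (metis ennreal_leI not_le)
      then show ?thesis using that K by blast
    qed
    obtain U where U: "open U" "A \<subseteq> U" "measure \<rho> U < m + e'"
    proof -
      have "(INF U\<in>{U. A \<subseteq> U \<and> open U}. emeasure \<rho> U) < ennreal (m + e')"
        unfolding outer_regular[OF sets fin A, symmetric] m(1) using m(2) e' by (intro ennreal_lessI) auto
      then obtain U where U: "A \<subseteq> U" "open U" "ennreal (measure \<rho> U) < ennreal (m + e')"
        by (auto simp: INF_less_iff emeasure_eq_measure)
      then have "measure \<rho> U < m + e'" by (metis ennreal_leI not_le)
      then show ?thesis using that U by blast
    qed
    obtain g :: "'a \<Rightarrow> real" where g: "continuous_on UNIV g" "\<And>x. g x \<in> closed_segment 0 1"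
      "\<And>x. x \<in> - U \<Longrightarrow> g x = 0" "\<And>x. x \<in> K \<Longrightarrow> g x = 1"
    proof (rule Urysohn[of "- U" K 0 "1::real"])
      show "closed (- U)" "closed K" "- U \<inter> K = {}" using U K by (auto simp: compact_imp_closed)
    qed (use that in blast)
    have g01: "0 \<le> g x" "g x \<le> 1" for x using g(2)[of x] by (auto simp: closed_segment_eq_real_ivl)
    have KU: "K \<in> sets \<rho>" "U \<in> sets \<rho>" 
      using K(1) U(1) unfolding sets by (auto intro: borel_closed compact_imp_closed)
    have int_g: "integrable \<rho> (\<lambda>x. g x * c)"
      using cm[OF g(1)] g01 by (intro integrable_mult_left integrable_const_bound[of _ 1]) auto
    have "(\<integral>x. \<bar>indicator A x *\<^sub>R c - g x * c\<bar> \<partial>\<rho>) \<le> (\<integral>x. (indicator U x - indicator K x) * \<bar>c\<bar> \<partial>\<rho>)"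
    proof (rule integral_mono)
      show "integrable \<rho> (\<lambda>x. \<bar>indicator A x *\<^sub>R c - g x * c\<bar>)"
        using integrable_real_indicator[OF base(1,2)] int_g
        by (intro integrable_abs Bochner_Integration.integrable_diff integrable_scaleR_left)
      show "integrable \<rho> (\<lambda>x. (indicator U x - indicator K x) * \<bar>c\<bar>)"
        using KU by (intro integrable_mult_left Bochner_Integration.integrable_diff integrable_real_indicator)
           (auto simp: emeasure_eq_measure)
      fix x
      have "\<bar>indicator A x - g x\<bar> \<le> indicator U x - indicator K x"
        using g(3,4)[of x] g01[of x] K(2) U(2) by (auto simp: indicator_def)
      then have "\<bar>indicator A x - g x\<bar> * \<bar>c\<bar> \<le> (indicator U x - indicator K x) * \<bar>c\<bar>" by (intro mult_right_mono) auto
      then show "\<bar>indicator A x *\<^sub>R c - g x * c\<bar> \<le> (indicator U x - indicator K x) * \<bar>c\<bar>"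
        by (simp add: abs_mult flip: left_diff_distrib)
    qed
    also have "\<dots> = (measure \<rho> U - measure \<rho> K) * \<bar>c\<bar>"
      using KU by (simp add: Bochner_Integration.integral_diff integrable_real_indicator emeasure_eq_measure)
    also have "\<dots> \<le> 2 * e' * \<bar>c\<bar>" using K U by (intro mult_right_mono) auto
    also have "\<dots> < e" using base(3) by (simp add: e'_def field_simps)
    finally show ?case using g int_g by (intro exI[of _ "\<lambda>x. g x * c"]) (auto intro: continuous_intros)
  next
    case (add f g)
    obtain f' where f': "continuous_on UNIV f'" "integrable \<rho> f'" "(\<integral>x. \<bar>f x - f' x\<bar> \<partial>\<rho>) < e / 2"
      using add.IH(1)[of "e / 2"] add.prems by auto
    obtain g' where g': "continuous_on UNIV g'" "integrable \<rho> g'" "(\<integral>x. \<bar>g x - g' x\<bar> \<partial>\<rho>) < e / 2"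
      using add.IH(2)[of "e / 2"] add.prems by auto
    have "(\<integral>x. \<bar>(f x + g x) - (f' x + g' x)\<bar> \<partial>\<rho>) \<le> (\<integral>x. \<bar>f x - f' x\<bar> + \<bar>g x - g' x\<bar> \<partial>\<rho>)"
      using add f' g' by (intro integral_mono) auto
    also have "\<dots> = (\<integral>x. \<bar>f x - f' x\<bar> \<partial>\<rho>) + (\<integral>x. \<bar>g x - g' x\<bar> \<partial>\<rho>)" using add f' g' by (intro Bochner_Integration.integral_add) auto
    also have "\<dots> < e" using f'(3) g'(3) by simp
    finally show ?case using f' g'
      by (intro exI[of _ "\<lambda>x. f' x + g' x"]) (auto intro: continuous_intros)
  next
    case (lim f s)
    have "(\<lambda>i. \<integral>x. \<bar>s i x - f x\<bar> \<partial>\<rho>) \<longlonglongrightarrow> (\<integral>x. 0 \<partial>\<rho>)"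
    proof (rule integral_dominated_convergence)
      \<comment> \<open>The approximants of the induction principle satisfy |s i| \<le> 2 |f|, which
        leaves 3 |f| for the difference.\<close>
      show "integrable \<rho> (\<lambda>x. 3 * \<bar>f x\<bar>)" using lim by auto
      show "AE x in \<rho>. (\<lambda>i. \<bar>s i x - f x\<bar>) \<longlonglongrightarrow> 0"
        using lim.hyps(2) by (intro AE_I2 tendsto_rabs_zero LIM_zero)
      have "\<bar>s i x - f x\<bar> \<le> 3 * \<bar>f x\<bar>" if "x \<in> space \<rho>" for i x
        using lim.hyps(3)[OF that, of i] by auto
      then show "AE x in \<rho>. norm \<bar>s i x - f x\<bar> \<le> 3 * \<bar>f x\<bar>" for i by (intro AE_I2) simp
    qed (use lim.hyps(1,4) in auto)
    then have "\<forall>\<^sub>F i in sequentially. (\<integral>x. \<bar>s i x - f x\<bar> \<partial>\<rho>) < e / 2"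
      using lim.prems by (intro order_tendstoD(2)) auto
    then obtain i where i: "(\<integral>x. \<bar>s i x - f x\<bar> \<partial>\<rho>) < e / 2"
      by (auto dest: eventually_happens)
    obtain g where g: "continuous_on UNIV g" "integrable \<rho> g" "(\<integral>x. \<bar>s i x - g x\<bar> \<partial>\<rho>) < e / 2"
      using lim.IH[of "e / 2" i] lim.prems by auto
    have "(\<integral>x. \<bar>f x - g x\<bar> \<partial>\<rho>) \<le> (\<integral>x. \<bar>s i x - f x\<bar> + \<bar>s i x - g x\<bar> \<partial>\<rho>)"
      using lim g by (intro integral_mono) auto
    also have "\<dots> = (\<integral>x. \<bar>s i x - f x\<bar> \<partial>\<rho>) + (\<integral>x. \<bar>s i x - g x\<bar> \<partial>\<rho>)"
      using lim g by (intro Bochner_Integration.integral_add) auto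
    also have "\<dots> < e" using i g(3) by simp
    finally show ?case using g by blast
  qed
qed

section \<open>Moments of the drift gap\<close>

lemma norm_matrix_vector_le: "norm (\<sigma> *v v) \<le> onorm ((*v) \<sigma>) * norm (v :: real ^ 'd)"
  for \<sigma> :: "real ^ 'd ^ 'd"
  by (rule onorm[OF matrix_vector_mul_bounded_linear])

context delay_drift
begin

definition growth_const :: real where
  "growth_const = norm (b 0) + norm (Z (\<lambda>_. 0)) + L2"

text \<open>Together with \<open>noise_const\<close> this gives an affine bound: along the solution
  the drift on \<open>{0..T}\<close> is at most
  \<open>path_const T + noise_const \<sigma> T * w\<close> if the noise stays below
  \<open>w\<close>. It results from \<open>apriori_bound\<close> with
  \<open>A = growth_const\<close> and \<open>B = L1 + L2\<close>.\<close>

definition path_const :: "real \<Rightarrow> real" where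
  "path_const T = growth_const + (L1 + L2) * (2 * exp ((2 * (L1 + L2) + 1) * T) * (seg_norm \<tau> \<xi> + growth_const * T))"

definition noise_const :: "real ^ 'd ^ 'd \<Rightarrow> real \<Rightarrow> real" where
  "noise_const \<sigma> T = (L1 + L2) * (2 * exp ((2 * (L1 + L2) + 1) * T) * onorm ((*v) \<sigma>))"

lemma \<xi>_le_seg_norm:
  assumes "-\<tau> \<le> r" "r \<le> 0"
  shows "norm (\<xi> r) \<le> seg_norm \<tau> \<xi>"
proof -
  have "compact ((\<lambda>\<theta>. norm (\<xi> \<theta>)) ` {-\<tau>..0})"
    by (intro compact_continuous_image continuous_on_norm \<xi>_cont) auto
  then show ?thesis unfolding seg_norm_def
    using assms by (intro cSUP_upper bounded_imp_bdd_above compact_imp_bounded) auto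
qed

text \<open>Extracts the rate. The Lipschitz part uses \<delta> \<le> \<delta> powr \<alpha>, valid
  as \<delta> < 1 and \<alpha> \<le> 1; the Hoelder part writes \<Delta>^2 as \<delta> times
  \<Delta>^2 / \<delta> before taking the power. Being linear in \<Delta>^2, the result calls only
  for second moments of the path increments.\<close>

lemma hoelder_power_bound:
  assumes "0 \<le> \<Delta>" "0 < \<delta>" "\<delta> < 1"
  shows "(L1 * \<Delta> + L2 * \<Delta> powr \<alpha>)\<^sup>2 \<le> 2 * (L1\<^sup>2 + L2\<^sup>2) * \<delta> powr \<alpha> * (1 + \<Delta>\<^sup>2 / \<delta>)"
proof -
  have *: "(u + v)\<^sup>2 \<le> 2 * u\<^sup>2 + 2 * v\<^sup>2" for u v :: real
    using sum_squares_bound[of u v] by (simp add: power2_sum)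
  have "(L1 * \<Delta> + L2 * \<Delta> powr \<alpha>)\<^sup>2 \<le> 2 * L1\<^sup>2 * \<Delta>\<^sup>2 + 2 * L2\<^sup>2 * (\<Delta> powr \<alpha>)\<^sup>2"
    using *[of "L1 * \<Delta>" "L2 * \<Delta> powr \<alpha>"] by (simp add: power_mult_distrib)
  also have "\<dots> \<le> 2 * L1\<^sup>2 * (\<delta> powr \<alpha> * (1 + \<Delta>\<^sup>2 / \<delta>)) + 2 * L2\<^sup>2 * (\<delta> powr \<alpha> * (1 + \<Delta>\<^sup>2 / \<delta>))"
  proof (intro add_mono mult_left_mono)
    have "\<delta> powr 1 \<le> \<delta> powr \<alpha>" using assms \<alpha>_le_1 by (intro powr_mono') auto
    then have d: "\<delta> \<le> \<delta> powr \<alpha>" using assms by simp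
    have "\<Delta>\<^sup>2 = \<delta> * (\<Delta>\<^sup>2 / \<delta>)" using assms by simp
    also have "\<dots> \<le> \<delta> powr \<alpha> * (1 + \<Delta>\<^sup>2 / \<delta>)" using d assms by (intro mult_mono) auto
    finally show "\<Delta>\<^sup>2 \<le> \<delta> powr \<alpha> * (1 + \<Delta>\<^sup>2 / \<delta>)" .
    have "(\<Delta> powr \<alpha>)\<^sup>2 = (\<Delta>\<^sup>2) powr \<alpha>"
      using assms by (simp add: power2_eq_square powr_mult)
    also have "\<dots> = \<delta> powr \<alpha> * (\<Delta>\<^sup>2 / \<delta>) powr \<alpha>"
      using assms by (simp flip: powr_mult)
    also have "\<dots> \<le> \<delta> powr \<alpha> * (1 + \<Delta>\<^sup>2 / \<delta>)"
      using assms \<alpha>_pos \<alpha>_le_1 by (intro mult_left_mono powr_le_1_plus) auto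
    finally show "(\<Delta> powr \<alpha>)\<^sup>2 \<le> \<delta> powr \<alpha> * (1 + \<Delta>\<^sup>2 / \<delta>)" .
  qed auto
  also have "\<dots> = 2 * (L1\<^sup>2 + L2\<^sup>2) * \<delta> powr \<alpha> * (1 + \<Delta>\<^sup>2 / \<delta>)" by (simp add: algebra_simps)
  finally show ?thesis .
qed

text \<open>Here \<open>p\<close> bounds the squared noise on the whole horizon and \<open>q\<close>
  its squared increments since the start of the block. The bound is affine in \<open>p\<close> and
  \<open>q / \<delta>\<close>, so Doob's inequality will control its mean.\<close>

lemma drift_gap_pathwise:
  fixes y :: "real \<Rightarrow> real ^ 'd"
  assumes "0 < T" and \<eta>: "\<eta> > 0" and \<delta>: "0 < \<delta>" "\<delta> < 1"
    and y0: "\<And>r. -\<tau> \<le> r \<Longrightarrow> r \<le> 0 \<Longrightarrow> y r = \<xi> r"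
    and cont: "continuous_on {-\<tau>..T} y"
    and int: "G integrable_on {0..T}"
    and G: "\<And>s. 0 \<le> s \<Longrightarrow> s \<le> T \<Longrightarrow> G s = b (y s) + Z (\<lambda>\<theta>. y (min (s + \<theta>) s))"
    and eq: "\<And>s. 0 \<le> s \<Longrightarrow> s \<le> T \<Longrightarrow> y s = \<xi> 0 + integral {0..s} G + \<sigma> *v (W s - W 0)"
    and p: "\<And>s. 0 \<le> s \<Longrightarrow> s \<le> T \<Longrightarrow> (norm (W s - W 0))\<^sup>2 \<le> p"
    and i: "a \<le> i" "real i * \<eta> \<le> T" "real (i - a) * \<eta> \<le> \<delta>"
    and q: "\<And>l. a \<le> l \<Longrightarrow> l \<le> i \<Longrightarrow> (norm (W (real l * \<eta>) - W (real a * \<eta>)))\<^sup>2 \<le> q"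
  shows "(norm (disc_drift \<eta> i i (\<lambda>l. y (real l * \<eta>)) - disc_drift \<eta> a i (\<lambda>l. y (real l * \<eta>))))\<^sup>2
    \<le> 2 * (L1\<^sup>2 + L2\<^sup>2) * \<delta> powr \<alpha> *
      (1 + 4 * (path_const T)\<^sup>2 + 4 * (noise_const \<sigma> T)\<^sup>2 * p + 2 * (onorm ((*v) \<sigma>))\<^sup>2 * (q / \<delta>))"
proof -
  define A where "A = growth_const"
  define B where "B = L1 + L2"
  define s0 where "s0 = onorm ((*v) \<sigma>)"
  define K where "K = 2 * exp ((2 * B + 1) * T)"
  define \<Xi> where "\<Xi> = seg_norm \<tau> \<xi>"
  have A0: "0 \<le> A" using L2_nonneg by (simp add: A_def growth_const_def)
  have B0: "0 \<le> B" using L1_nonneg L2_nonneg by (simp add: B_def)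
  have s0: "0 \<le> s0" unfolding s0_def by (intro onorm_pos_le matrix_vector_mul_bounded_linear)
  have p0: "0 \<le> p" using p[of 0] \<open>0 < T\<close> by simp
  have q0: "0 \<le> q" using q[of a] i by simp
  have \<sigma>_le: "norm (\<sigma> *v v) \<le> s0 * norm v" for v unfolding s0_def by (rule norm_matrix_vector_le)
  have W_le: "norm (W s - W 0) \<le> sqrt p" if "0 \<le> s" "s \<le> T" for s
    using p[OF that] by (rule real_le_rsqrt)
  have G_le: "norm (G s) \<le> A + B * m" if s: "0 \<le> s" "s \<le> T" and m: "\<And>r. -\<tau> \<le> r \<Longrightarrow> r \<le> s \<Longrightarrow> norm (y r) \<le> m" for s m
  proof -
    have "norm (b (y s)) \<le> norm (b 0) + L1 * m" using s \<tau>_pos by (intro b_growth m) auto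
    moreover have "norm (Z (\<lambda>\<theta>. y (min (s + \<theta>) s))) \<le> norm (Z (\<lambda>_. 0)) + L2 * (1 + m)"
      using s \<tau>_pos by (intro Z_growth path_seg[OF cont] m) auto
    ultimately show ?thesis unfolding G[OF s] A_def B_def growth_const_def
      using norm_triangle_ineq[of "b (y s)" "Z (\<lambda>\<theta>. y (min (s + \<theta>) s))"] by (simp add: algebra_simps)
  qed
  have y_le: "norm (y r) \<le> K * (\<Xi> + A * T + s0 * sqrt p)" if "-\<tau> \<le> r" "r \<le> T" for r
    unfolding K_def
  proof (rule apriori_bound[OF \<open>0 < T\<close> less_imp_le[OF \<tau>_pos] cont _ int _ _ G_le A0 B0 that])
    show "norm (y r) \<le> \<Xi>" if "-\<tau> \<le> r" "r \<le> 0" for r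
      using \<xi>_le_seg_norm[OF that] y0[OF that] by (simp add: \<Xi>_def)
    show "y s = y 0 + integral {0..s} G + \<sigma> *v (W s - W 0)" if "0 \<le> s" "s \<le> T" for s
      using eq[OF that] y0[of 0] \<tau>_pos by simp
    show "norm (\<sigma> *v (W s - W 0)) \<le> s0 * sqrt p" if "0 \<le> s" "s \<le> T" for s
      using order_trans[OF \<sigma>_le mult_left_mono[OF W_le[OF that] s0]] .
  qed
  define g where "g = A + B * (K * (\<Xi> + A * T + s0 * sqrt p))"
  have g_le: "norm (G s) \<le> g" if "0 \<le> s" "s \<le> T" for s
    unfolding g_def using that by (intro G_le y_le) auto
  have g0: "0 \<le> g" using order_trans[OF norm_ge_zero g_le[of 0]] \<open>0 < T\<close> by simp
  have g_eq: "g = path_const T + noise_const \<sigma> T * sqrt p"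
    by (simp add: g_def path_const_def noise_const_def A_def B_def K_def \<Xi>_def s0_def algebra_simps)
  \<comment> \<open>Over a time of at most \<delta> the drift moves the path by at most
    \<open>\<delta> * g\<close> and the noise by at most \<open>s0 * sqrt q\<close>.\<close>
  define \<Delta> where "\<Delta> = \<delta> * g + s0 * sqrt q"
  have \<Delta>0: "0 \<le> \<Delta>" using \<delta> g0 s0 q0 by (simp add: \<Delta>_def)
  define x where "x = (\<lambda>l. y (real l * \<eta>))"
  have "norm (x l - x a) \<le> \<Delta>" if l: "a \<le> l" "l \<le> i" for l
  proof -
    have le: "real a * \<eta> \<le> real l * \<eta>" "real l * \<eta> \<le> T" "0 \<le> real a * \<eta>"
      using l \<eta> i(2) by (auto intro: mult_right_mono order_trans[of _ "real i * \<eta>"])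
    have "integral {0..real l * \<eta>} G = integral {0..real a * \<eta>} G + integral {real a * \<eta>..real l * \<eta>} G"
      using le by (intro Henstock_Kurzweil_Integration.integral_combine[symmetric] integrable_on_subinterval[OF int]) auto
    moreover have "\<sigma> *v (W (real l * \<eta>) - W (real a * \<eta>)) = \<sigma> *v (W (real l * \<eta>) - W 0) - \<sigma> *v (W (real a * \<eta>) - W 0)"
      by (simp flip: matrix_vector_mult_diff_distrib)
    moreover have "y (real l * \<eta>) = \<xi> 0 + integral {0..real l * \<eta>} G + \<sigma> *v (W (real l * \<eta>) - W 0)"
      "y (real a * \<eta>) = \<xi> 0 + integral {0..real a * \<eta>} G + \<sigma> *v (W (real a * \<eta>) - W 0)"
      using le by (intro eq; linarith)+
    ultimately have "x l - x a = integral {real a * \<eta>..real l * \<eta>} G + \<sigma> *v (W (real l * \<eta>) - W (real a * \<eta>))"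
      unfolding x_def by simp
    moreover have "norm (integral {real a * \<eta>..real l * \<eta>} G) \<le> \<delta> * g"
    proof -
      have "G integrable_on {real a * \<eta>..real l * \<eta>}" using le by (intro integrable_on_subinterval[OF int]) auto
      then have "(G has_integral (integral {real a * \<eta>..real l * \<eta>} G)) (cbox (real a * \<eta>) (real l * \<eta>))"
        by (simp add: integrable_integral)
      then have "norm (integral {real a * \<eta>..real l * \<eta>} G) \<le> g * measure lborel (cbox (real a * \<eta>) (real l * \<eta>))"
      proof (rule has_integral_bound[OF g0])
        fix r assume "r \<in> cbox (real a * \<eta>) (real l * \<eta>)"
        then have "real a * \<eta> \<le> r" "r \<le> real l * \<eta>" by auto
        then have "0 \<le> r" "r \<le> T" using le by linarith+
        then show "norm (G r) \<le> g" by (rule g_le)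
      qed
      also have "\<dots> = g * (real (l - a) * \<eta>)" using le l by (simp add: of_nat_diff algebra_simps)
      also have "\<dots> \<le> g * (real (i - a) * \<eta>)" using l \<eta> g0 by (intro mult_left_mono mult_right_mono) auto
      also have "\<dots> \<le> g * \<delta>" using i g0 by (intro mult_left_mono) auto
      finally show ?thesis by (simp add: mult.commute)
    qed
    moreover have "norm (\<sigma> *v (W (real l * \<eta>) - W (real a * \<eta>))) \<le> s0 * sqrt q"
      using order_trans[OF \<sigma>_le mult_left_mono[OF real_le_rsqrt[OF q[OF l]] s0]] .
    ultimately show ?thesis unfolding \<Delta>_def using norm_triangle_le add_mono by metis
  qed
  then have "norm (disc_drift \<eta> i i x - disc_drift \<eta> a i x) \<le> L1 * \<Delta> + L2 * \<Delta> powr \<alpha>"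
    using \<eta> i by (intro disc_drift_stop_diff) auto
  then have "(norm (disc_drift \<eta> i i x - disc_drift \<eta> a i x))\<^sup>2 \<le> (L1 * \<Delta> + L2 * \<Delta> powr \<alpha>)\<^sup>2"
    by (intro power_mono) auto
  also have "\<dots> \<le> 2 * (L1\<^sup>2 + L2\<^sup>2) * \<delta> powr \<alpha> * (1 + \<Delta>\<^sup>2 / \<delta>)"
    by (rule hoelder_power_bound[OF \<Delta>0 \<delta>])
  also have "\<dots> \<le> 2 * (L1\<^sup>2 + L2\<^sup>2) * \<delta> powr \<alpha> *
      (1 + 4 * (path_const T)\<^sup>2 + 4 * (noise_const \<sigma> T)\<^sup>2 * p + 2 * (onorm ((*v) \<sigma>))\<^sup>2 * (q / \<delta>))"
  proof (rule mult_left_mono)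
    have *: "(u + v)\<^sup>2 \<le> 2 * u\<^sup>2 + 2 * v\<^sup>2" for u v :: real
      using sum_squares_bound[of u v] by (simp add: power2_sum)
    have "\<Delta>\<^sup>2 / \<delta> \<le> (2 * (\<delta> * g)\<^sup>2 + 2 * (s0 * sqrt q)\<^sup>2) / \<delta>"
      unfolding \<Delta>_def using \<delta> * by (intro divide_right_mono) auto
    also have "\<dots> = 2 * \<delta> * g\<^sup>2 + 2 * s0\<^sup>2 * (q / \<delta>)"
      using \<delta> q0 by (simp add: power_mult_distrib field_simps power2_eq_square)
    also have "\<dots> \<le> 2 * g\<^sup>2 + 2 * s0\<^sup>2 * (q / \<delta>)" using \<delta> by (simp add: mult_left_le_one_le)
    also have "g\<^sup>2 \<le> 2 * (path_const T)\<^sup>2 + 2 * (noise_const \<sigma> T * sqrt p)\<^sup>2" unfolding g_eq by (rule *)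
    also have "(noise_const \<sigma> T * sqrt p)\<^sup>2 = (noise_const \<sigma> T)\<^sup>2 * p" using p0 by (simp add: power_mult_distrib)
    finally show "1 + \<Delta>\<^sup>2 / \<delta> \<le> 1 + 4 * (path_const T)\<^sup>2 + 4 * (noise_const \<sigma> T)\<^sup>2 * p + 2 * (onorm ((*v) \<sigma>))\<^sup>2 * (q / \<delta>)"
      by (simp add: s0_def)
  qed simp
  finally show ?thesis by (simp add: x_def)
qed

text \<open>The factors \<open>8 * real CARD('d) * T\<close> and \<open>8 * real CARD('d)\<close>
  are Doob's bounds for the means of \<open>p\<close> and \<open>q / \<delta>\<close>. The added
  ones keep the coefficients positive, so that an infinite supremum makes the majorant
  infinite.\<close>

definition gap_const :: "real ^ 'd ^ 'd \<Rightarrow> real \<Rightarrow> real" where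
  "gap_const \<sigma> T = (2 * (L1\<^sup>2 + L2\<^sup>2) + 1) *
     (1 + 4 * (path_const T)\<^sup>2 + (4 * (noise_const \<sigma> T)\<^sup>2 + 1) * (8 * real CARD('d) * T)
        + (2 * (onorm ((*v) \<sigma>))\<^sup>2 + 1) * (8 * real CARD('d)))"

text \<open>The segment is rewritten as \<open>X (min (s + \<theta>) s)\<close>, the case
  \<open>\<gamma> s = s\<close> of the form shared with the scheme; both agree on
  \<open>{-\<tau>..0}\<close>, so \<open>Z_cong\<close> applies. Lebesgue integrals become gauge
  integrals.\<close>

lemma weak_solution_path:
  assumes "weak_solution \<tau> b Z \<sigma> \<xi> M F W X"
  shows "AE \<omega> in M. continuous_on {-\<tau>..} (\<lambda>t. X t \<omega>) \<and> (\<forall>r. -\<tau> \<le> r \<longrightarrow> r \<le> 0 \<longrightarrow> X r \<omega> = \<xi> r) \<and>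
    continuous_on {0..} (\<lambda>t. W t \<omega>) \<and>
    (\<exists>G. \<forall>T\<ge>0. G integrable_on {0..T} \<and>
       G T = b (X T \<omega>) + Z (\<lambda>\<theta>. X (min (T + \<theta>) T) \<omega>) \<and>
       X T \<omega> = \<xi> 0 + integral {0..T} G + \<sigma> *v (W T \<omega> - W 0 \<omega>))"
proof -
  have "AE \<omega> in M. continuous_on {0..} (\<lambda>t. W t \<omega>)"
    using assms by (simp add: weak_solution_def brownian_motion_def)
  moreover have "AE \<omega> in M. continuous_on {-\<tau>..} (\<lambda>t. X t \<omega>) \<and> (\<forall>\<theta>\<in>{-\<tau>..0}. X \<theta> \<omega> = \<xi> \<theta>) \<and>
        (\<forall>t\<ge>0. set_integrable lborel {0..t} (\<lambda>s. b (X s \<omega>) + Z (segment (\<lambda>r. X r \<omega>) s)) \<and>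
           X t \<omega> = \<xi> 0 + (LINT s:{0..t}|lborel. b (X s \<omega>) + Z (segment (\<lambda>r. X r \<omega>) s)) + \<sigma> *v (W t \<omega> - W 0 \<omega>))"
    using assms by (simp add: weak_solution_def additive_sde_def)
  ultimately show ?thesis
  proof eventually_elim
    fix \<omega>
    assume W: "continuous_on {0..} (\<lambda>t. W t \<omega>)"
    assume X: "continuous_on {-\<tau>..} (\<lambda>t. X t \<omega>) \<and> (\<forall>\<theta>\<in>{-\<tau>..0}. X \<theta> \<omega> = \<xi> \<theta>) \<and>
        (\<forall>t\<ge>0. set_integrable lborel {0..t} (\<lambda>s. b (X s \<omega>) + Z (segment (\<lambda>r. X r \<omega>) s)) \<and>
           X t \<omega> = \<xi> 0 + (LINT s:{0..t}|lborel. b (X s \<omega>) + Z (segment (\<lambda>r. X r \<omega>) s)) + \<sigma> *v (W t \<omega> - W 0 \<omega>))"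
    have Zeq: "Z (\<lambda>\<theta>. X (min (s + \<theta>) s) \<omega>) = Z (segment (\<lambda>r. X r \<omega>) s)" if "0 \<le> s" for s
    proof (rule Z_cong)
      have "continuous_on {-\<tau>..s} (\<lambda>t. X t \<omega>)" using X by (auto intro: continuous_on_subset)
      from path_seg[OF this, of s s] that show "(\<lambda>\<theta>. X (min (s + \<theta>) s) \<omega>) \<in> seg_space \<tau>" by simp
    qed (simp add: segment_def min_absorb1)
    show "continuous_on {-\<tau>..} (\<lambda>t. X t \<omega>) \<and> (\<forall>r. -\<tau> \<le> r \<longrightarrow> r \<le> 0 \<longrightarrow> X r \<omega> = \<xi> r) \<and>
      continuous_on {0..} (\<lambda>t. W t \<omega>) \<and>
      (\<exists>G. \<forall>T\<ge>0. G integrable_on {0..T} \<and>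
         G T = b (X T \<omega>) + Z (\<lambda>\<theta>. X (min (T + \<theta>) T) \<omega>) \<and>
         X T \<omega> = \<xi> 0 + integral {0..T} G + \<sigma> *v (W T \<omega> - W 0 \<omega>))"
      using X W Zeq
      by (intro conjI exI[of _ "\<lambda>s. b (X s \<omega>) + Z (segment (\<lambda>r. X r \<omega>) s)"] allI impI)
         (auto simp: set_borel_integral_eq_integral)
  qed
qed

text \<open>The pathwise bound with \<open>p\<close> and \<open>q\<close> the random suprema over
  the horizon and over the current stretch from \<open>a\<close> to \<open>i\<close>. That stretch
  has length at most \<delta>, so the mean of \<open>q / \<delta>\<close> is bounded independently
  of \<delta>.\<close>

lemma drift_gap_moment:
  fixes X :: "real \<Rightarrow> 'v \<Rightarrow> real ^ 'd"
  assumes ws: "weak_solution \<tau> b Z \<sigma> \<xi> M F W X"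
    and "0 < T" and \<eta>: "\<eta> > 0" and \<delta>: "0 < \<delta>" "\<delta> < 1"
    and i: "a \<le> i" "real i * \<eta> \<le> T" "real (i - a) * \<eta> \<le> \<delta>"
  shows "(\<integral>\<^sup>+\<omega>. ennreal ((norm (disc_drift \<eta> i i (\<lambda>l. X (real l * \<eta>) \<omega>) - disc_drift \<eta> a i (\<lambda>l. X (real l * \<eta>) \<omega>)))\<^sup>2) \<partial>M)
    \<le> ennreal (gap_const \<sigma> T * \<delta> powr \<alpha>)"
proof -
  interpret B: brownian M F W using ws by unfold_locales (auto simp: weak_solution_def)
  define s where "s l = real (a + l) * \<eta>" for l
  define Q where "Q \<omega> = (SUP l\<in>{..i - a}. ennreal ((norm (W (s l) \<omega> - W (s 0) \<omega>))\<^sup>2))" for \<omega>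
  define P where "P = B.sup_square T"
  define c0 where "c0 = (2 * (L1\<^sup>2 + L2\<^sup>2) + 1) * \<delta> powr \<alpha>"
  define c1 where "c1 = 1 + 4 * (path_const T)\<^sup>2"
  define c2 where "c2 = 4 * (noise_const \<sigma> T)\<^sup>2 + 1"
  define c3 where "c3 = (2 * (onorm ((*v) \<sigma>))\<^sup>2 + 1) / \<delta>"
  have c: "0 < c0" "0 < c1" "0 < c2" "0 < c3" using \<delta>
    by (simp_all add: c0_def c1_def c2_def c3_def add_nonneg_pos add_pos_nonneg)
  have s0: "0 \<le> s 0" "strict_mono s" using \<eta> by (auto simp: s_def strict_mono_def)
  have s_meas: "(\<lambda>\<omega>. W (s l) \<omega> - W (s 0) \<omega>) \<in> borel_measurable M" for l
    using \<eta> by (intro B.increment_measurable) (auto simp: s_def)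
  have Q_meas [measurable]: "Q \<in> borel_measurable M"
    unfolding Q_def using s_meas
    by (intro borel_measurable_SUP measurable_compose[OF _ measurable_ennreal] borel_measurable_power borel_measurable_norm) auto
  have P_meas [measurable]: "P \<in> borel_measurable M"
    unfolding P_def by (rule B.sup_square_measurable[OF \<open>0 < T\<close>])
  have "AE \<omega> in M. ennreal ((norm (disc_drift \<eta> i i (\<lambda>l. X (real l * \<eta>) \<omega>) - disc_drift \<eta> a i (\<lambda>l. X (real l * \<eta>) \<omega>)))\<^sup>2)
     \<le> ennreal c0 * (ennreal c1 + ennreal c2 * P \<omega> + ennreal c3 * Q \<omega>)"
    using weak_solution_path[OF ws]
  proof eventually_elim
    case (elim \<omega>)
    then obtain G where G: "\<And>s. 0 \<le> s \<Longrightarrow> G integrable_on {0..s}"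
      "\<And>s. 0 \<le> s \<Longrightarrow> G s = b (X s \<omega>) + Z (\<lambda>\<theta>. X (min (s + \<theta>) s) \<omega>)"
      "\<And>s. 0 \<le> s \<Longrightarrow> X s \<omega> = \<xi> 0 + integral {0..s} G + \<sigma> *v (W s \<omega> - W 0 \<omega>)" by blast
    have cont: "continuous_on {-\<tau>..T} (\<lambda>t. X t \<omega>)" using elim by (auto intro: continuous_on_subset)
    show ?case
    proof (cases "P \<omega> = \<top> \<or> Q \<omega> = \<top>")
      case True
      then have "ennreal c0 * (ennreal c1 + ennreal c2 * P \<omega> + ennreal c3 * Q \<omega>) = \<top>"
        using c by (auto simp: ennreal_mult_top)
      then show ?thesis by simp
    next
      case False
      then obtain p q where pq: "P \<omega> = ennreal p" "Q \<omega> = ennreal q" "0 \<le> p" "0 \<le> q"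
        by (metis ennreal_cases)
      have "(norm (disc_drift \<eta> i i (\<lambda>l. X (real l * \<eta>) \<omega>) - disc_drift \<eta> a i (\<lambda>l. X (real l * \<eta>) \<omega>)))\<^sup>2
        \<le> 2 * (L1\<^sup>2 + L2\<^sup>2) * \<delta> powr \<alpha> *
      (1 + 4 * (path_const T)\<^sup>2 + 4 * (noise_const \<sigma> T)\<^sup>2 * p + 2 * (onorm ((*v) \<sigma>))\<^sup>2 * (q / \<delta>))"
      proof (rule drift_gap_pathwise[where W="\<lambda>t. W t \<omega>" and y="\<lambda>t. X t \<omega>" and G=G])
        show "(norm (W s \<omega> - W 0 \<omega>))\<^sup>2 \<le> p" if "0 \<le> s" "s \<le> T" for s
          using B.sup_square_ge[OF \<open>0 < T\<close> that, of \<omega>] elim pq by (simp add: P_def)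
        show "(norm (W (real l * \<eta>) \<omega> - W (real a * \<eta>) \<omega>))\<^sup>2 \<le> q" if "a \<le> l" "l \<le> i" for l
        proof -
          have "ennreal ((norm (W (s (l - a)) \<omega> - W (s 0) \<omega>))\<^sup>2) \<le> Q \<omega>"
            unfolding Q_def using that by (intro SUP_upper) auto
          then show ?thesis using pq that by (simp add: s_def)
        qed
      qed (use assms elim G cont in auto)
      also have "\<dots> \<le> c0 * (c1 + c2 * p + c3 * q)"
      proof (rule mult_mono)
        show "2 * (L1\<^sup>2 + L2\<^sup>2) * \<delta> powr \<alpha> \<le> c0" by (simp add: c0_def algebra_simps)
        have "2 * (onorm ((*v) \<sigma>))\<^sup>2 * (q / \<delta>) \<le> c3 * q" using pq \<delta> by (simp add: c3_def field_simps)
        moreover have "4 * (noise_const \<sigma> T)\<^sup>2 * p \<le> c2 * p" using pq by (simp add: c2_def algebra_simps)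
        ultimately show "1 + 4 * (path_const T)\<^sup>2 + 4 * (noise_const \<sigma> T)\<^sup>2 * p + 2 * (onorm ((*v) \<sigma>))\<^sup>2 * (q / \<delta>) \<le> c1 + c2 * p + c3 * q"
          by (simp add: c1_def)
      qed (use c pq \<delta> in auto)
      finally show ?thesis using c pq by (simp add: ennreal_leI flip: ennreal_mult ennreal_plus)
    qed
  qed
  then have "(\<integral>\<^sup>+\<omega>. ennreal ((norm (disc_drift \<eta> i i (\<lambda>l. X (real l * \<eta>) \<omega>) - disc_drift \<eta> a i (\<lambda>l. X (real l * \<eta>) \<omega>)))\<^sup>2) \<partial>M)
     \<le> (\<integral>\<^sup>+\<omega>. ennreal c0 * (ennreal c1 + ennreal c2 * P \<omega> + ennreal c3 * Q \<omega>) \<partial>M)"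
    by (rule nn_integral_mono_AE)
  also have "\<dots> = ennreal c0 * (ennreal c1 + ennreal c2 * (\<integral>\<^sup>+\<omega>. P \<omega> \<partial>M) + ennreal c3 * (\<integral>\<^sup>+\<omega>. Q \<omega> \<partial>M))"
    by (simp add: nn_integral_cmult nn_integral_add B.emeasure_space_1)
  also have "\<dots> \<le> ennreal c0 * (ennreal c1 + ennreal c2 * ennreal (8 * real CARD('d) * T) + ennreal c3 * ennreal (8 * real CARD('d) * \<delta>))"
  proof (intro mult_left_mono add_mono order_refl)
    show "(\<integral>\<^sup>+\<omega>. P \<omega> \<partial>M) \<le> ennreal (8 * real CARD('d) * T)"
      unfolding P_def by (rule B.nn_integral_sup_square[OF \<open>0 < T\<close>])
    have "(\<integral>\<^sup>+\<omega>. Q \<omega> \<partial>M) \<le> ennreal (8 * real CARD('d) * (s (i - a) - s 0))"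
      unfolding Q_def by (rule B.doob[OF s0])
    also have "\<dots> \<le> ennreal (8 * real CARD('d) * \<delta>)"
      using i(3) by (intro ennreal_leI mult_left_mono) (auto simp: s_def algebra_simps)
    finally show "(\<integral>\<^sup>+\<omega>. Q \<omega> \<partial>M) \<le> ennreal (8 * real CARD('d) * \<delta>)" .
  qed auto
  also have "\<dots> = ennreal (c0 * (c1 + c2 * (8 * real CARD('d) * T) + c3 * (8 * real CARD('d) * \<delta>)))"
    using c \<delta> \<open>0 < T\<close> by (simp flip: ennreal_mult ennreal_plus)
  also have "c0 * (c1 + c2 * (8 * real CARD('d) * T) + c3 * (8 * real CARD('d) * \<delta>)) = gap_const \<sigma> T * \<delta> powr \<alpha>"
    using \<delta> by (simp add: c0_def c1_def c2_def c3_def gap_const_def)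
  finally show ?thesis .
qed

end

section \<open>Weak error\<close>

text \<open>A single approximation in L1 of the average of the two laws is good for both of them,
  and cutting it off at \<open>S\<close> makes it an admissible continuous test function. Hence the
  constant \<open>c\<close> is preserved.\<close>

lemma test_function_extension:
  fixes \<mu> \<nu> :: "('a::euclidean_space) measure" and f :: "'a \<Rightarrow> real"
  assumes "prob_space \<mu>" "prob_space \<nu>" and sets [measurable_cong]: "sets \<mu> = sets borel" "sets \<nu> = sets borel"
    and cont: "\<And>g. continuous_on UNIV g \<Longrightarrow> (\<And>x. \<bar>g x\<bar> \<le> S) \<Longrightarrow> \<bar>(\<integral>x. g x \<partial>\<mu>) - (\<integral>x. g x \<partial>\<nu>)\<bar> \<le> c"
    and f[measurable]: "f \<in> borel_measurable borel" and S: "\<And>x. \<bar>f x\<bar> \<le> S"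
  shows "\<bar>(\<integral>x. f x \<partial>\<mu>) - (\<integral>x. f x \<partial>\<nu>)\<bar> \<le> c"
proof (rule field_le_epsilon)
  interpret \<mu>: prob_space \<mu> by fact
  interpret \<nu>: prob_space \<nu> by fact
  fix e :: real assume "0 < e"
  define K where "K = (\<lambda>c. if c then \<mu> else \<nu>)"
  \<comment> \<open>The average of \<open>\<mu>\<close> and \<open>\<nu>\<close>, as the law of a
    sample from the one that a fair coin selects. Each of the two is at most
    \<open>2 * \<rho>\<close>.\<close>
  define \<rho> where "\<rho> = measure_pmf (bernoulli_pmf (1/2)) \<bind> K"
  have K: "K \<in> measurable (measure_pmf (bernoulli_pmf (1/2))) (subprob_algebra borel)"
    using sets by (auto simp: K_def space_subprob_algebra \<mu>.subprob_space_axioms \<nu>.subprob_space_axioms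
      prob_space_imp_subprob_space assms(1,2))
  have sets_\<rho> [measurable_cong]: "sets \<rho> = sets borel"
    unfolding \<rho>_def by (rule sets_bind) (auto simp: K_def sets)
  have nn: "(\<integral>\<^sup>+x. h x \<partial>\<rho>) = (\<integral>\<^sup>+x. h x \<partial>\<mu>) * ennreal (1/2) + (\<integral>\<^sup>+x. h x \<partial>\<nu>) * ennreal (1/2)"
    if "h \<in> borel_measurable borel" for h
    unfolding \<rho>_def nn_integral_bind[OF that K]
    by (subst nn_integral_bernoulli_pmf) (auto simp: K_def)
  have "emeasure \<rho> (space \<rho>) = (\<integral>\<^sup>+x. 1 \<partial>\<rho>)" by simp
  also have "\<dots> = ennreal (1/2) + ennreal (1/2)" by (subst nn) (auto simp: \<mu>.emeasure_space_1 \<nu>.emeasure_space_1)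
  finally have "emeasure \<rho> (space \<rho>) \<noteq> \<infinity>" by simp
  then interpret \<rho>: finite_measure \<rho> by (intro finite_measureI)
  have "integrable \<rho> f" using S by (intro \<rho>.integrable_const_bound[of _ S]) auto
  then obtain g where g: "continuous_on UNIV g" "integrable \<rho> g" "(\<integral>x. \<bar>f x - g x\<bar> \<partial>\<rho>) < e / 4"
    using integrable_approx_continuous[OF \<rho>.finite_measure_axioms sets_\<rho>, of f "e / 4"] \<open>0 < e\<close> by auto
  \<comment> \<open>Truncation to the range of \<open>f\<close> does not increase the distance to
    \<open>f\<close>.\<close>
  define g' where "g' x = max (- S) (min S (g x))" for x
  have g'_cont: "continuous_on UNIV g'" unfolding g'_def by (intro continuous_intros g)
  have [measurable]: "g \<in> borel_measurable borel" "g' \<in> borel_measurable borel"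
    using g(1) g'_cont by (auto intro: borel_measurable_continuous_onI)
  have S0: "0 \<le> S" using S[of undefined] by simp
  have g'_S: "\<bar>g' x\<bar> \<le> S" for x using S0 by (auto simp: g'_def)
  have diff: "\<bar>f x - g' x\<bar> \<le> \<bar>f x - g x\<bar>" for x using S[of x] by (auto simp: g'_def max_def min_def)
  have small: "(\<integral>\<^sup>+x. ennreal \<bar>f x - g x\<bar> \<partial>\<rho>) \<le> ennreal (e / 4)"
    using g \<open>integrable \<rho> f\<close> by (subst nn_integral_eq_integral) (auto intro: ennreal_leI)
  have est: "\<bar>(\<integral>x. f x \<partial>\<kappa>) - (\<integral>x. g' x \<partial>\<kappa>)\<bar> \<le> e / 2"
    if "prob_space \<kappa>" and [measurable_cong]: "sets \<kappa> = sets borel"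
      and le: "(\<integral>\<^sup>+x. ennreal \<bar>f x - g x\<bar> \<partial>\<kappa>) * ennreal (1/2) \<le> (\<integral>\<^sup>+x. ennreal \<bar>f x - g x\<bar> \<partial>\<rho>)" for \<kappa>
  proof -
    interpret \<kappa>: prob_space \<kappa> by fact
    have int: "integrable \<kappa> f" "integrable \<kappa> g'"
      using S g'_S by (auto intro!: \<kappa>.integrable_const_bound[of _ S])
    have "ennreal (\<integral>x. \<bar>f x - g' x\<bar> \<partial>\<kappa>) = (\<integral>\<^sup>+x. ennreal \<bar>f x - g' x\<bar> \<partial>\<kappa>)"
      using int by (intro nn_integral_eq_integral[symmetric]) auto
    also have "\<dots> \<le> (\<integral>\<^sup>+x. ennreal \<bar>f x - g x\<bar> \<partial>\<kappa>)"
      using diff by (intro nn_integral_mono ennreal_leI)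
    finally have "ennreal (\<integral>x. \<bar>f x - g' x\<bar> \<partial>\<kappa>) * ennreal (1/2) \<le> ennreal (e / 4)"
      using le small by (meson mult_right_mono order_trans zero_le)
    moreover have "ennreal ((\<integral>x. \<bar>f x - g' x\<bar> \<partial>\<kappa>) * (1/2)) = ennreal (\<integral>x. \<bar>f x - g' x\<bar> \<partial>\<kappa>) * ennreal (1/2)"
      by (rule ennreal_mult'') simp
    ultimately have "ennreal ((\<integral>x. \<bar>f x - g' x\<bar> \<partial>\<kappa>) * (1/2)) \<le> ennreal (e / 4)" by (simp only:)
    then have "(\<integral>x. \<bar>f x - g' x\<bar> \<partial>\<kappa>) \<le> e / 2"
      using \<open>0 < e\<close> by (subst (asm) ennreal_le_iff) auto
    moreover have "\<bar>(\<integral>x. f x \<partial>\<kappa>) - (\<integral>x. g' x \<partial>\<kappa>)\<bar> \<le> (\<integral>x. \<bar>f x - g' x\<bar> \<partial>\<kappa>)"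
      using int integral_abs_bound[of \<kappa> "\<lambda>x. f x - g' x"] by simp
    ultimately show ?thesis by linarith
  qed
  have "\<bar>(\<integral>x. f x \<partial>\<mu>) - (\<integral>x. g' x \<partial>\<mu>)\<bar> \<le> e / 2"
    by (rule est[OF assms(1) sets(1)]) (subst nn, auto)
  moreover have "\<bar>(\<integral>x. f x \<partial>\<nu>) - (\<integral>x. g' x \<partial>\<nu>)\<bar> \<le> e / 2"
    by (rule est[OF assms(2) sets(2)]) (subst nn, auto)
  moreover have "\<bar>(\<integral>x. g' x \<partial>\<mu>) - (\<integral>x. g' x \<partial>\<nu>)\<bar> \<le> c" by (rule cont[OF g'_cont g'_S])
  ultimately show "\<bar>(\<integral>x. f x \<partial>\<mu>) - (\<integral>x. f x \<partial>\<nu>)\<bar> \<le> c + e" by linarith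
qed

context delay_drift
begin

text \<open>The square root of the entropy bound without its power of \<delta>; the added 1 keeps it
  positive, since the total variation estimate divides by it.\<close>

definition error_const :: "real ^ 'd ^ 'd \<Rightarrow> real \<Rightarrow> real" where
  "error_const \<sigma> T = sqrt ((onorm ((*v) (matrix_inv \<sigma>)))\<^sup>2 * gap_const \<sigma> T * T + 1)"

lemma gap_const_nonneg: "0 < T \<Longrightarrow> 0 \<le> gap_const \<sigma> T"
  by (simp add: gap_const_def)

text \<open>Every multiple of \<delta> is a grid point whose index is a multiple of
  \<open>Suc k\<close>, so no grid cell crosses one and the floor is constant on each cell.\<close>

lemma em_scheme_grid:
  fixes \<delta> s :: real
  assumes "\<delta> > 0" "real j * (\<delta> / real (Suc k)) \<le> s" "s < real (Suc j) * (\<delta> / real (Suc k))"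
  shows "grid_floor \<delta> s = real (Suc k * (j div Suc k)) * (\<delta> / real (Suc k))"
proof -
  define n where "n = Suc k"
  have n: "real n > 0" by (simp add: n_def)
  have "\<lfloor>s / \<delta>\<rfloor> = int (j div n)"
  proof (rule floor_unique)
    have "real (j div n) * real n \<le> real j"
      by (metis of_nat_le_iff of_nat_mult times_div_less_eq_dividend mult.commute)
    also have "\<dots> \<le> s / \<delta> * real n" using assms(1,2) n by (simp add: n_def[symmetric] field_simps)
    finally have le: "real (j div n) * real n \<le> s / \<delta> * real n" .
    show "of_int (int (j div n)) \<le> s / \<delta>" using mult_right_le_imp_le[OF le n] by simp
    have "s / \<delta> * real n < real (Suc j)" using assms(1,3) n by (simp add: n_def[symmetric] field_simps)
    also have "Suc j \<le> (j div n + 1) * n"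
      using dividend_less_div_times[of n j] n by (simp add: Suc_le_eq)
    then have "real (Suc j) \<le> (real (j div n) + 1) * real n" by (metis of_nat_1 of_nat_add of_nat_le_iff of_nat_mult)
    finally have less: "s / \<delta> * real n < (real (j div n) + 1) * real n" .
    show "s / \<delta> < of_int (int (j div n)) + 1" using mult_right_less_imp_less[OF less] by simp
  qed
  then show ?thesis unfolding grid_floor_def n_def[symmetric] using n by simp
qed

text \<open>Multiplying the shift \<open>u k i\<close> by \<sigma> gives back exactly the missing
  drift difference, so the block-frozen recursion driven by the shifted noise follows the
  solution.\<close>

lemma weak_solution_limit:
  fixes X :: "real \<Rightarrow> 'v \<Rightarrow> real ^ 'd" and \<sigma> :: "real ^ 'd ^ 'd" and \<delta> t :: real
  defines "\<eta> \<equiv> \<lambda>k. \<delta> / real (Suc k)"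
  defines "m \<equiv> \<lambda>k. nat \<lfloor>t / \<eta> k\<rfloor>"
  defines "u \<equiv> \<lambda>k i \<omega>. \<eta> k *\<^sub>R (matrix_inv \<sigma> *v (disc_drift (\<eta> k) i i (\<lambda>l. X (real l * \<eta> k) \<omega>)
      - disc_drift (\<eta> k) (Suc k * (i div Suc k)) i (\<lambda>l. X (real l * \<eta> k) \<omega>)))"
  assumes ws: "weak_solution \<tau> b Z \<sigma> \<xi> M F W X" and inv: "invertible \<sigma>" and \<delta>: "0 < \<delta>" and t: "0 \<le> t"
  shows "AE \<omega> in M. (\<lambda>k. em_path \<sigma> (\<eta> k) (Suc k) (brownian.shifted_noise W (\<eta> k) (u k) (m k) \<omega>) (m k) (m k)) \<longlonglongrightarrow> X t \<omega>"
  using weak_solution_path[OF ws]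
proof eventually_elim
  case (elim \<omega>)
  interpret B: brownian M F W using ws by unfold_locales (auto simp: weak_solution_def)
  from elim obtain G where G: "\<And>s. 0 \<le> s \<Longrightarrow> G integrable_on {0..s}"
    "\<And>s. 0 \<le> s \<Longrightarrow> G s = b (X s \<omega>) + Z (\<lambda>\<theta>. X (min (s + \<theta>) s) \<omega>)"
    "\<And>s. 0 \<le> s \<Longrightarrow> X s \<omega> = \<xi> 0 + integral {0..s} G + \<sigma> *v (W s \<omega> - W 0 \<omega>)" by blast
  have \<eta>: "\<eta> k > 0" for k using \<delta> by (simp add: \<eta>_def)
  have \<sigma>: "\<sigma> *v (matrix_inv \<sigma> *v v) = v" for v
  proof -
    have "\<sigma> ** matrix_inv \<sigma> = mat 1"
      using someI_ex[OF inv[unfolded invertible_def]] by (simp add: matrix_inv_def)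
    then show ?thesis by (simp add: matrix_vector_mul_assoc)
  qed
  have \<eta>_eq: "\<delta> / real (Suc k) = \<eta> k" and m_eq: "nat \<lfloor>t / \<eta> k\<rfloor> = m k" for k
    by (simp_all add: \<eta>_def m_def)
  show ?case
  proof (rule em_path_converges[where \<delta>=\<delta> and t=t and y="\<lambda>t. X t \<omega>" and G=G and \<gamma>="\<lambda>s. s"
        and W="\<lambda>t. W t \<omega>" and c="\<lambda>k j. j", unfolded \<eta>_eq m_eq])
    show "continuous_on {-\<tau>..t} (\<lambda>t. X t \<omega>)" using elim by (auto intro: continuous_on_subset)
    show "\<bar>s - real j * \<eta> k\<bar> \<le> \<eta> k \<and> 0 \<le> s \<and> s \<le> s" if "real j * \<eta> k \<le> s" "s < real (Suc j) * \<eta> k" for k j s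
      using that \<eta>[of k] by (auto simp: algebra_simps abs_le_iff intro: order_trans[of 0 "real j * \<eta> k"])
    show "\<sigma> *v B.shifted_noise (\<eta> k) (u k) (m k) \<omega> j =
        \<eta> k *\<^sub>R (disc_drift (\<eta> k) j j (\<lambda>l. X (real l * \<eta> k) \<omega>)
              - disc_drift (\<eta> k) (Suc k * (j div Suc k)) j (\<lambda>l. X (real l * \<eta> k) \<omega>))
        + \<sigma> *v (W (real (Suc j) * \<eta> k) \<omega> - W (real j * \<eta> k) \<omega>)" if "j < m k" for k j
      using that unfolding B.shifted_noise_def u_def
      by (simp only: if_True matrix_vector_right_distrib matrix_vector_mult_scaleR \<sigma> add.commute)
  qed (use elim G \<delta> t in auto)
qed

text \<open>Here the freezing index \<open>c\<close> is already the start of the block, so the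
  correction vanishes and the unshifted noise suffices.\<close>

lemma em_scheme_limit:
  fixes Y :: "real \<Rightarrow> 'w \<Rightarrow> real ^ 'd" and \<delta> t :: real
  defines "\<eta> \<equiv> \<lambda>k. \<delta> / real (Suc k)"
  defines "m \<equiv> \<lambda>k. nat \<lfloor>t / \<eta> k\<rfloor>"
  assumes em: "truncated_EM_scheme \<tau> b Z \<sigma> \<xi> \<delta> N F V Y" and \<delta>: "0 < \<delta>" and t: "0 \<le> t"
  shows "AE \<omega> in N. (\<lambda>k. em_path \<sigma> (\<eta> k) (Suc k) (brownian.shifted_noise V (\<eta> k) (\<lambda>_ _. 0) (m k) \<omega>) (m k) (m k)) \<longlonglongrightarrow> Y t \<omega>"
proof -
  interpret B: brownian N F V using em by unfold_locales (auto simp: truncated_EM_scheme_def)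
  let ?G = "\<lambda>\<omega> s. b (Y (grid_floor \<delta> s) \<omega>) + Z (truncated_segment \<delta> (\<lambda>r. Y r \<omega>) s)"
  have "AE \<omega> in N. continuous_on {-\<tau>..} (\<lambda>t. Y t \<omega>) \<and> (\<forall>\<theta>\<in>{-\<tau>..0}. Y \<theta> \<omega> = \<xi> \<theta>) \<and>
        (\<forall>t\<ge>0. set_integrable lborel {0..t} (?G \<omega>) \<and>
           Y t \<omega> = \<xi> 0 + (LINT s:{0..t}|lborel. ?G \<omega> s) + \<sigma> *v (V t \<omega> - V 0 \<omega>))"
    using em by (simp add: truncated_EM_scheme_def additive_sde_def)
  then show ?thesis
  proof eventually_elim
    case (elim \<omega>)
    have \<eta>: "\<eta> k > 0" for k using \<delta> by (simp add: \<eta>_def)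
    have \<eta>_eq: "\<delta> / real (Suc k) = \<eta> k" and m_eq: "nat \<lfloor>t / \<eta> k\<rfloor> = m k" for k
      by (simp_all add: \<eta>_def m_def)
    show ?case
    proof (rule em_path_converges[where \<delta>=\<delta> and t=t and y="\<lambda>t. Y t \<omega>" and G="?G \<omega>" and \<gamma>="grid_floor \<delta>"
          and W="\<lambda>t. V t \<omega>" and c="\<lambda>k j. Suc k * (j div Suc k)", unfolded \<eta>_eq m_eq])
      show "continuous_on {-\<tau>..t} (\<lambda>t. Y t \<omega>)" using elim by (auto intro: continuous_on_subset)
      show "?G \<omega> integrable_on {0..t}" using elim t set_borel_integral_eq_integral(1) by blast
      show "Y s \<omega> = \<xi> 0 + integral {0..s} (?G \<omega>) + \<sigma> *v (V s \<omega> - V 0 \<omega>)" if "0 \<le> s" "s \<le> t" for s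
        using elim that set_borel_integral_eq_integral(2)[of "{0..s}" "?G \<omega>"] by simp
      show "?G \<omega> s = b (Y (grid_floor \<delta> s) \<omega>) + Z (\<lambda>\<theta>. Y (min (s + \<theta>) (grid_floor \<delta> s)) \<omega>)" for s
        by (simp add: truncated_segment_def)
      show "\<bar>grid_floor \<delta> s - real (Suc k * (j div Suc k)) * \<eta> k\<bar> \<le> \<eta> k \<and> 0 \<le> grid_floor \<delta> s \<and> grid_floor \<delta> s \<le> s"
        if "real j * \<eta> k \<le> s" "s < real (Suc j) * \<eta> k" for k j s
      proof -
        have eq: "grid_floor \<delta> s = real (Suc k * (j div Suc k)) * \<eta> k"
          using em_scheme_grid[OF \<delta>, of j k s] that unfolding \<eta>_def by simp
        have "Suc k * (j div Suc k) \<le> j" by (rule times_div_less_eq_dividend)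
        then have "grid_floor \<delta> s \<le> real j * \<eta> k"
          unfolding eq using \<eta>[of k] by (intro mult_right_mono) (simp_all only: of_nat_le_iff less_imp_le)
        moreover have "0 \<le> grid_floor \<delta> s" unfolding eq using \<eta>[of k] by (intro mult_nonneg_nonneg) auto
        ultimately show ?thesis unfolding eq[symmetric] using that(1) \<eta>[of k] by simp
      qed
      show "\<sigma> *v B.shifted_noise (\<eta> k) (\<lambda>_ _. 0) (m k) \<omega> j =
        \<eta> k *\<^sub>R (disc_drift (\<eta> k) (Suc k * (j div Suc k)) j (\<lambda>l. Y (real l * \<eta> k) \<omega>)
              - disc_drift (\<eta> k) (Suc k * (j div Suc k)) j (\<lambda>l. Y (real l * \<eta> k) \<omega>))
        + \<sigma> *v (V (real (Suc j) * \<eta> k) \<omega> - V (real j * \<eta> k) \<omega>)" if "j < m k" for k j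
        using that by (simp add: B.shifted_noise_def del: of_nat_Suc mult_Suc)
      show "Suc k * (j div Suc k) \<le> j" for k j by (rule times_div_less_eq_dividend)
    qed (use elim \<delta> t in auto)
  qed
qed

text \<open>The noise comparison gives a bound that is uniform in the refinement \<open>k\<close>.
  With \<delta> and \<open>f\<close> fixed, \<open>k\<close> tends to infinity on each probability
  space separately, by dominated convergence with majorant \<open>S\<close>.\<close>

lemma weak_error_continuous:
  fixes X :: "real \<Rightarrow> 'v \<Rightarrow> real ^ 'd" and Y :: "real \<Rightarrow> 'w \<Rightarrow> real ^ 'd"
  assumes ws: "weak_solution \<tau> b Z \<sigma> \<xi> M F W X" and em: "truncated_EM_scheme \<tau> b Z \<sigma> \<xi> \<delta> N G V Y"
    and inv: "invertible \<sigma>" and \<delta>: "0 < \<delta>" "\<delta> < 1" and "0 < T" and t: "0 \<le> t" "t \<le> T"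
    and f: "continuous_on UNIV f" and S: "\<And>x. \<bar>f x\<bar> \<le> S"
  shows "\<bar>(\<integral>\<omega>. f (X t \<omega>) \<partial>M) - (\<integral>\<omega>. f (Y t \<omega>) \<partial>N)\<bar> \<le> 2 * S * (error_const \<sigma> T * \<delta> powr (\<alpha> / 2))"
proof -
  interpret B: brownian M F W using ws by unfold_locales (auto simp: weak_solution_def)
  interpret C: brownian N G V using em by unfold_locales (auto simp: truncated_EM_scheme_def)
  define \<eta> where "\<eta> = (\<lambda>k. \<delta> / real (Suc k))"
  define m where "m = (\<lambda>k. nat \<lfloor>t / \<eta> k\<rfloor>)"
  define gap where "gap k i \<omega> = disc_drift (\<eta> k) i i (\<lambda>l. X (real l * \<eta> k) \<omega>)
      - disc_drift (\<eta> k) (Suc k * (i div Suc k)) i (\<lambda>l. X (real l * \<eta> k) \<omega>)" for k i \<omega>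
  define u where "u = (\<lambda>k i \<omega>. \<eta> k *\<^sub>R (matrix_inv \<sigma> *v gap k i \<omega>))"
  define s where "s = error_const \<sigma> T * \<delta> powr (\<alpha> / 2)"
  define r where "r = onorm ((*v) (matrix_inv \<sigma>))"
  have \<eta>: "\<eta> k > 0" for k using \<delta> by (simp add: \<eta>_def)
  have m: "real (m k) * \<eta> k \<le> t" for k
  proof -
    have "0 \<le> t / \<eta> k" using t \<eta>[of k] by simp
    then have "real (m k) \<le> t / \<eta> k" unfolding m_def by linarith
    then show ?thesis using \<eta>[of k] by (simp add: field_simps)
  qed
  have r: "0 \<le> r" unfolding r_def by (intro onorm_pos_le matrix_vector_mul_bounded_linear)
  have kappa: "Suc k * (i div Suc k) \<le> i" for k i by (rule times_div_less_eq_dividend)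
  have gap_meas: "gap k i \<in> borel_measurable (F (real i * \<eta> k))" for k i
  proof -
    \<comment> \<open>Stopping the grid path at \<open>i\<close> gives a sequence known at time
      \<open>real i * \<eta> k\<close>; the drifts in \<open>gap k i\<close> cannot tell it from the
      full path, as their freezing indices are at most \<open>i\<close>.\<close>
    define x where "x \<omega> l = X (real (min l i) * \<eta> k) \<omega>" for \<omega> l
    have "x \<in> borel_measurable (F (real i * \<eta> k))"
    proof (rule measurable_coordinatewise_then_product)
      fix l
      have "X (real (min l i) * \<eta> k) \<in> borel_measurable (F (real (min l i) * \<eta> k))"
        using ws \<eta>[of k] by (simp add: weak_solution_def)
      moreover have "real (min l i) * \<eta> k \<le> real i * \<eta> k" using \<eta>[of k] by (intro mult_right_mono) auto
      ultimately show "(\<lambda>\<omega>. x \<omega> l) \<in> borel_measurable (F (real i * \<eta> k))"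
        unfolding x_def by (rule B.F_measurable_mono)
    qed
    then have x: "(\<lambda>\<omega>. disc_drift (\<eta> k) c i (x \<omega>)) \<in> borel_measurable (F (real i * \<eta> k))" for c
      by (rule measurable_compose[OF _ disc_drift_measurable[OF \<eta>]])
    have "disc_drift (\<eta> k) c i (\<lambda>l. X (real l * \<eta> k) \<omega>) = disc_drift (\<eta> k) c i (x \<omega>)" if "c \<le> i" for c \<omega>
    proof -
      have "norm (disc_drift (\<eta> k) c i (\<lambda>l. X (real l * \<eta> k) \<omega>) - disc_drift (\<eta> k) c i (x \<omega>)) \<le> L1 * 0 + L2 * 0 powr \<alpha>"
        by (rule disc_drift_diff[OF \<eta>]) (use that in \<open>auto simp: x_def min_absorb1\<close>)
      then show ?thesis by simp
    qed
    then have "gap k i = (\<lambda>\<omega>. disc_drift (\<eta> k) i i (x \<omega>) - disc_drift (\<eta> k) (Suc k * (i div Suc k)) i (x \<omega>))"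
      using kappa unfolding gap_def by (intro ext) (metis order_refl)
    then show ?thesis by (simp only:) (intro borel_measurable_diff x)
  qed
  have u_meas: "u k i \<in> borel_measurable (F (real i * \<eta> k))" for k i
    unfolding u_def
    by (intro borel_measurable_scaleR borel_measurable_const measurable_compose[OF gap_meas]
        borel_measurable_continuous_onI linear_continuous_on matrix_vector_mul_bounded_linear)
  have gap_moment: "(\<integral>\<^sup>+\<omega>. ennreal ((norm (gap k i \<omega>))\<^sup>2) \<partial>M) \<le> ennreal (gap_const \<sigma> T * \<delta> powr \<alpha>)" if i: "i < m k" for k i
    unfolding gap_def
  proof (rule drift_gap_moment[OF ws \<open>0 < T\<close> \<eta> \<delta> kappa])
    have "real i * \<eta> k \<le> real (m k) * \<eta> k" using i \<eta>[of k] by (intro mult_right_mono) auto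
    then show "real i * \<eta> k \<le> T" using m[of k] t by linarith
    have "i - Suc k * (i div Suc k) = i mod Suc k" by (rule minus_mult_div_eq_mod)
    also have "\<dots> \<le> Suc k" by (simp add: less_imp_le)
    finally have "real (i - Suc k * (i div Suc k)) \<le> real (Suc k)" by (simp only: of_nat_le_iff)
    then have "real (i - Suc k * (i div Suc k)) * \<eta> k \<le> real (Suc k) * \<eta> k" using \<eta>[of k] by (intro mult_right_mono) auto
    also have "\<dots> = \<delta>" by (simp add: \<eta>_def)
    finally show "real (i - Suc k * (i div Suc k)) * \<eta> k \<le> \<delta>" .
  qed
  have gap_M: "gap k i \<in> borel_measurable M" for k i by (rule B.F_measurable[OF gap_meas])
  have gap_int: "integrable M (\<lambda>\<omega>. (norm (gap k i \<omega>))\<^sup>2)" "(\<integral>\<omega>. (norm (gap k i \<omega>))\<^sup>2 \<partial>M) \<le> gap_const \<sigma> T * \<delta> powr \<alpha>" if i: "i < m k" for k i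
  proof -
    show int: "integrable M (\<lambda>\<omega>. (norm (gap k i \<omega>))\<^sup>2)"
      using gap_M gap_moment[OF i] by (intro integrableI_bounded) (auto intro: le_less_trans)
    show "(\<integral>\<omega>. (norm (gap k i \<omega>))\<^sup>2 \<partial>M) \<le> gap_const \<sigma> T * \<delta> powr \<alpha>"
      using gap_moment[OF i] nn_integral_eq_integral[OF int] gap_const_nonneg[OF \<open>0 < T\<close>]
      by (simp add: ennreal_le_iff)
  qed
  have u_le: "(norm (u k i \<omega>))\<^sup>2 \<le> (\<eta> k)\<^sup>2 * r\<^sup>2 * (norm (gap k i \<omega>))\<^sup>2" for k i \<omega>
  proof -
    have "norm (u k i \<omega>) \<le> \<eta> k * (r * norm (gap k i \<omega>))"
      unfolding u_def r_def using \<eta>[of k] norm_matrix_vector_le[of "matrix_inv \<sigma>" "gap k i \<omega>"]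
      by (simp add: mult_left_mono)
    then have "(norm (u k i \<omega>))\<^sup>2 \<le> (\<eta> k * (r * norm (gap k i \<omega>)))\<^sup>2" by (intro power_mono) auto
    then show ?thesis by (simp add: power_mult_distrib mult.assoc)
  qed
  have u_int: "integrable M (\<lambda>\<omega>. (norm (u k i \<omega>))\<^sup>2)" if "i < m k" for k i
  proof (rule Bochner_Integration.integrable_bound)
    show "integrable M (\<lambda>\<omega>. (\<eta> k)\<^sup>2 * r\<^sup>2 * (norm (gap k i \<omega>))\<^sup>2)" by (intro integrable_mult_right gap_int that)
    show "AE \<omega> in M. norm ((norm (u k i \<omega>))\<^sup>2) \<le> norm ((\<eta> k)\<^sup>2 * r\<^sup>2 * (norm (gap k i \<omega>))\<^sup>2)"
      using u_le by (intro AE_I2) simp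
  qed (rule borel_measurable_power[OF measurable_compose[OF B.F_measurable[OF u_meas] borel_measurable_norm]])
  have s_pos: "0 < s"
    using gap_const_nonneg[OF \<open>0 < T\<close>, of \<sigma>] \<open>0 < T\<close> \<delta> by (simp add: s_def error_const_def add_nonneg_pos)
  have s_sq: "s\<^sup>2 = (r\<^sup>2 * gap_const \<sigma> T * T + 1) * \<delta> powr \<alpha>"
  proof -
    have "(\<delta> powr (\<alpha> / 2))\<^sup>2 = \<delta> powr \<alpha>" using \<delta> by (simp add: power2_eq_square flip: powr_add)
    moreover have "(error_const \<sigma> T)\<^sup>2 = r\<^sup>2 * gap_const \<sigma> T * T + 1"
      using gap_const_nonneg[OF \<open>0 < T\<close>, of \<sigma>] \<open>0 < T\<close> by (simp add: error_const_def r_def)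
    ultimately show ?thesis by (simp add: s_def power_mult_distrib)
  qed
  \<comment> \<open>Each shift is \<eta> times a vector of bounded second moment, so its squared
    norm over 2 \<eta> is of order \<eta>; summing over at most T / \<eta> cells leaves a bound free
    of \<open>k\<close>.\<close>
  have ent: "(\<Sum>i<m k. (\<integral>\<omega>. (norm (u k i \<omega>))\<^sup>2 \<partial>M) / (2 * \<eta> k)) \<le> s\<^sup>2" for k
  proof -
    define c where "c = r\<^sup>2 * gap_const \<sigma> T * \<delta> powr \<alpha>"
    have c0: "0 \<le> c" using gap_const_nonneg[OF \<open>0 < T\<close>, of \<sigma>] by (simp add: c_def)
    have "(\<integral>\<omega>. (norm (u k i \<omega>))\<^sup>2 \<partial>M) / (2 * \<eta> k) \<le> \<eta> k * c" if i: "i < m k" for i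
    proof -
      have "(\<integral>\<omega>. (norm (u k i \<omega>))\<^sup>2 \<partial>M) \<le> (\<integral>\<omega>. (\<eta> k)\<^sup>2 * r\<^sup>2 * (norm (gap k i \<omega>))\<^sup>2 \<partial>M)"
        by (intro integral_mono u_int i integrable_mult_right gap_int u_le)
      also have "\<dots> \<le> (\<eta> k)\<^sup>2 * r\<^sup>2 * (gap_const \<sigma> T * \<delta> powr \<alpha>)"
        using gap_int[OF i] by (simp add: mult_left_mono)
      also have "\<dots> = (\<eta> k)\<^sup>2 * c" by (simp add: c_def)
      finally have "(\<integral>\<omega>. (norm (u k i \<omega>))\<^sup>2 \<partial>M) / (2 * \<eta> k) \<le> (\<eta> k)\<^sup>2 * c / (2 * \<eta> k)"
        using \<eta>[of k] by (intro divide_right_mono) auto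
      also have "\<dots> = \<eta> k * c / 2" using \<eta>[of k] by (simp add: power2_eq_square)
      also have "\<dots> \<le> \<eta> k * c" using \<eta>[of k] c0 by simp
      finally show ?thesis .
    qed
    then have "(\<Sum>i<m k. (\<integral>\<omega>. (norm (u k i \<omega>))\<^sup>2 \<partial>M) / (2 * \<eta> k)) \<le> (\<Sum>i<m k. \<eta> k * c)"
      by (intro sum_mono) auto
    also have "\<dots> = (real (m k) * \<eta> k) * c" by simp
    also have "\<dots> \<le> T * c" using m[of k] t c0 by (intro mult_right_mono) auto
    also have "\<dots> \<le> s\<^sup>2" by (simp add: s_sq c_def algebra_simps)
    finally show ?thesis .
  qed
  define \<phi> where "\<phi> k w = f (em_path \<sigma> (\<eta> k) (Suc k) w (m k) (m k))" for k w
  have \<phi>_meas: "\<phi> k \<in> borel_measurable borel" for k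
    unfolding \<phi>_def
    by (intro measurable_compose[OF measurable_compose[OF em_path_measurable[OF \<eta>] coordinate_measurable]]
        borel_measurable_continuous_onI f)
  define P where "P k \<omega> = \<phi> k (B.shifted_noise (\<eta> k) (u k) (m k) \<omega>)" for k \<omega>
  define Q where "Q k \<omega> = \<phi> k (C.shifted_noise (\<eta> k) (\<lambda>_ _. 0) (m k) \<omega>)" for k \<omega>
  have f_meas: "f \<in> borel_measurable borel" using f by (rule borel_measurable_continuous_onI)
  have P_meas: "P k \<in> borel_measurable M" for k
    unfolding P_def using B.F_measurable[OF B.noise_adapted(1)[OF \<eta> u_meas]] by (rule measurable_compose[OF _ \<phi>_meas])
  have Q_meas: "Q k \<in> borel_measurable N" for k
    unfolding Q_def using C.F_measurable[OF C.noise_adapted(1)[OF \<eta>, of _ "\<lambda>_ _. 0"]]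
    by (intro measurable_compose[OF _ \<phi>_meas]) simp
  have compare: "\<bar>(\<integral>\<omega>. P k \<omega> \<partial>M) - (\<integral>\<omega>. Q k \<omega> \<partial>N)\<bar> \<le> 2 * S * s" for k
    unfolding P_def Q_def
    by (rule shifted_noise_compare[OF B.brownian_axioms C.brownian_axioms \<eta> u_meas u_int ent s_pos \<phi>_meas])
       (auto simp: \<phi>_def S)
  have X_meas: "X t \<in> borel_measurable M"
    using ws t \<tau>_pos by (simp add: weak_solution_def additive_sde_def)
  have Y_meas: "Y t \<in> borel_measurable N"
    using em t \<tau>_pos by (simp add: truncated_EM_scheme_def additive_sde_def)
  have cont_f: "isCont f x" for x using f continuous_on_eq_continuous_at[OF open_UNIV] by blast
  have "(\<lambda>k. \<integral>\<omega>. P k \<omega> \<partial>M) \<longlonglongrightarrow> (\<integral>\<omega>. f (X t \<omega>) \<partial>M)"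
  proof (rule integral_dominated_convergence[where w="\<lambda>_. S"])
    show "(\<lambda>\<omega>. f (X t \<omega>)) \<in> borel_measurable M" by (rule measurable_compose[OF X_meas f_meas])
    show "AE \<omega> in M. (\<lambda>k. P k \<omega>) \<longlonglongrightarrow> f (X t \<omega>)"
      using weak_solution_limit[OF ws inv \<delta>(1) t(1)]
      unfolding P_def \<phi>_def u_def gap_def m_def \<eta>_def
      by eventually_elim (rule isCont_tendsto_compose[OF cont_f])
    show "AE \<omega> in M. norm (P k \<omega>) \<le> S" for k using S by (simp add: P_def \<phi>_def)
  qed (auto simp: P_meas)
  moreover have "(\<lambda>k. \<integral>\<omega>. Q k \<omega> \<partial>N) \<longlonglongrightarrow> (\<integral>\<omega>. f (Y t \<omega>) \<partial>N)"
  proof (rule integral_dominated_convergence[where w="\<lambda>_. S"])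
    show "(\<lambda>\<omega>. f (Y t \<omega>)) \<in> borel_measurable N" by (rule measurable_compose[OF Y_meas f_meas])
    show "AE \<omega> in N. (\<lambda>k. Q k \<omega>) \<longlonglongrightarrow> f (Y t \<omega>)"
      using em_scheme_limit[OF em \<delta>(1) t(1)]
      unfolding Q_def \<phi>_def m_def \<eta>_def
      by eventually_elim (rule isCont_tendsto_compose[OF cont_f])
    show "AE \<omega> in N. norm (Q k \<omega>) \<le> S" for k using S by (simp add: Q_def \<phi>_def)
  qed (auto simp: Q_meas)
  ultimately have "(\<lambda>k. \<bar>(\<integral>\<omega>. P k \<omega> \<partial>M) - (\<integral>\<omega>. Q k \<omega> \<partial>N)\<bar>) \<longlonglongrightarrow> \<bar>(\<integral>\<omega>. f (X t \<omega>) \<partial>M) - (\<integral>\<omega>. f (Y t \<omega>) \<partial>N)\<bar>"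
    by (intro tendsto_intros)
  then show ?thesis unfolding s_def[symmetric] by (rule LIMSEQ_le_const2) (use compare in auto)
qed

end

theorem theorem3p1:
  fixes b :: "real ^ 'd \<Rightarrow> real ^ 'd"
    and Z :: "(real \<Rightarrow> real ^ 'd) \<Rightarrow> real ^ 'd"
    and \<sigma> :: "real ^ 'd ^ 'd"
    and \<xi> :: "real \<Rightarrow> real ^ 'd"
    and \<tau> L1 C \<beta> \<alpha> L2 T :: real
  assumes "\<tau> > 0"
    and "invertible \<sigma>"
    and "\<xi> \<in> seg_space \<tau>"
    and "\<forall>x y. norm (b x - b y) \<le> L1 * norm (x - y)"
    and "C > 0"
    and "\<forall>x. 2 * (x \<bullet> b x) \<le> C + \<beta> * (norm x)\<^sup>2"
    and "0 < \<alpha>" and "\<alpha> \<le> 1"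
    and "\<forall>\<zeta>\<in>seg_space \<tau>. \<forall>\<eta>\<in>seg_space \<tau>.
           norm (Z \<zeta> - Z \<eta>) \<le> L2 * seg_norm \<tau> (\<lambda>\<theta>. \<zeta> \<theta> - \<eta> \<theta>) powr \<alpha>"
    and "T > 0"
    and "2 * (hs_norm \<sigma>)\<^sup>2 * (hs_norm (matrix_inv \<sigma>))\<^sup>2 *
           ((4 * L1\<^sup>2 + L2\<^sup>2) * indicator {1} \<alpha> + L1\<^sup>2 * indicator {0<..<1} \<alpha>)
         < exp (- (1 + \<beta> * T)) / T\<^sup>2"
  shows "\<exists>C2 > 0.
           \<forall>(M :: 'v measure) F W X (N :: 'w measure) G V Y \<delta> f t.
             weak_solution \<tau> b Z \<sigma> \<xi> M F W X \<longrightarrow>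
             admissible_stepsize \<tau> \<delta> \<longrightarrow>
             truncated_EM_scheme \<tau> b Z \<sigma> \<xi> \<delta> N G V Y \<longrightarrow>
             f \<in> borel_measurable borel \<longrightarrow> bounded (range f) \<longrightarrow>
             t \<in> {0..T} \<longrightarrow>
             \<bar>(\<integral>\<omega>. f (X t \<omega>) \<partial>M) - (\<integral>\<omega>. f (Y t \<omega>) \<partial>N)\<bar>
               \<le> C2 * (SUP x. \<bar>f x\<bar>) * \<delta> powr (\<alpha> / 2)"
proof -
  \<comment> \<open>Absolute values meet the sign conditions of the locale and only weaken the
    assumed bounds.\<close>
  interpret delay_drift b Z \<xi> \<tau> "\<bar>L1\<bar>" "\<bar>L2\<bar>" \<alpha>
  proof
    show "continuous_on {-\<tau>..0} \<xi>" using assms(3) by (simp add: seg_space_def)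
    show "norm (b x - b y) \<le> \<bar>L1\<bar> * norm (x - y)" for x y
      using assms(4) by (meson abs_ge_self mult_right_mono norm_ge_zero order_trans)
    show "norm (Z \<zeta> - Z \<eta>) \<le> \<bar>L2\<bar> * seg_norm \<tau> (\<lambda>\<theta>. \<zeta> \<theta> - \<eta> \<theta>) powr \<alpha>"
      if "\<zeta> \<in> seg_space \<tau>" "\<eta> \<in> seg_space \<tau>" for \<zeta> \<eta>
      using assms(9) that by (meson abs_ge_self mult_right_mono powr_ge_zero order_trans)
  qed (use assms in auto)
  have "0 < error_const \<sigma> T"
    using gap_const_nonneg[OF \<open>T > 0\<close>, of \<sigma>] \<open>T > 0\<close> by (simp add: error_const_def add_nonneg_pos)
  moreover have "\<bar>(\<integral>\<omega>. f (X t \<omega>) \<partial>M) - (\<integral>\<omega>. f (Y t \<omega>) \<partial>N)\<bar> \<le> 2 * error_const \<sigma> T * (SUP x. \<bar>f x\<bar>) * \<delta> powr (\<alpha> / 2)"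
    if ws: "weak_solution \<tau> b Z \<sigma> \<xi> M F W X" and adm: "admissible_stepsize \<tau> \<delta>"
      and em: "truncated_EM_scheme \<tau> b Z \<sigma> \<xi> \<delta> N G V Y"
      and f: "f \<in> borel_measurable borel" "bounded (range f)" and t: "t \<in> {0..T}"
    for M :: "'v measure" and F W X and N :: "'w measure" and G V Y \<delta> f t
  proof -
    define S where "S = (SUP x. \<bar>f x\<bar>)"
    obtain K where "\<And>x. \<bar>f x\<bar> \<le> K" using f(2) unfolding bounded_iff by auto
    then have "bdd_above (range (\<lambda>x. \<bar>f x\<bar>))" by (rule bdd_aboveI2)
    then have S: "\<bar>f x\<bar> \<le> S" for x unfolding S_def by (intro cSUP_upper) auto
    have \<delta>: "0 < \<delta>" "\<delta> < 1" using adm by (auto simp: admissible_stepsize_def)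
    have t': "0 \<le> t" "t \<le> T" using t by auto
    have X: "X t \<in> borel_measurable M" using ws t' \<open>\<tau> > 0\<close> by (simp add: weak_solution_def additive_sde_def)
    have Y: "Y t \<in> borel_measurable N" using em t' \<open>\<tau> > 0\<close> by (simp add: truncated_EM_scheme_def additive_sde_def)
    have "prob_space M" "prob_space N"
      using ws em by (auto simp: weak_solution_def truncated_EM_scheme_def filtered_prob_space_def)
    \<comment> \<open>Passing to the laws of \<open>X t\<close> and \<open>Y t\<close> puts both
      expectations on the same space, where the two measures can be averaged.\<close>
    then have "\<bar>(\<integral>x. f x \<partial>distr M borel (X t)) - (\<integral>x. f x \<partial>distr N borel (Y t))\<bar> \<le> 2 * S * (error_const \<sigma> T * \<delta> powr (\<alpha> / 2))"
    proof (intro test_function_extension[OF _ _ _ _ _ f(1) S] prob_space.prob_space_distr X Y)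
      fix g :: "real ^ 'd \<Rightarrow> real" assume g: "continuous_on UNIV g" "\<And>x. \<bar>g x\<bar> \<le> S"
      have "g \<in> borel_measurable borel" using g(1) by (rule borel_measurable_continuous_onI)
      then show "\<bar>(\<integral>x. g x \<partial>distr M borel (X t)) - (\<integral>x. g x \<partial>distr N borel (Y t))\<bar> \<le> 2 * S * (error_const \<sigma> T * \<delta> powr (\<alpha> / 2))"
        using weak_error_continuous[OF ws em \<open>invertible \<sigma>\<close> \<delta> \<open>T > 0\<close> t' g]
        by (simp add: integral_distr X Y)
    qed auto
    then show ?thesis by (simp add: integral_distr X Y f(1) S_def mult_ac)
  qed
  ultimately show ?thesis by (intro exI[of _ "2 * error_const \<sigma> T"]) auto
qed

end
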